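(* Let $Q$ be a finite quiver on $k$ vertices with double quiver $\overline{Q}$, and let $V=\mathbb{C}^k\subset\mathbb{C}\overline{Q}$ be the vertex subalgebra. Then $\mathrm{dR}^0_V\,\mathbb{C}\overline{Q}$ with the Kontsevich bracket is isomorphic to the necklace Lie algebra $\mathbb{N}_Q$, and the sequence $$0\longrightarrow V\longrightarrow\mathbb{N}_Q\xrightarrow{\ \tau^{-1}d\ }\mathrm{Der}_\omega\,\mathbb{C}\overline{Q}\longrightarrow0$$ is an exact sequence (hence a central extension) of Lie algebras.
   Context: A quiver $Q$ is a finite directed graph with vertices $v_1,\dots,v_k$ and finite arrow set $Q_a$. The double quiver $\overline{Q}$ is obtained by adjoining, for every $a\in Q_a$ from $v_i$ to $v_j$, an arrow $a^*$ from $v_j$ to $v_i$. The path algebra $A=\mathbb{C}\overline{Q}$ has as basis all oriented paths, including length-zero vertex idempotents $e_1,\dots,e_k$; multiplication is concatenation, paths being written right to left (so $e_jae_i=a$ for $a$ from $v_i$ to $v_j$). $V=\bigoplus_i\mathbb{C}e_i$. Relative forms: $\Omega^n_VA=A\otimes_V\overline{A}_V\otimes_V\cdots\otimes_V\overline{A}_V$ ($n$ factors $\overline{A}_V=A/V$), where $(a_0,\dots,a_n)$ represents $a_0da_1\cdots da_n$; it is a differential graded algebra with product $(a_0,\dots,a_n)(a_{n+1},\dots,a_m)=\sum_{i=0}^n(-1)^{n-i}(a_0,\dots,a_{i-1},a_ia_{i+1},a_{i+2},\dots,a_m)$ and $d(a_0,\dots,a_n)=(1,a_0,\dots,a_n)$.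 The relative Karoubi complex is $\mathrm{dR}^n_VA=\Omega^n_VA/\sum_{i=0}^n[\Omega^i_VA,\Omega^{n-i}_VA]$ (supercommutators) with the induced differential $d$; in particular $\mathrm{dR}^0_VA=A/[A,A]$, which has as basis the necklace words in $\overline Q$ (equivalence classes of oriented cycles, including the $e_i$, under cyclic permutation of arrows). For an arrow $b$ of $\overline Q$ and a necklace word $w$, $\partial w/\partial b\in A$ is the sum, over all occurrences of $b$ in $w$, of the path obtained by opening the necklace and removing that occurrence. The Kontsevich bracket on $\mathrm{dR}^0_VA$ is $$\{w_1,w_2\}_K=\sum_{a\in Q_a}\Big(\frac{\partial w_1}{\partial a}\frac{\partial w_2}{\partial a^*}-\frac{\partial w_1}{\partial a^*}\frac{\partial w_2}{\partial a}\Big)\bmod[A,A].$$ The necklace Lie algebra $\mathbb{N}_Q$ has as basis the necklace words in $\overline{Q}$, with $[w_1,w_2]$ defined graphically: for every $a\in Q_a$, every occurrence of $a$ in $w_1$ and every occurrence of $a^*$ in $w_2$, remove these two factors, opening both necklaces, and reglue the open ends to form one necklace word; sum all of these; then subtract the analogous sum with the roles of $a$ and $a^*$ exchanged (occurrences of $a^*$ in $w_1$ and of $a$ in $w_2$). $\mathrm{Der}_VA$ is the Lie algebra of derivations $\theta$ of $A$ with $\theta(V)=0$. For such $\theta$, $L_\theta$ is the degree-preserving derivation of $\Omega^\bullet_VA$ with $L_\theta(a)=\theta(a)$, $L_\theta(da)=d\theta(a)$, and $i_\theta$ is the degree $-1$ super-derivation with $i_\theta(a)=0$, $i_\theta(da)=\theta(a)$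 for all $a\in A$; both induce operators on the Karoubi complex. Let $\omega=\sum_{a\in Q_a}da^*\,da\in\mathrm{dR}^2_VA$. The map $\tau:\mathrm{Der}_VA\to\mathrm{dR}^1_VA$, $\tau(\theta)=i_\theta(\omega)$, is a bijection. $\mathrm{Der}_\omega A=\{\theta\in\mathrm{Der}_VA: L_\theta\omega=0 \text{ in }\mathrm{dR}^2_VA\}$ is the Lie algebra of symplectic derivations under the commutator. In the sequence, $V$ is the abelian Lie algebra mapped into $\mathbb{N}_Q$ by sending $e_i$ to the length-zero necklace word $e_i$, and $\mathbb{N}_Q$ is identified with $\mathrm{dR}^0_VA$ via necklace words. *)

theory Defs
  imports Complex_Main "HOL-Library.Poly_Mapping" "HOL-Library.FuncSet"
    "Graph_Theory.Digraph" "Graph_Theory.Arc_Walk"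
begin

section \<open>Free complex vector spaces\<close>

text \<open>
  The free complex vector space on the type \<open>'a\<close> is \<open>'a \<Rightarrow>\<^sub>0 complex\<close>. The multiplication that
  the library puts on this type is not used; the product of the path algebra is defined below.
\<close>

definition cscale :: "complex \<Rightarrow> ('a \<Rightarrow>\<^sub>0 complex) \<Rightarrow> ('a \<Rightarrow>\<^sub>0 complex)"  (infixr "\<cdot>\<^sub>c" 75)
  where "c \<cdot>\<^sub>c f = Poly_Mapping.map ((*) c) f"

lemma lookup_cscale [simp]: "Poly_Mapping.lookup (c \<cdot>\<^sub>c f) x = c * Poly_Mapping.lookup f x"
  by (simp add: cscale_def Poly_Mapping.map.rep_eq when_def)

global_interpretation free: vector_space cscale
  by unfold_locales
    (auto intro!: poly_mapping_eqI simp: lookup_add algebra_simps)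

definition gen :: "'a \<Rightarrow> ('a \<Rightarrow>\<^sub>0 complex)"
  where "gen x = Poly_Mapping.single x 1"

definition lin_ext :: "('a \<Rightarrow> ('b \<Rightarrow>\<^sub>0 complex)) \<Rightarrow> ('a \<Rightarrow>\<^sub>0 complex) \<Rightarrow> ('b \<Rightarrow>\<^sub>0 complex)"
  where "lin_ext \<phi> f = (\<Sum>x\<in>Poly_Mapping.keys f. Poly_Mapping.lookup f x \<cdot>\<^sub>c \<phi> x)"

definition bilin_ext ::
  "('a \<Rightarrow> 'b \<Rightarrow> ('c \<Rightarrow>\<^sub>0 complex)) \<Rightarrow> ('a \<Rightarrow>\<^sub>0 complex) \<Rightarrow> ('b \<Rightarrow>\<^sub>0 complex) \<Rightarrow> ('c \<Rightarrow>\<^sub>0 complex)"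
  where "bilin_ext \<phi> f g = lin_ext (\<lambda>x. lin_ext (\<phi> x) g) f"


section \<open>Complex Lie algebras on carrier sets\<close>

record 'a lie_struct =
  lcarrier :: "'a set"
  ladd :: "'a \<Rightarrow> 'a \<Rightarrow> 'a"
  lzero :: "'a"
  lscale :: "complex \<Rightarrow> 'a \<Rightarrow> 'a"
  lbracket :: "'a \<Rightarrow> 'a \<Rightarrow> 'a"

locale lie_algebra =
  fixes L :: "'a lie_struct"
  assumes zero_closed: "lzero L \<in> lcarrier L"
    and add_closed: "x \<in> lcarrier L \<Longrightarrow> y \<in> lcarrier L \<Longrightarrow> ladd L x y \<in> lcarrier L"
    and scale_closed: "x \<in> lcarrier L \<Longrightarrow> lscale L c x \<in> lcarrier L"
    and bracket_closed: "x \<in> lcarrier L \<Longrightarrow> y \<in> lcarrier L \<Longrightarrow> lbracket L x y \<in> lcarrier L"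
    and add_assoc: "x \<in> lcarrier L \<Longrightarrow> y \<in> lcarrier L \<Longrightarrow> z \<in> lcarrier L \<Longrightarrow>
      ladd L (ladd L x y) z = ladd L x (ladd L y z)"
    and add_comm: "x \<in> lcarrier L \<Longrightarrow> y \<in> lcarrier L \<Longrightarrow> ladd L x y = ladd L y x"
    and add_zero: "x \<in> lcarrier L \<Longrightarrow> ladd L x (lzero L) = x"
    and add_inverse: "x \<in> lcarrier L \<Longrightarrow> \<exists>y\<in>lcarrier L. ladd L x y = lzero L"
    and scale_one: "x \<in> lcarrier L \<Longrightarrow> lscale L 1 x = x"
    and scale_scale: "x \<in> lcarrier L \<Longrightarrow> lscale L c (lscale L c' x) = lscale L (c * c') x"
    and scale_add_right: "x \<in> lcarrier L \<Longrightarrow> y \<in> lcarrier L \<Longrightarrow>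
      lscale L c (ladd L x y) = ladd L (lscale L c x) (lscale L c y)"
    and scale_add_left: "x \<in> lcarrier L \<Longrightarrow>
      lscale L (c + c') x = ladd L (lscale L c x) (lscale L c' x)"
    and bracket_add_left: "x \<in> lcarrier L \<Longrightarrow> y \<in> lcarrier L \<Longrightarrow> z \<in> lcarrier L \<Longrightarrow>
      lbracket L (ladd L x y) z = ladd L (lbracket L x z) (lbracket L y z)"
    and bracket_add_right: "x \<in> lcarrier L \<Longrightarrow> y \<in> lcarrier L \<Longrightarrow> z \<in> lcarrier L \<Longrightarrow>
      lbracket L x (ladd L y z) = ladd L (lbracket L x y) (lbracket L x z)"
    and bracket_scale_left: "x \<in> lcarrier L \<Longrightarrow> y \<in> lcarrier L \<Longrightarrow>
      lbracket L (lscale L c x) y = lscale L c (lbracket L x y)"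
    and bracket_scale_right: "x \<in> lcarrier L \<Longrightarrow> y \<in> lcarrier L \<Longrightarrow>
      lbracket L x (lscale L c y) = lscale L c (lbracket L x y)"
    and bracket_alternating: "x \<in> lcarrier L \<Longrightarrow> lbracket L x x = lzero L"
    and jacobi: "x \<in> lcarrier L \<Longrightarrow> y \<in> lcarrier L \<Longrightarrow> z \<in> lcarrier L \<Longrightarrow>
      ladd L (lbracket L x (lbracket L y z))
        (ladd L (lbracket L y (lbracket L z x)) (lbracket L z (lbracket L x y))) = lzero L"

definition lie_hom :: "'a lie_struct \<Rightarrow> 'b lie_struct \<Rightarrow> ('a \<Rightarrow> 'b) \<Rightarrow> bool"
  where "lie_hom L M f \<longleftrightarrow>
    f ` lcarrier L \<subseteq> lcarrier M \<and>
    (\<forall>x\<in>lcarrier L. \<forall>y\<in>lcarrier L. f (ladd L x y) = ladd M (f x) (f y)) \<and>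
    (\<forall>c. \<forall>x\<in>lcarrier L. f (lscale L c x) = lscale M c (f x)) \<and>
    (\<forall>x\<in>lcarrier L. \<forall>y\<in>lcarrier L. f (lbracket L x y) = lbracket M (f x) (f y))"

definition lie_iso :: "'a lie_struct \<Rightarrow> 'b lie_struct \<Rightarrow> ('a \<Rightarrow> 'b) \<Rightarrow> bool"
  where "lie_iso L M f \<longleftrightarrow> lie_hom L M f \<and> bij_betw f (lcarrier L) (lcarrier M)"

definition lie_short_exact ::
  "'a lie_struct \<Rightarrow> 'b lie_struct \<Rightarrow> 'c lie_struct \<Rightarrow> ('a \<Rightarrow> 'b) \<Rightarrow> ('b \<Rightarrow> 'c) \<Rightarrow> bool"
  where "lie_short_exact K L M f g \<longleftrightarrow>
    lie_algebra K \<and> lie_algebra L \<and> lie_algebra M \<and> lie_hom K L f \<and> lie_hom L M g \<and>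
    inj_on f (lcarrier K) \<and>
    f ` lcarrier K = {x \<in> lcarrier L. g x = lzero M} \<and>
    g ` lcarrier L = lcarrier M"

definition lie_center :: "'a lie_struct \<Rightarrow> 'a set"
  where "lie_center L = {x \<in> lcarrier L. \<forall>y\<in>lcarrier L. lbracket L x y = lzero L}"


section \<open>Quivers and path algebras\<close>

text \<open>
  A quiver is a \<open>fin_digraph\<close>: finitely many vertices and arrows; loops and parallel arrows are
  allowed. \<open>Star a\<close> is the reversed arrow adjoined for \<open>a\<close>.
\<close>

datatype 'e dbl = Arr 'e | Star 'e

definition double_quiver :: "('v, 'e) pre_digraph \<Rightarrow> ('v, 'e dbl) pre_digraph"
  where "double_quiver Q =
    \<lparr>verts = verts Q,
     arcs = Arr ` arcs Q \<union> Star ` arcs Q,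
     tail = (\<lambda>b. case b of Arr a \<Rightarrow> tail Q a | Star a \<Rightarrow> head Q a),
     head = (\<lambda>b. case b of Arr a \<Rightarrow> head Q a | Star a \<Rightarrow> tail Q a)\<rparr>"

text \<open>
  A path is a triple (source, arrows, target). The arrows are listed in the order in which they are
  traversed, so the list is the reverse of the word written right to left.
\<close>

type_synonym ('v, 'b) qpath = "'v \<times> 'b list \<times> 'v"

definition qpaths :: "('v, 'b) pre_digraph \<Rightarrow> ('v, 'b) qpath set"
  where "qpaths G = {(u, p, v). pre_digraph.awalk G u p v}"

definition trivial_paths :: "('v, 'b) pre_digraph \<Rightarrow> ('v, 'b) qpath set"
  where "trivial_paths G = {(v, [], v) | v. v \<in> verts G}"

type_synonym ('v, 'b) path_vec = "('v, 'b) qpath \<Rightarrow>\<^sub>0 complex"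

definition path_alg :: "('v, 'b) pre_digraph \<Rightarrow> ('v, 'b) path_vec set"
  where "path_alg G = {x. Poly_Mapping.keys x \<subseteq> qpaths G}"

definition vertex_alg :: "('v, 'b) pre_digraph \<Rightarrow> ('v, 'b) path_vec set"
  where "vertex_alg G = {x. Poly_Mapping.keys x \<subseteq> trivial_paths G}"

text \<open>In the product \<open>x y\<close> the path \<open>y\<close> is traversed first.\<close>

fun path_comp :: "('v, 'b) qpath \<Rightarrow> ('v, 'b) qpath \<Rightarrow> ('v, 'b) path_vec"
  where "path_comp (u, p, v) (u', p', v') = (if v' = u then gen (u', p' @ p, v) else 0)"

definition pmult :: "('v, 'b) path_vec \<Rightarrow> ('v, 'b) path_vec \<Rightarrow> ('v, 'b) path_vec"
    (infixl "\<odot>" 70)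
  where "pmult = bilin_ext path_comp"

definition pone :: "('v, 'b) pre_digraph \<Rightarrow> ('v, 'b) path_vec"
  where "pone G = (\<Sum>v\<in>verts G. gen (v, [], v))"

definition arrow :: "('v, 'b) pre_digraph \<Rightarrow> 'b \<Rightarrow> ('v, 'b) path_vec"
  where "arrow G b = gen (tail G b, [b], head G b)"


section \<open>Relative forms and the relative Karoubi complex\<close>

text \<open>
  \<open>preforms G n\<close> is the free vector space on the tuples \<open>(a\<^sub>0, \<dots>, a\<^sub>n)\<close> of elements of the path
  algebra. Its quotient by \<open>forms_null G n\<close> is the space of relative forms
  \<open>A \<otimes>\<^sub>V (A/V) \<otimes>\<^sub>V \<cdots> \<otimes>\<^sub>V (A/V)\<close>: the generators in \<open>tensor_rels\<close> say, in this order, that a tuple is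
  additive and homogeneous in each entry, is balanced over \<open>V\<close>, and vanishes as soon as one of
  \<open>a\<^sub>1, \<dots>, a\<^sub>n\<close> lies in \<open>V\<close>. The Karoubi complex is the further quotient by the supercommutators;
  the two quotients are taken in one step, by \<open>karoubi_null\<close>.
\<close>

type_synonym ('v, 'b) preform = "('v, 'b) path_vec list \<Rightarrow>\<^sub>0 complex"

definition preforms :: "('v, 'b) pre_digraph \<Rightarrow> nat \<Rightarrow> ('v, 'b) preform set"
  where "preforms G n =
    {x. Poly_Mapping.keys x \<subseteq> {as. length as = n + 1 \<and> set as \<subseteq> path_alg G}}"

definition tensor_rels :: "('v, 'b) pre_digraph \<Rightarrow> nat \<Rightarrow> ('v, 'b) preform set"
  where "tensor_rels G n =
    {gen (xs @ [a + b] @ ys) - gen (xs @ [a] @ ys) - gen (xs @ [b] @ ys) | xs a b ys.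
       set xs \<union> {a, b} \<union> set ys \<subseteq> path_alg G \<and> length xs + length ys = n} \<union>
    {gen (xs @ [c \<cdot>\<^sub>c a] @ ys) - c \<cdot>\<^sub>c gen (xs @ [a] @ ys) | xs c a ys.
       set xs \<union> {a} \<union> set ys \<subseteq> path_alg G \<and> length xs + length ys = n} \<union>
    {gen (xs @ [a \<odot> v, b] @ ys) - gen (xs @ [a, v \<odot> b] @ ys) | xs a v b ys.
       set xs \<union> {a, b} \<union> set ys \<subseteq> path_alg G \<and> v \<in> vertex_alg G \<and>
       length xs + length ys + 1 = n} \<union>
    {gen (xs @ [v] @ ys) | xs v ys.
       set xs \<union> set ys \<subseteq> path_alg G \<and> v \<in> vertex_alg G \<and> xs \<noteq> [] \<and>
       length xs + length ys = n}"

definition forms_null :: "('v, 'b) pre_digraph \<Rightarrow> nat \<Rightarrow> ('v, 'b) preform set"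
  where "forms_null G n = free.span (tensor_rels G n)"

text \<open>
  The product \<open>(a\<^sub>0, \<dots>, a\<^sub>n) (a\<^sub>n\<^sub>+\<^sub>1, \<dots>, a\<^sub>m)\<close>, with \<open>length as = n + 1\<close>.
\<close>

definition tuple_mult ::
  "('v, 'b) path_vec list \<Rightarrow> ('v, 'b) path_vec list \<Rightarrow> ('v, 'b) preform"
  where "tuple_mult as bs = (let cs = as @ bs; n = length as - 1 in
    \<Sum>i\<in>{0..n}. (- 1) ^ (n - i) \<cdot>\<^sub>c
      gen (take i cs @ [cs ! i \<odot> cs ! (i + 1)] @ drop (i + 2) cs))"

definition form_mult :: "('v, 'b) preform \<Rightarrow> ('v, 'b) preform \<Rightarrow> ('v, 'b) preform"
    (infixl "\<otimes>\<^sub>f" 70)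
  where "form_mult = bilin_ext tuple_mult"

definition form_d :: "('v, 'b) pre_digraph \<Rightarrow> ('v, 'b) preform \<Rightarrow> ('v, 'b) preform"
  where "form_d G = lin_ext (\<lambda>as. gen (pone G # as))"

definition supercommutators :: "('v, 'b) pre_digraph \<Rightarrow> nat \<Rightarrow> ('v, 'b) preform set"
  where "supercommutators G n =
    {x \<otimes>\<^sub>f y - (- 1) ^ (i * j) \<cdot>\<^sub>c (y \<otimes>\<^sub>f x) | x y i j.
       i + j = n \<and> x \<in> preforms G i \<and> y \<in> preforms G j}"

definition karoubi_null :: "('v, 'b) pre_digraph \<Rightarrow> nat \<Rightarrow> ('v, 'b) preform set"
  where "karoubi_null G n = free.span (forms_null G n \<union> supercommutators G n)"

definition karoubi_class ::
  "('v, 'b) pre_digraph \<Rightarrow> nat \<Rightarrow> ('v, 'b) preform \<Rightarrow> ('v, 'b) preform set"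
  where "karoubi_class G n x = {y \<in> preforms G n. y - x \<in> karoubi_null G n}"

definition karoubi :: "('v, 'b) pre_digraph \<Rightarrow> nat \<Rightarrow> ('v, 'b) preform set set"
  where "karoubi G n = karoubi_class G n ` preforms G n"

text \<open>
  The map into degree \<open>m\<close> of the Karoubi complex induced by a map \<open>\<phi>\<close> of representatives. If \<open>\<phi>\<close> is
  compatible with the quotients, the classes in the union coincide.
\<close>

definition induced ::
  "('v, 'b) pre_digraph \<Rightarrow> nat \<Rightarrow> (('v, 'b) preform \<Rightarrow> ('v, 'b) preform) \<Rightarrow>
   ('v, 'b) preform set \<Rightarrow> ('v, 'b) preform set"
  where "induced G m \<phi> X = (\<Union>x\<in>X. karoubi_class G m (\<phi> x))"

definition karoubi_d ::
  "('v, 'b) pre_digraph \<Rightarrow> nat \<Rightarrow> ('v, 'b) preform set \<Rightarrow> ('v, 'b) preform set"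
  where "karoubi_d G n = induced G (n + 1) (form_d G)"


section \<open>Relative derivations\<close>

text \<open>
  A derivation is a function on the carrier of the path algebra; it takes the value \<open>undefined\<close>
  elsewhere, so that equality of derivations is equality of functions.
\<close>

type_synonym ('v, 'b) path_der = "('v, 'b) path_vec \<Rightarrow> ('v, 'b) path_vec"

definition derivations :: "('v, 'b) pre_digraph \<Rightarrow> ('v, 'b) path_der set"
  where "derivations G = {\<theta> \<in> path_alg G \<rightarrow>\<^sub>E path_alg G.
    (\<forall>x\<in>path_alg G. \<forall>y\<in>path_alg G. \<theta> (x + y) = \<theta> x + \<theta> y) \<and>
    (\<forall>c. \<forall>x\<in>path_alg G. \<theta> (c \<cdot>\<^sub>c x) = c \<cdot>\<^sub>c \<theta> x) \<and>
    (\<forall>x\<in>path_alg G. \<forall>y\<in>path_alg G. \<theta> (x \<odot> y) = \<theta> x \<odot> y + x \<odot> \<theta> y) \<and>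
    (\<forall>v\<in>vertex_alg G. \<theta> v = 0)}"

text \<open>
  Since \<open>(a\<^sub>0, \<dots>, a\<^sub>n) = a\<^sub>0 da\<^sub>1 \<cdots> da\<^sub>n\<close>, the (super-)Leibniz rule expands the derivation \<open>L\<^sub>\<theta>\<close> with
  \<open>L\<^sub>\<theta>(a) = \<theta>(a)\<close>, \<open>L\<^sub>\<theta>(da) = d\<theta>(a)\<close> to \<open>\<Sum>\<^sub>i (a\<^sub>0, \<dots>, \<theta>(a\<^sub>i), \<dots>, a\<^sub>n)\<close>, and the super-derivation \<open>i\<^sub>\<theta>\<close>
  with \<open>i\<^sub>\<theta>(a) = 0\<close>, \<open>i\<^sub>\<theta>(da) = \<theta>(a)\<close> to
  \<open>\<Sum>\<^sub>i\<^sub>\<ge>\<^sub>1 (-1)\<^sup>i\<^sup>-\<^sup>1 (a\<^sub>0 da\<^sub>1 \<cdots> da\<^sub>i\<^sub>-\<^sub>1) (\<theta>(a\<^sub>i) da\<^sub>i\<^sub>+\<^sub>1 \<cdots> da\<^sub>n)\<close>.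
\<close>

definition form_lie :: "('v, 'b) path_der \<Rightarrow> ('v, 'b) preform \<Rightarrow> ('v, 'b) preform"
  where "form_lie \<theta> = lin_ext (\<lambda>as. \<Sum>i<length as. gen (as[i := \<theta> (as ! i)]))"

definition form_contract :: "('v, 'b) path_der \<Rightarrow> ('v, 'b) preform \<Rightarrow> ('v, 'b) preform"
  where "form_contract \<theta> = lin_ext (\<lambda>as. \<Sum>i\<in>{1..<length as}.
    (- 1) ^ (i - 1) \<cdot>\<^sub>c (gen (take i as) \<otimes>\<^sub>f gen (\<theta> (as ! i) # drop (i + 1) as)))"


section \<open>The symplectic form and symplectic derivations\<close>

text \<open>From here on \<open>Q\<close> is the original quiver, and \<open>A\<close> the path algebra of its double.\<close>

definition symp_form :: "('v, 'e) pre_digraph \<Rightarrow> ('v, 'e dbl) preform"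
  where "symp_form Q = (let D = double_quiver Q in
    \<Sum>a\<in>arcs Q. form_d D (gen [arrow D (Star a)]) \<otimes>\<^sub>f form_d D (gen [arrow D (Arr a)]))"

definition symp_class :: "('v, 'e) pre_digraph \<Rightarrow> ('v, 'e dbl) preform set"
  where "symp_class Q = karoubi_class (double_quiver Q) 2 (symp_form Q)"

definition tau :: "('v, 'e) pre_digraph \<Rightarrow> ('v, 'e dbl) path_der \<Rightarrow> ('v, 'e dbl) preform set"
  where "tau Q \<theta> = induced (double_quiver Q) 1 (form_contract \<theta>) (symp_class Q)"

definition symp_derivations :: "('v, 'e) pre_digraph \<Rightarrow> ('v, 'e dbl) path_der set"
  where "symp_derivations Q = {\<theta> \<in> derivations (double_quiver Q).
    induced (double_quiver Q) 2 (form_lie \<theta>) (symp_class Q) = karoubi_class (double_quiver Q) 2 0}"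

definition symp_lie :: "('v, 'e) pre_digraph \<Rightarrow> ('v, 'e dbl) path_der lie_struct"
  where "symp_lie Q = (let A = path_alg (double_quiver Q) in
    \<lparr>lcarrier = symp_derivations Q,
     ladd = (\<lambda>\<theta> \<eta>. \<lambda>x\<in>A. \<theta> x + \<eta> x),
     lzero = (\<lambda>x\<in>A. 0),
     lscale = (\<lambda>c \<theta>. \<lambda>x\<in>A. c \<cdot>\<^sub>c \<theta> x),
     lbracket = (\<lambda>\<theta> \<eta>. \<lambda>x\<in>A. \<theta> (\<eta> x) - \<eta> (\<theta> x))\<rparr>)"

definition vertex_lie :: "('v, 'e) pre_digraph \<Rightarrow> ('v, 'e dbl) path_vec lie_struct"
  where "vertex_lie Q =
    \<lparr>lcarrier = vertex_alg (double_quiver Q),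
     ladd = (+), lzero = 0, lscale = cscale, lbracket = (\<lambda>x y. 0)\<rparr>"


section \<open>The Kontsevich bracket\<close>

text \<open>
  \<open>open_at i p\<close> removes the arrow at position \<open>i\<close> of the cyclic word \<open>p\<close> and opens the word there; the
  resulting path starts at the head and ends at the tail of the removed arrow.
\<close>

definition open_at :: "nat \<Rightarrow> 'b list \<Rightarrow> 'b list"
  where "open_at i p = drop (i + 1) p @ take i p"

text \<open>
  \<open>\<partial>w/\<partial>b\<close>, where the necklace \<open>w\<close> is given by a closed path. A path that is not closed is a
  commutator and represents zero, and its derivative is zero accordingly.
\<close>

fun path_deriv :: "('v, 'b) pre_digraph \<Rightarrow> 'b \<Rightarrow> ('v, 'b) qpath \<Rightarrow> ('v, 'b) path_vec"
  where "path_deriv G b (u, p, v) =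
    (if u = v then \<Sum>i | i < length p \<and> p ! i = b. gen (head G b, open_at i p, tail G b) else 0)"

definition cyc_deriv :: "('v, 'b) pre_digraph \<Rightarrow> 'b \<Rightarrow> ('v, 'b) path_vec \<Rightarrow> ('v, 'b) path_vec"
  where "cyc_deriv G b = lin_ext (path_deriv G b)"

definition kontsevich ::
  "('v, 'e) pre_digraph \<Rightarrow> ('v, 'e dbl) path_vec \<Rightarrow> ('v, 'e dbl) path_vec \<Rightarrow> ('v, 'e dbl) path_vec"
  where "kontsevich Q x y = (let D = double_quiver Q in
    \<Sum>a\<in>arcs Q. cyc_deriv D (Arr a) x \<odot> cyc_deriv D (Star a) y
             - cyc_deriv D (Star a) x \<odot> cyc_deriv D (Arr a) y)"

definition class0 :: "('v, 'e) pre_digraph \<Rightarrow> ('v, 'e dbl) path_vec \<Rightarrow> ('v, 'e dbl) preform set"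
  where "class0 Q x = karoubi_class (double_quiver Q) 0 (gen [x])"

text \<open>
  Every class of degree zero is \<open>class0 Q x\<close> for some \<open>x\<close> in the path algebra; the bracket of two
  classes is computed on all such representatives.
\<close>

definition kontsevich_bracket ::
  "('v, 'e) pre_digraph \<Rightarrow> ('v, 'e dbl) preform set \<Rightarrow> ('v, 'e dbl) preform set \<Rightarrow>
   ('v, 'e dbl) preform set"
  where "kontsevich_bracket Q X Y =
    \<Union> {class0 Q (kontsevich Q x y) | x y.
        x \<in> path_alg (double_quiver Q) \<and> y \<in> path_alg (double_quiver Q) \<and>
        class0 Q x = X \<and> class0 Q y = Y}"

definition kontsevich_lie :: "('v, 'e) pre_digraph \<Rightarrow> ('v, 'e dbl) preform set lie_struct"
  where "kontsevich_lie Q = (let D = double_quiver Q in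
    \<lparr>lcarrier = karoubi D 0,
     ladd = (\<lambda>X Y. \<Union>x\<in>X. \<Union>y\<in>Y. karoubi_class D 0 (x + y)),
     lzero = karoubi_class D 0 0,
     lscale = (\<lambda>c. induced D 0 (cscale c)),
     lbracket = kontsevich_bracket Q\<rparr>)"


section \<open>The necklace Lie algebra\<close>

text \<open>
  Rotating the arrows of a closed path determines its new base point, except for trivial paths,
  which are related to themselves only.
\<close>

definition cyclic_rel :: "('v, 'b) pre_digraph \<Rightarrow> (('v, 'b) qpath \<times> ('v, 'b) qpath) set"
  where "cyclic_rel G = {((u, p, u), (u', p', u')) | u p u' p'.
    (u, p, u) \<in> qpaths G \<and> (u', p', u') \<in> qpaths G \<and>
    (\<exists>n. p' = rotate n p) \<and> (p = [] \<longrightarrow> u' = u)}"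

definition necklaces :: "('v, 'b) pre_digraph \<Rightarrow> ('v, 'b) qpath set set"
  where "necklaces G = {(u, p, u) | u p. (u, p, u) \<in> qpaths G} // cyclic_rel G"

definition necklace_of :: "('v, 'b) pre_digraph \<Rightarrow> ('v, 'b) qpath \<Rightarrow> ('v, 'b) qpath set"
  where "necklace_of G c = cyclic_rel G `` {c}"

definition necklace_rep :: "('v, 'b) qpath set \<Rightarrow> ('v, 'b) qpath"
  where "necklace_rep w = (SOME c. c \<in> w)"

type_synonym ('v, 'b) necklace_vec = "('v, 'b) qpath set \<Rightarrow>\<^sub>0 complex"

text \<open>
  Remove an occurrence of \<open>b\<close> from \<open>w\<close> and one of \<open>b'\<close> from \<open>w'\<close> in all possible ways and reglue. Here
  \<open>b'\<close> is the reverse of \<open>b\<close>: what remains of \<open>w'\<close> runs from the tail to the head of \<open>b\<close>, and what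
  remains of \<open>w\<close> runs back.
\<close>

definition reglue ::
  "('v, 'b) pre_digraph \<Rightarrow> 'b \<Rightarrow> 'b \<Rightarrow> ('v, 'b) qpath set \<Rightarrow> ('v, 'b) qpath set \<Rightarrow>
   ('v, 'b) necklace_vec"
  where "reglue G b b' w w' =
    (let p = fst (snd (necklace_rep w)); p' = fst (snd (necklace_rep w')) in
     \<Sum>i | i < length p \<and> p ! i = b. \<Sum>j | j < length p' \<and> p' ! j = b'.
       gen (necklace_of G (tail G b, open_at j p' @ open_at i p, tail G b)))"

definition necklace_bracket ::
  "('v, 'e) pre_digraph \<Rightarrow> ('v, 'e dbl) necklace_vec \<Rightarrow> ('v, 'e dbl) necklace_vec \<Rightarrow>
   ('v, 'e dbl) necklace_vec"
  where "necklace_bracket Q = bilin_ext (\<lambda>w w'.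
    let D = double_quiver Q in
    \<Sum>a\<in>arcs Q. reglue D (Arr a) (Star a) w w' - reglue D (Star a) (Arr a) w w')"

definition necklace_lie :: "('v, 'e) pre_digraph \<Rightarrow> ('v, 'e dbl) necklace_vec lie_struct"
  where "necklace_lie Q =
    \<lparr>lcarrier = {f. Poly_Mapping.keys f \<subseteq> necklaces (double_quiver Q)},
     ladd = (+), lzero = 0, lscale = cscale, lbracket = necklace_bracket Q\<rparr>"


section \<open>The maps of the sequence\<close>

definition necklace_class ::
  "('v, 'e) pre_digraph \<Rightarrow> ('v, 'e dbl) necklace_vec \<Rightarrow> ('v, 'e dbl) preform set"
  where "necklace_class Q f = class0 Q (lin_ext (\<lambda>w. gen (necklace_rep w)) f)"

definition vertex_to_necklace ::
  "('v, 'e) pre_digraph \<Rightarrow> ('v, 'e dbl) path_vec \<Rightarrow> ('v, 'e dbl) necklace_vec"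
  where "vertex_to_necklace Q = lin_ext (\<lambda>c. gen (necklace_of (double_quiver Q) c))"

definition tau_inv_d ::
  "('v, 'e) pre_digraph \<Rightarrow> ('v, 'e dbl) necklace_vec \<Rightarrow> ('v, 'e dbl) path_der"
  where "tau_inv_d Q f = inv_into (derivations (double_quiver Q)) (tau Q)
    (karoubi_d (double_quiver Q) 0 (necklace_class Q f))"

end

theory Submission
  imports Defs
begin

text \<open>
  Everything is dualised. A vector lies in a span iff it is killed by all functionals that kill the
  generators, so the Karoubi complex in degrees \<open>0, 1, 2\<close> is controlled by its functionals, here
  called traces. In degree one the Leibniz rule shows that a trace is determined by its values on
  the forms \<open>x db\<close> with \<open>b\<close> an arrow; this gives the bijectivity of \<open>\<tau>\<close> and the formula
  \<open>dw = \<Sum>\<^sub>b (\<partial>w/\<partial>b) db\<close>, so that \<open>\<theta>\<^sub>w = \<tau>\<^sup>-\<^sup>1dw\<close> sends \<open>a\<^sup>*\<close> to \<open>\<partial>w/\<partial>a\<close> and \<open>a\<close> to \<open>-\<partial>w/\<partial>a\<^sup>*\<close>.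
  Pulling traces back along \<open>i\<^sub>\<theta>\<close> and \<open>L\<^sub>\<theta>\<close> replaces the Cartan calculus. Writing \<open>\<theta>\<close>, \<open>\<theta>'\<close> for the
  derivations of \<open>w\<close>, \<open>w'\<close>, the bracket \<open>{w, w'}\<close> is the class of \<open>\<theta> w'\<close> and its derivation is
  \<open>[\<theta>, \<theta>']\<close>, so the Jacobi identity for necklaces is inherited from derivations. Contracting with
  the Euler derivation and dividing by the degree yields both exactness statements: symplectic
  derivations are Hamiltonian, and \<open>dw = 0\<close> forces \<open>w\<close> to have degree zero.
\<close>

section \<open>Functionals on free vector spaces\<close>

text \<open>The Karoubi spaces are quotients of the free space on all tuples of algebra elements, so
  a class has no visible normal form and operators act on it through unions over representatives.
  Functionals turn both difficulties into algebra: an operator descends to the quotient because a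
  trace composed with it is again a trace. Two explicit families of traces supply bases: the
  coordinates of \<open>form_coeff\<close> in degree one and those of \<open>necklace_proj\<close>
  in degree zero. Degree two gets no basis. Apart from the well-definedness of the Lie derivative,
  its traces enter through two constructions: evaluating one at \<open>a\<^sub>0 = 1\<close> gives a
  trace of degree one, which is dual to \<open>d\<close>, and contracting a trace of degree one with
  a derivation gives one of degree two. The vanishing of \<open>L\<^sub>\<theta>\<omega>\<close> is
  exploited by testing it on contracted traces, with the Euler derivation to find a Hamiltonian and
  with a second Hamiltonian derivation to compute a commutator.\<close>

lemma lin_ext_superset:
  assumes "finite S" "Poly_Mapping.keys f \<subseteq> S"
  shows "lin_ext \<phi> f = (\<Sum>x\<in>S. Poly_Mapping.lookup f x \<cdot>\<^sub>c \<phi> x)"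
  unfolding lin_ext_def
  by (rule sum.mono_neutral_left) (use assms in \<open>auto simp: in_keys_iff\<close>)

lemma lin_ext_add [simp]: "lin_ext \<phi> (f + g) = lin_ext \<phi> f + lin_ext \<phi> g"
proof -
  let ?S = "Poly_Mapping.keys f \<union> Poly_Mapping.keys g"
  have "Poly_Mapping.keys (f + g) \<subseteq> ?S" by (rule Poly_Mapping.keys_add)
  then show ?thesis
    by (simp add: lin_ext_superset[of ?S] lookup_add free.scale_left_distrib sum.distrib)
qed

lemma keys_cscale: "Poly_Mapping.keys (c \<cdot>\<^sub>c f) \<subseteq> Poly_Mapping.keys f"
  by (auto simp: in_keys_iff)

lemma lin_ext_scale [simp]: "lin_ext \<phi> (c \<cdot>\<^sub>c f) = c \<cdot>\<^sub>c lin_ext \<phi> f"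
  by (subst lin_ext_superset[OF _ keys_cscale]) (simp_all add: lin_ext_def free.scale_sum_right)

lemma lookup_gen: "Poly_Mapping.lookup (gen x) y = (if x = y then 1 else 0)"
  by (simp add: gen_def lookup_single when_def)

lemma keys_gen [simp]: "Poly_Mapping.keys (gen x) = {x}"
  by (auto simp: gen_def)

lemma lin_ext_gen [simp]: "lin_ext \<phi> (gen x) = \<phi> x"
  by (simp add: lin_ext_def lookup_gen)

lemma lin_ext_zero [simp]: "lin_ext \<phi> 0 = 0"
  by (simp add: lin_ext_def)

lemma lin_ext_minus [simp]: "lin_ext \<phi> (- f) = - lin_ext \<phi> f"
  by (rule minus_unique[symmetric]) (simp flip: lin_ext_add)

lemma lin_ext_diff [simp]: "lin_ext \<phi> (f - g) = lin_ext \<phi> f - lin_ext \<phi> g"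
  using lin_ext_add[of \<phi> f "- g"] by simp

lemma lin_ext_sum: "lin_ext \<phi> (\<Sum>i\<in>I. f i) = (\<Sum>i\<in>I. lin_ext \<phi> (f i))"
  by (induction I rule: infinite_finite_induct) auto

lemma lin_ext_add_fun: "lin_ext (\<lambda>x. \<phi> x + \<psi> x) f = lin_ext \<phi> f + lin_ext \<psi> f"
  by (simp add: lin_ext_def free.scale_right_distrib sum.distrib)

lemma lin_ext_scale_fun: "lin_ext (\<lambda>x. c \<cdot>\<^sub>c \<phi> x) f = c \<cdot>\<^sub>c lin_ext \<phi> f"
  by (simp add: lin_ext_def free.scale_sum_right mult.commute)

lemma lin_ext_gen_id [simp]: "lin_ext gen f = f"
proof (rule poly_mapping_eqI)
  fix x
  show "Poly_Mapping.lookup (lin_ext gen f) x = Poly_Mapping.lookup f x"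
    by (auto simp: lin_ext_def lookup_sum lookup_gen sum.delta if_distrib[of "\<lambda>y. _ * y"]
        in_keys_iff cong: if_cong)
qed

lemma vec_induct_on [consumes 1, case_names zero add scale gen]:
  assumes "Poly_Mapping.keys f \<subseteq> S"
    and "P 0"
    and "\<And>f g. Poly_Mapping.keys f \<subseteq> S \<Longrightarrow> Poly_Mapping.keys g \<subseteq> S \<Longrightarrow> P f \<Longrightarrow> P g \<Longrightarrow> P (f + g)"
    and "\<And>c f. Poly_Mapping.keys f \<subseteq> S \<Longrightarrow> P f \<Longrightarrow> P (c \<cdot>\<^sub>c f)"
    and "\<And>x. x \<in> S \<Longrightarrow> P (gen x)"
  shows "P f"
proof -
  have "P (\<Sum>x\<in>T. Poly_Mapping.lookup f x \<cdot>\<^sub>c gen x) \<and>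
      Poly_Mapping.keys (\<Sum>x\<in>T. Poly_Mapping.lookup f x \<cdot>\<^sub>c gen x) \<subseteq> S"
    if "finite T" "T \<subseteq> S" for T
    using that
  proof (induction T)
    case (insert x T)
    have 1: "Poly_Mapping.keys (Poly_Mapping.lookup f x \<cdot>\<^sub>c gen x) \<subseteq> S"
      using insert.prems keys_cscale[of "Poly_Mapping.lookup f x" "gen x"] by auto
    moreover have "P (Poly_Mapping.lookup f x \<cdot>\<^sub>c gen x)"
      using insert.prems by (intro assms(4,5)) auto
    moreover note insert
    ultimately show ?case
      using Poly_Mapping.keys_add[of "Poly_Mapping.lookup f x \<cdot>\<^sub>c gen x" "\<Sum>x\<in>T. Poly_Mapping.lookup f x \<cdot>\<^sub>c gen x"]
      by (auto intro!: assms(3))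
  qed (simp add: assms(2))
  from this[OF finite_keys assms(1)] show ?thesis
    using lin_ext_gen_id[of f] by (simp add: lin_ext_def)
qed

lemma vec_induct [case_names zero add scale gen]:
  assumes "P 0" "\<And>f g. P f \<Longrightarrow> P g \<Longrightarrow> P (f + g)" "\<And>c f. P f \<Longrightarrow> P (c \<cdot>\<^sub>c f)" "\<And>x. P (gen x)"
  shows "P f"
  using assms by (intro vec_induct_on[of f UNIV P]) auto

lemma bilin_ext_linear:
  "bilin_ext \<phi> (x + x') y = bilin_ext \<phi> x y + bilin_ext \<phi> x' y"
  "bilin_ext \<phi> x (y + y') = bilin_ext \<phi> x y + bilin_ext \<phi> x y'"
  "bilin_ext \<phi> (c \<cdot>\<^sub>c x) y = c \<cdot>\<^sub>c bilin_ext \<phi> x y"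
  "bilin_ext \<phi> x (c \<cdot>\<^sub>c y) = c \<cdot>\<^sub>c bilin_ext \<phi> x y"
  "bilin_ext \<phi> 0 y = 0" "bilin_ext \<phi> x 0 = 0"
  "bilin_ext \<phi> (- x) y = - bilin_ext \<phi> x y" "bilin_ext \<phi> x (- y) = - bilin_ext \<phi> x y"
  "bilin_ext \<phi> (x - x') y = bilin_ext \<phi> x y - bilin_ext \<phi> x' y"
  "bilin_ext \<phi> x (y - y') = bilin_ext \<phi> x y - bilin_ext \<phi> x y'"
proof -
  show *: "bilin_ext \<phi> x (y + y') = bilin_ext \<phi> x y + bilin_ext \<phi> x y'"
    "bilin_ext \<phi> x (c \<cdot>\<^sub>c y) = c \<cdot>\<^sub>c bilin_ext \<phi> x y" "bilin_ext \<phi> x 0 = 0" for y y'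
    by (simp_all add: bilin_ext_def lin_ext_add_fun lin_ext_scale_fun) (simp add: lin_ext_def)
  show "bilin_ext \<phi> x (- y) = - bilin_ext \<phi> x y"
    by (rule minus_unique[symmetric]) (simp flip: *(1) add: *(3))
  show "bilin_ext \<phi> x (y - y') = bilin_ext \<phi> x y - bilin_ext \<phi> x y'"
    by (metis *(1) add_diff_cancel_right' diff_add_cancel)
qed (simp_all add: bilin_ext_def)

lemma bilin_ext_gen [simp]: "bilin_ext \<phi> (gen x) (gen y) = \<phi> x y"
  by (simp add: bilin_ext_def)

section \<open>Linear functionals and membership in spans\<close>

definition pair :: "('a \<Rightarrow> complex) \<Rightarrow> ('a \<Rightarrow>\<^sub>0 complex) \<Rightarrow> complex"
  where "pair t f = (\<Sum>x\<in>Poly_Mapping.keys f. Poly_Mapping.lookup f x * t x)"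

lemma pair_superset:
  assumes "finite S" "Poly_Mapping.keys f \<subseteq> S"
  shows "pair t f = (\<Sum>x\<in>S. Poly_Mapping.lookup f x * t x)"
  unfolding pair_def
  by (rule sum.mono_neutral_left) (use assms in \<open>auto simp: in_keys_iff\<close>)

lemma pair_add [simp]: "pair t (f + g) = pair t f + pair t g"
proof -
  let ?S = "Poly_Mapping.keys f \<union> Poly_Mapping.keys g"
  have "Poly_Mapping.keys (f + g) \<subseteq> ?S" by (rule Poly_Mapping.keys_add)
  then show ?thesis
    by (simp add: pair_superset[of ?S] lookup_add distrib_right sum.distrib)
qed

lemma pair_scale [simp]: "pair t (c \<cdot>\<^sub>c f) = c * pair t f"
  by (subst pair_superset[OF _ keys_cscale]) (simp_all add: pair_def sum_distrib_left mult.assoc)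

lemma pair_gen [simp]: "pair t (gen x) = t x"
  by (simp add: pair_def lookup_gen)

lemma pair_zero [simp]: "pair t 0 = 0"
  by (simp add: pair_def)

lemma pair_minus [simp]: "pair t (- f) = - pair t f"
  by (rule minus_unique[symmetric]) (simp flip: pair_add)

lemma pair_diff [simp]: "pair t (f - g) = pair t f - pair t g"
  using pair_add[of t f "- g"] by simp

lemma pair_sum: "pair t (\<Sum>i\<in>I. f i) = (\<Sum>i\<in>I. pair t (f i))"
  by (induction I rule: infinite_finite_induct) auto

lemma pair_lin_ext: "pair t (lin_ext \<phi> f) = pair (\<lambda>x. pair t (\<phi> x)) f"
  by (induction f rule: vec_induct) simp_all

text \<open>Every linear functional on a free space is some \<open>pair t\<close>, and over a field
  a vector outside a span is separated from it by a functional.\<close>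

lemma in_span_iff_pair:
  "x \<in> free.span S \<longleftrightarrow> (\<forall>t. (\<forall>s\<in>S. pair t s = 0) \<longrightarrow> pair t x = 0)"
proof
  assume x: "x \<in> free.span S"
  show "\<forall>t. (\<forall>s\<in>S. pair t s = 0) \<longrightarrow> pair t x = 0"
  proof (intro allI impI)
    fix t assume "\<forall>s\<in>S. pair t s = 0"
    with x show "pair t x = 0"
      by (induction rule: free.span_induct_alt) auto
  qed
next
  assume *: "\<forall>t. (\<forall>s\<in>S. pair t s = 0) \<longrightarrow> pair t x = 0"
  show "x \<in> free.span S"
  proof (rule ccontr)
    assume x: "x \<notin> free.span S"
    interpret vp: vector_space_pair "cscale :: _ \<Rightarrow> ('a \<Rightarrow>\<^sub>0 complex) \<Rightarrow> _" "(*) :: complex \<Rightarrow> complex \<Rightarrow> complex"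
      by unfold_locales (auto simp: algebra_simps)
    obtain B where B: "B \<subseteq> S" "free.independent B" "S \<subseteq> free.span B"
      by (rule free.maximal_independent_subset)
    \<comment> \<open>A basis of the span stays independent after adjoining \<open>x\<close>, so a
      functional may be prescribed as 1 at \<open>x\<close> and 0 on the basis.\<close>
    have "x \<notin> free.span B" using x free.span_mono[OF B(1)] by blast
    then have "free.independent (insert x B)"
      using B(2) free.independent_insertI by blast
    then obtain h where h: "Vector_Spaces.linear cscale (*) h"
      "\<forall>y\<in>insert x B. h y = (if y = x then 1 else 0)"
      using vp.linear_independent_extend[of "insert x B" "\<lambda>y. if y = x then 1 else 0"] by blast
    interpret h: Vector_Spaces.linear cscale "(*)" h by (rule h(1))
    have hp: "h y = pair (\<lambda>z. h (gen z)) y" for y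
      by (induction y rule: vec_induct) (simp_all add: h.add h.scale h.zero)
    have "h y = 0" if "y \<in> free.span B" for y
      using that
    proof (induction rule: free.span_induct_alt)
      case (step c b y)
      then have "h b = 0" using h(2) \<open>x \<notin> free.span B\<close> free.span_base[of b B] by auto
      with step show ?case by (simp add: h.add h.scale)
    qed (simp add: h.zero)
    then have "\<forall>s\<in>S. pair (\<lambda>z. h (gen z)) s = 0"
      using B(3) by (auto simp flip: hp)
    then have "pair (\<lambda>z. h (gen z)) x = 0" using * by blast
    then have "h x = 0" by (simp flip: hp)
    then show False using h(2) by simp
  qed
qed

section \<open>Products and derivations of paths\<close>

lemmas pmult_linear [simp] = bilin_ext_linear[of path_comp, folded pmult_def]

lemma pmult_sum_left: "(\<Sum>i\<in>I. f i) \<odot> y = (\<Sum>i\<in>I. f i \<odot> y)"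
  by (induction I rule: infinite_finite_induct) auto

lemma pmult_sum_right: "y \<odot> (\<Sum>i\<in>I. f i) = (\<Sum>i\<in>I. y \<odot> f i)"
  by (induction I rule: infinite_finite_induct) auto

lemma pmult_gen:
  "gen (u, p, v) \<odot> gen (u', p', v') = (if v' = u then gen (u', p' @ p, v) else 0)"
  by (simp add: pmult_def)

lemma pmult_assoc: "(x \<odot> y) \<odot> z = x \<odot> (y \<odot> z)"
proof (induction x rule: vec_induct)
  case (gen p)
  show ?case
  proof (induction y rule: vec_induct)
    case (gen q)
    show ?case
      by (induction z rule: vec_induct) (cases p; cases q; auto simp: pmult_gen)+
  qed simp_all
qed simp_all

text \<open>
  For an arrow \<open>c\<close> of a path, the arguments \<open>l\<close> and \<open>r\<close> in \<open>g c l r\<close> are the parts of the path that are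
  traversed after and before \<open>c\<close>, so that the path is the product \<open>l c r\<close>.
\<close>

definition arrow_sum ::
  "('v, 'b) pre_digraph \<Rightarrow> ('b \<Rightarrow> ('v, 'b) path_vec \<Rightarrow> ('v, 'b) path_vec \<Rightarrow> ('v, 'b) path_vec) \<Rightarrow>
   ('v, 'b) path_vec \<Rightarrow> ('v, 'b) path_vec"
  where "arrow_sum G g = lin_ext (\<lambda>(u, p, v). \<Sum>i<length p.
    g (p ! i) (gen (head G (p ! i), drop (Suc i) p, v)) (gen (u, take i p, tail G (p ! i))))"

lemma arrow_sum_gen:
  "arrow_sum G g (gen (u, p, v)) = (\<Sum>i<length p.
    g (p ! i) (gen (head G (p ! i), drop (Suc i) p, v)) (gen (u, take i p, tail G (p ! i))))"
  by (simp add: arrow_sum_def)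

lemma arrow_sum_simps [simp]:
  "arrow_sum G g (x + y) = arrow_sum G g x + arrow_sum G g y"
  "arrow_sum G g (c \<cdot>\<^sub>c x) = c \<cdot>\<^sub>c arrow_sum G g x"
  "arrow_sum G g 0 = 0"
  "arrow_sum G g (- x) = - arrow_sum G g x"
  "arrow_sum G g (x - y) = arrow_sum G g x - arrow_sum G g y"
  by (simp_all add: arrow_sum_def)

lemma arrow_sum_add_fun:
  "arrow_sum G (\<lambda>c l r. g c l r + h c l r) x = arrow_sum G g x + arrow_sum G h x"
  by (induction x rule: vec_induct)
    (auto simp: arrow_sum_gen sum.distrib free.scale_right_distrib)

lemma arrow_sum_scale_fun:
  "arrow_sum G (\<lambda>c l r. k \<cdot>\<^sub>c g c l r) x = k \<cdot>\<^sub>c arrow_sum G g x"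
  by (induction x rule: vec_induct)
    (auto simp: arrow_sum_gen free.scale_sum_right free.scale_right_distrib mult.commute)

lemma sum_lessThan_add: "(\<Sum>i<m + n. f i) = (\<Sum>i<m. f i) + (\<Sum>j<n. f (m + j :: nat))"
  for f :: "nat \<Rightarrow> 'a::comm_monoid_add"
  by (induction n) (auto simp: add.assoc)

text \<open>The arrows of the composite are those of \<open>z\<close> followed by those of
  \<open>y\<close>: an arrow of \<open>z\<close> has \<open>y\<close> appended to its later part, an
  arrow of \<open>y\<close> has \<open>z\<close> prepended to its earlier part. If the paths do not
  compose, each summand on the right contains a zero product, and the assumptions on
  \<open>g\<close> make it vanish.\<close>

lemma arrow_sum_mult_gen:
  assumes "\<And>c l. g c l 0 = 0" "\<And>c r. g c 0 r = 0"
  shows "arrow_sum G g (gen y \<odot> gen z) =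
    arrow_sum G (\<lambda>c l r. g c (gen y \<odot> l) r) (gen z) + arrow_sum G (\<lambda>c l r. g c l (r \<odot> gen z)) (gen y)"
proof -
  obtain u q v where y: "y = (u, q, v)" by (cases y)
  obtain u' q' v' where z: "z = (u', q', v')" by (cases z)
  show ?thesis
  proof (cases "v' = u")
    case True
    then show ?thesis
      by (simp add: y z pmult_gen arrow_sum_gen sum_lessThan_add nth_append)
  next
    case False
    then show ?thesis
      by (simp add: y z pmult_gen arrow_sum_gen assms)
  qed
qed

text \<open>The component at \<open>b\<close> of the \<open>1\<close>-form \<open>x dy\<close>, written cyclically as \<open>\<Sum>\<^sub>b (\<dots>) db\<close>.\<close>

definition form_coeff ::
  "('v, 'b) pre_digraph \<Rightarrow> 'b \<Rightarrow> ('v, 'b) path_vec \<Rightarrow> ('v, 'b) path_vec \<Rightarrow> ('v, 'b) path_vec"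
  where "form_coeff G b x = arrow_sum G (\<lambda>c l r. if c = b then r \<odot> x \<odot> l else 0)"

lemma form_coeff_gen:
  "form_coeff G b x (gen (u, p, v)) = (\<Sum>i | i < length p \<and> p ! i = b.
    gen (u, take i p, tail G b) \<odot> x \<odot> gen (head G b, drop (Suc i) p, v))"
proof -
  have "{i. i < length p \<and> p ! i = b} = {i \<in> {..<length p}. p ! i = b}" by auto
  then show ?thesis
    by (simp only: form_coeff_def arrow_sum_gen sum.inter_filter finite_lessThan)
      (intro sum.cong, auto)
qed

lemma form_coeff_right [simp]:
  "form_coeff G b x (y + z) = form_coeff G b x y + form_coeff G b x z"
  "form_coeff G b x (k \<cdot>\<^sub>c y) = k \<cdot>\<^sub>c form_coeff G b x y"
  "form_coeff G b x 0 = 0"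
  "form_coeff G b x (- y) = - form_coeff G b x y"
  "form_coeff G b x (y - z) = form_coeff G b x y - form_coeff G b x z"
  by (simp_all add: form_coeff_def)

lemma form_coeff_left [simp]:
  "form_coeff G b (x + y) z = form_coeff G b x z + form_coeff G b y z"
  "form_coeff G b (k \<cdot>\<^sub>c x) z = k \<cdot>\<^sub>c form_coeff G b x z"
  "form_coeff G b 0 z = 0"
proof -
  show "form_coeff G b (x + y) z = form_coeff G b x z + form_coeff G b y z"
    unfolding form_coeff_def arrow_sum_add_fun[symmetric]
    by (rule arg_cong[where f = "\<lambda>g. arrow_sum G g z"]) (auto simp: fun_eq_iff)
  show "form_coeff G b (k \<cdot>\<^sub>c x) z = k \<cdot>\<^sub>c form_coeff G b x z"
    unfolding form_coeff_def arrow_sum_scale_fun[symmetric]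
    by (rule arg_cong[where f = "\<lambda>g. arrow_sum G g z"]) (auto simp: fun_eq_iff)
  show "form_coeff G b 0 z = 0"
    by (induction z rule: vec_induct) (auto simp: form_coeff_gen)
qed

text \<open>The Leibniz rule \<open>x d(yz) = xy dz + x dy z\<close>, with the trailing
  \<open>z\<close> rotated to the front. This is the identity that makes coefficients compatible
  with commutators.\<close>

lemma form_coeff_mult:
  "form_coeff G b x (y \<odot> z) = form_coeff G b (x \<odot> y) z + form_coeff G b (z \<odot> x) y"
proof (induction y rule: vec_induct)
  case (gen p)
  show ?case
  proof (induction z rule: vec_induct)
    case (gen q)
    have "form_coeff G b x (gen p \<odot> gen q) =
      arrow_sum G (\<lambda>c l r. if c = b then r \<odot> x \<odot> (gen p \<odot> l) else 0) (gen q) +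
      arrow_sum G (\<lambda>c l r. if c = b then (r \<odot> gen q) \<odot> x \<odot> l else 0) (gen p)"
      unfolding form_coeff_def by (rule arrow_sum_mult_gen) auto
    then show ?case by (simp add: form_coeff_def pmult_assoc cong: if_cong)
  qed (simp_all add: algebra_simps free.scale_right_distrib)
qed (simp_all add: algebra_simps free.scale_right_distrib)

section \<open>Derivations prescribed on arrows\<close>

definition path_derivation ::
  "('v, 'b) pre_digraph \<Rightarrow> ('b \<Rightarrow> ('v, 'b) path_vec) \<Rightarrow> ('v, 'b) path_vec \<Rightarrow> ('v, 'b) path_vec"
  where "path_derivation G \<phi> = arrow_sum G (\<lambda>c l r. l \<odot> \<phi> c \<odot> r)"

lemma path_derivation_linear [simp]:
  "path_derivation G \<phi> (y + z) = path_derivation G \<phi> y + path_derivation G \<phi> z"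
  "path_derivation G \<phi> (k \<cdot>\<^sub>c y) = k \<cdot>\<^sub>c path_derivation G \<phi> y"
  "path_derivation G \<phi> 0 = 0"
  by (simp_all add: path_derivation_def)

lemma path_derivation_mult:
  "path_derivation G \<phi> (y \<odot> z) = path_derivation G \<phi> y \<odot> z + y \<odot> path_derivation G \<phi> z"
proof (induction y rule: vec_induct)
  case (gen p)
  show ?case
  proof (induction z rule: vec_induct)
    case (gen q)
    have "path_derivation G \<phi> (gen p \<odot> gen q) =
      arrow_sum G (\<lambda>c l r. (gen p \<odot> l) \<odot> \<phi> c \<odot> r) (gen q) +
      arrow_sum G (\<lambda>c l r. l \<odot> \<phi> c \<odot> (r \<odot> gen q)) (gen p)"
      unfolding path_derivation_def by (rule arrow_sum_mult_gen) auto
    then show ?case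
      by (cases p; cases q) (simp add: path_derivation_def arrow_sum_gen pmult_assoc
        pmult_sum_left pmult_sum_right add.commute)
  qed (simp_all add: algebra_simps free.scale_right_distrib)
qed (simp_all add: algebra_simps free.scale_right_distrib)

section \<open>The path algebra and its relative derivations\<close>

context wf_digraph
begin

abbreviation A where "A \<equiv> path_alg G"
abbreviation V where "V \<equiv> vertex_alg G"
abbreviation idem :: "'a \<Rightarrow> ('a, 'b) path_vec" where "idem v \<equiv> gen (v, [], v)"

lemma gen_in_path_alg [simp]: "gen p \<in> A \<longleftrightarrow> p \<in> qpaths G"
  by (simp add: path_alg_def)

lemma qpaths_iff [simp]: "(u, p, v) \<in> qpaths G \<longleftrightarrow> awalk u p v"
  by (simp add: qpaths_def)

lemma path_alg_add [simp]: "x \<in> A \<Longrightarrow> y \<in> A \<Longrightarrow> x + y \<in> A"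
  using Poly_Mapping.keys_add[of x y] by (auto simp: path_alg_def)

lemma path_alg_scale [simp]: "x \<in> A \<Longrightarrow> c \<cdot>\<^sub>c x \<in> A"
  using keys_cscale[of c x] by (auto simp: path_alg_def)

lemma path_alg_zero [simp]: "0 \<in> A"
  by (simp add: path_alg_def)

lemma path_alg_minus [simp]: "x \<in> A \<Longrightarrow> - x \<in> A"
  by (simp add: path_alg_def)

lemma path_alg_diff [simp]: "x \<in> A \<Longrightarrow> y \<in> A \<Longrightarrow> x - y \<in> A"
  using path_alg_add[of x "- y"] by simp

lemma path_alg_sum [simp]: "(\<And>i. i \<in> I \<Longrightarrow> f i \<in> A) \<Longrightarrow> (\<Sum>i\<in>I. f i) \<in> A"
  by (induction I rule: infinite_finite_induct) auto

lemma path_alg_induct [consumes 1, case_names zero add scale gen]: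
  assumes "x \<in> A" "P 0"
    and "\<And>x y. x \<in> A \<Longrightarrow> y \<in> A \<Longrightarrow> P x \<Longrightarrow> P y \<Longrightarrow> P (x + y)"
    and "\<And>c x. x \<in> A \<Longrightarrow> P x \<Longrightarrow> P (c \<cdot>\<^sub>c x)"
    and "\<And>u p v. awalk u p v \<Longrightarrow> P (gen (u, p, v))"
  shows "P x"
  using assms by (intro vec_induct_on[of x "qpaths G" P]) (auto simp: path_alg_def)

lemma path_alg_mult [simp]:
  assumes "x \<in> A" "y \<in> A"
  shows "x \<odot> y \<in> A"
  using assms
proof (induction x rule: path_alg_induct)
  case (gen u p v)
  from gen(2,1) show ?case
    by (induction y rule: path_alg_induct) (auto simp: pmult_gen intro: awalk_appendI)
qed auto

lemma vertex_alg_subset: "x \<in> V \<Longrightarrow> x \<in> A"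
  by (auto simp: vertex_alg_def path_alg_def trivial_paths_def awalk_Nil_iff)

lemma vertex_alg_induct [consumes 1, case_names zero add scale idem]:
  assumes "x \<in> V" "P 0"
    and "\<And>x y. x \<in> V \<Longrightarrow> y \<in> V \<Longrightarrow> P x \<Longrightarrow> P y \<Longrightarrow> P (x + y)"
    and "\<And>c x. x \<in> V \<Longrightarrow> P x \<Longrightarrow> P (c \<cdot>\<^sub>c x)"
    and "\<And>v. v \<in> verts G \<Longrightarrow> P (idem v)"
  shows "P x"
  using assms
  by (intro vec_induct_on[of x "trivial_paths G" P]) (auto simp: vertex_alg_def trivial_paths_def)

lemma idem_in_vertex_alg [simp]: "v \<in> verts G \<Longrightarrow> idem v \<in> V"
  by (simp add: vertex_alg_def trivial_paths_def)

lemma vertex_alg_add [simp]: "x \<in> V \<Longrightarrow> y \<in> V \<Longrightarrow> x + y \<in> V"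
  using Poly_Mapping.keys_add[of x y] by (auto simp: vertex_alg_def)

lemma vertex_alg_scale [simp]: "x \<in> V \<Longrightarrow> c \<cdot>\<^sub>c x \<in> V"
  using keys_cscale[of c x] by (auto simp: vertex_alg_def)

lemma vertex_alg_zero [simp]: "0 \<in> V"
  by (simp add: vertex_alg_def)

lemma pone_in_vertex_alg [simp]: "pone G \<in> V"
proof -
  have "(\<Sum>v\<in>S. idem v) \<in> V" if "S \<subseteq> verts G" for S
    using that by (induction S rule: infinite_finite_induct) auto
  then show ?thesis by (simp add: pone_def)
qed

lemma pone_in_path_alg [simp]: "pone G \<in> A"
  using pone_in_vertex_alg by (rule vertex_alg_subset)

lemma arrow_in_path_alg [simp]: "b \<in> arcs G \<Longrightarrow> arrow G b \<in> A"
  by (simp add: arrow_def arc_implies_awalk)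

lemma form_coeff_vertex:
  assumes "v \<in> V"
  shows "form_coeff G b x v = 0"
  using assms by (induction v rule: vertex_alg_induct) (auto simp: form_coeff_gen)

lemma awalk_append_Cons:
  assumes "awalk u (p @ b # q) v"
  shows "awalk u p (tail G b)" "awalk (head G b) q v"
  using assms by (auto simp: awalk_append_iff awalk_Cons_iff)

lemma awalk_take_drop:
  assumes "awalk u p v" "i < length p"
  shows "awalk u (take i p) (tail G (p ! i))" "awalk (head G (p ! i)) (drop (Suc i) p) v"
proof -
  have "awalk u (take i p @ p ! i # drop (Suc i) p) v"
    unfolding id_take_nth_drop[OF assms(2), symmetric] by (rule assms(1))
  then show "awalk u (take i p) (tail G (p ! i))" "awalk (head G (p ! i)) (drop (Suc i) p) v"
    by (rule awalk_append_Cons)+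
qed

lemma form_coeff_closed [simp]:
  assumes "x \<in> A" "y \<in> A"
  shows "form_coeff G b x y \<in> A"
  using assms(2)
proof (induction y rule: path_alg_induct)
  case (gen u p v)
  then show ?case
    using assms(1) awalk_take_drop[OF gen] by (auto simp: form_coeff_gen intro!: path_alg_sum)
qed auto

lemma path_derivation_closed:
  assumes "\<And>b. b \<in> arcs G \<Longrightarrow> \<phi> b \<in> A" "x \<in> A"
  shows "path_derivation G \<phi> x \<in> A"
  using assms(2)
proof (induction x rule: path_alg_induct)
  case (gen u p v)
  then have "p ! i \<in> arcs G" if "i < length p" for i
    using that nth_mem by (auto simp: awalk_def)
  then show ?case
    using assms(1) awalk_take_drop[OF gen]
    by (auto simp: path_derivation_def arrow_sum_gen intro!: path_alg_sum)
qed auto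

lemma idem_mult_arrow [simp]: "idem (head G b) \<odot> arrow G b = arrow G b"
  and arrow_mult_idem [simp]: "arrow G b \<odot> idem (tail G b) = arrow G b"
  by (simp_all add: arrow_def pmult_gen)

lemma form_coeff_arrow:
  "form_coeff G b x (arrow G c) = (if b = c then idem (tail G b) \<odot> x \<odot> idem (head G b) else 0)"
  by (auto simp: arrow_def form_coeff_def arrow_sum_gen)

lemma gen_Cons: "gen (tail G b, b # p, v) = gen (head G b, p, v) \<odot> arrow G b"
  by (simp add: arrow_def pmult_gen)

end

locale relative_derivation = wf_digraph G for G :: "('a, 'b) pre_digraph" +
  fixes \<theta> :: "('a, 'b) path_der"
  assumes der: "\<theta> \<in> derivations G"
begin

lemma der_closed [simp]: "x \<in> A \<Longrightarrow> \<theta> x \<in> A"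
  and der_add [simp]: "x \<in> A \<Longrightarrow> y \<in> A \<Longrightarrow> \<theta> (x + y) = \<theta> x + \<theta> y"
  and der_scale [simp]: "x \<in> A \<Longrightarrow> \<theta> (c \<cdot>\<^sub>c x) = c \<cdot>\<^sub>c \<theta> x"
  and der_mult [simp]: "x \<in> A \<Longrightarrow> y \<in> A \<Longrightarrow> \<theta> (x \<odot> y) = \<theta> x \<odot> y + x \<odot> \<theta> y"
  and der_vertex [simp]: "x \<in> V \<Longrightarrow> \<theta> x = 0"
  and der_undefined: "x \<notin> A \<Longrightarrow> \<theta> x = undefined"
proof -
  note d = der[unfolded derivations_def mem_Collect_eq]
  note d1 = conjunct1[OF d] and d2 = conjunct2[OF d]
  show "x \<in> A \<Longrightarrow> \<theta> x \<in> A" by (rule PiE_mem[OF d1])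
  show "x \<notin> A \<Longrightarrow> \<theta> x = undefined" by (rule PiE_arb[OF d1])
  show "x \<in> A \<Longrightarrow> y \<in> A \<Longrightarrow> \<theta> (x + y) = \<theta> x + \<theta> y"
    by (rule conjunct1[OF d2, rule_format])
  show "x \<in> A \<Longrightarrow> \<theta> (c \<cdot>\<^sub>c x) = c \<cdot>\<^sub>c \<theta> x"
    by (rule conjunct1[OF conjunct2[OF d2], rule_format])
  show "x \<in> A \<Longrightarrow> y \<in> A \<Longrightarrow> \<theta> (x \<odot> y) = \<theta> x \<odot> y + x \<odot> \<theta> y"
    by (rule conjunct1[OF conjunct2[OF conjunct2[OF d2]], rule_format])
  show "x \<in> V \<Longrightarrow> \<theta> x = 0"
    by (rule conjunct2[OF conjunct2[OF conjunct2[OF d2]], rule_format])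
qed

lemma der_zero [simp]: "\<theta> 0 = 0"
  by (rule der_vertex) simp

lemma der_minus [simp]: "x \<in> A \<Longrightarrow> \<theta> (- x) = - \<theta> x"
  by (metis add.right_inverse der_add der_zero minus_unique path_alg_minus)

text \<open>A derivation that kills \<open>V\<close> is \<open>V\<close>-bilinear, so the
  idempotents at the ends of an arrow may be pulled out of its image.\<close>

lemma der_arrow_ends:
  assumes "b \<in> arcs G"
  shows "idem (head G b) \<odot> \<theta> (arrow G b) \<odot> idem (tail G b) = \<theta> (arrow G b)"
proof -
  have [simp]: "idem (head G b) \<in> V" "idem (tail G b) \<in> V" using assms by auto
  have [simp]: "idem (head G b) \<in> A" "idem (tail G b) \<in> A"
    by (rule vertex_alg_subset, simp)+
  note gen_in_path_alg [simp del]
  have "\<theta> (arrow G b) = idem (head G b) \<odot> \<theta> (arrow G b)"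
    using assms der_mult[of "idem (head G b)" "arrow G b"] by simp
  moreover have "\<theta> (arrow G b) = \<theta> (arrow G b) \<odot> idem (tail G b)"
    using assms der_mult[of "arrow G b" "idem (tail G b)"] by simp
  ultimately show ?thesis by (metis pmult_assoc)
qed

end

context wf_digraph
begin

text \<open>Arrows generate \<open>A\<close> over \<open>V\<close>; the first arrow of a path is
  split off and the Leibniz rule applied.\<close>

lemma der_eqI:
  assumes \<theta>: "\<theta> \<in> derivations G" and \<eta>: "\<eta> \<in> derivations G"
    and eq: "\<And>b. b \<in> arcs G \<Longrightarrow> \<theta> (arrow G b) = \<eta> (arrow G b)"
  shows "\<theta> = \<eta>"
proof
  fix x
  interpret \<theta>: relative_derivation G \<theta> by unfold_locales (rule \<theta>)
  interpret \<eta>: relative_derivation G \<eta> by unfold_locales (rule \<eta>)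
  show "\<theta> x = \<eta> x"
  proof (cases "x \<in> A")
    case True
    then show ?thesis
    proof (induction x rule: path_alg_induct)
      case (gen u p v)
      then show ?case
      proof (induction p arbitrary: u)
        case Nil
        then show ?case by (auto simp: awalk_Nil_iff)
      next
        case (Cons b p)
        then have "u = tail G b" "b \<in> arcs G" "awalk (head G b) p v"
          by (auto simp: awalk_Cons_iff)
        then show ?case using Cons.IH eq by (simp add: gen_Cons)
      qed
    qed auto
  next
    case False
    then show ?thesis by (simp add: \<theta>.der_undefined \<eta>.der_undefined)
  qed
qed

lemma derivationsI:
  assumes "\<And>x. x \<in> A \<Longrightarrow> \<theta> x \<in> A" "\<And>x. x \<notin> A \<Longrightarrow> \<theta> x = undefined"
    and "\<And>x y. x \<in> A \<Longrightarrow> y \<in> A \<Longrightarrow> \<theta> (x + y) = \<theta> x + \<theta> y"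
    and "\<And>c x. x \<in> A \<Longrightarrow> \<theta> (c \<cdot>\<^sub>c x) = c \<cdot>\<^sub>c \<theta> x"
    and "\<And>x y. x \<in> A \<Longrightarrow> y \<in> A \<Longrightarrow> \<theta> (x \<odot> y) = \<theta> x \<odot> y + x \<odot> \<theta> y"
    and "\<And>x. x \<in> V \<Longrightarrow> \<theta> x = 0"
  shows "\<theta> \<in> derivations G"
  unfolding derivations_def mem_Collect_eq
  by (intro conjI ballI allI PiE_I assms)

lemma path_derivation_in_derivations:
  assumes "\<And>b. b \<in> arcs G \<Longrightarrow> \<phi> b \<in> A"
  shows "(\<lambda>x\<in>A. path_derivation G \<phi> x) \<in> derivations G"
proof -
  have "path_derivation G \<phi> v = 0" if "v \<in> V" for v
    using that by (induction v rule: vertex_alg_induct) (auto simp: path_derivation_def arrow_sum_gen)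
  then show ?thesis
    by (intro derivationsI)
      (simp_all add: assms path_derivation_closed path_derivation_mult vertex_alg_subset)
qed

text \<open>The trivial paths around a single arrow cut \<open>\<phi> b\<close> down to its
  component from the tail to the head of \<open>b\<close>; only values with the right ends are
  recovered.\<close>

lemma path_derivation_arrow:
  "path_derivation G \<phi> (arrow G b) = idem (head G b) \<odot> \<phi> b \<odot> idem (tail G b)"
  by (simp add: arrow_def path_derivation_def arrow_sum_gen)

end

context fin_digraph
begin

lemma pone_left [simp]:
  assumes "x \<in> A"
  shows "pone G \<odot> x = x"
  using assms
proof (induction x rule: path_alg_induct)
  case (gen u p v)
  then have "v \<in> verts G" by auto
  then show ?case by (simp add: pone_def pmult_sum_left pmult_gen)
qed auto

lemma pone_right [simp]:
  assumes "x \<in> A"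
  shows "x \<odot> pone G = x"
  using assms
proof (induction x rule: path_alg_induct)
  case (gen u p v)
  then have "u \<in> verts G" by auto
  then show ?case by (simp add: pone_def pmult_sum_right pmult_gen cong: if_cong)
qed auto

text \<open>The coefficient of \<open>db\<close> in \<open>1 dw\<close> joins the part before an
  occurrence of \<open>b\<close> to the part after it at the base point. This product is zero unless
  the path is closed, which matches the convention in \<open>path_deriv\<close>.\<close>

lemma cyc_deriv_eq_form_coeff:
  assumes "x \<in> A"
  shows "cyc_deriv G b x = form_coeff G b (pone G) x"
  using assms
proof (induction x rule: path_alg_induct)
  case (gen u p v)
  have *: "gen (u, take i p, tail G (p ! i)) \<odot> pone G = gen (u, take i p, tail G (p ! i))"
    if "i < length p" for i
    using gen that awalk_take_drop by simp
  have "gen (u, take i p, tail G (p ! i)) \<odot> pone G \<odot> gen (head G (p ! i), drop (Suc i) p, v) =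
      (if u = v then gen (head G (p ! i), open_at i p, tail G (p ! i)) else 0)" if "i < length p" for i
    unfolding *[OF that] by (simp add: pmult_gen open_at_def)
  then show ?case
    by (auto simp: cyc_deriv_def form_coeff_gen intro!: sum.cong sum.neutral)
qed (auto simp: cyc_deriv_def)

end

section \<open>Traces on the Karoubi complex\<close>

text \<open>Linearity is demanded on \<open>A\<close> only, because traces arise by composition with
  derivations, which are \<open>undefined\<close> outside \<open>A\<close>.\<close>

locale functional = wf_digraph G for G :: "('a, 'b) pre_digraph" +
  fixes t :: "('a, 'b) path_vec \<Rightarrow> complex"
  assumes add: "x \<in> A \<Longrightarrow> y \<in> A \<Longrightarrow> t (x + y) = t x + t y"
    and scale: "x \<in> A \<Longrightarrow> t (c \<cdot>\<^sub>c x) = c * t x"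
begin

lemma zero: "t 0 = 0"
  using scale[of 0 0] by simp

lemma minus: "x \<in> A \<Longrightarrow> t (- x) = - t x"
  by (metis add ab_group_add_class.ab_left_minus add.commute minus_unique path_alg_minus zero)

lemma diff: "x \<in> A \<Longrightarrow> y \<in> A \<Longrightarrow> t (x - y) = t x - t y"
  using add[of x "- y"] by (simp add: minus)

lemma sum: "(\<And>i. i \<in> I \<Longrightarrow> f i \<in> A) \<Longrightarrow> t (\<Sum>i\<in>I. f i) = (\<Sum>i\<in>I. t (f i))"
  by (induction I rule: infinite_finite_induct) (auto simp: zero add)

lemma lin_ext:
  "(\<And>p. p \<in> Poly_Mapping.keys x \<Longrightarrow> \<phi> p \<in> A) \<Longrightarrow> t (lin_ext \<phi> x) = pair (\<lambda>p. t (\<phi> p)) x"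
  by (simp add: lin_ext_def pair_def sum scale)

lemma eqI:
  assumes "functional G s" "\<And>u p v. awalk u p v \<Longrightarrow> t (gen (u, p, v)) = s (gen (u, p, v))" "x \<in> A"
  shows "t x = s x"
proof -
  interpret s: functional G s by fact
  show ?thesis
    using assms(3) by (induction x rule: path_alg_induct)
      (auto simp: zero add scale s.zero s.add s.scale assms(2))
qed

end

text \<open>
  The functionals on degrees zero, one and two of the Karoubi complex, as functions of
  \<open>a\<^sub>0\<close>, of \<open>a\<^sub>0 da\<^sub>1\<close> and of \<open>a\<^sub>0 da\<^sub>1 da\<^sub>2\<close>.
\<close>

locale trace0 = fin_digraph G + functional G t for G :: "('a, 'b) pre_digraph" and t +
  assumes cyclic: "x \<in> A \<Longrightarrow> y \<in> A \<Longrightarrow> t (x \<odot> y) = t (y \<odot> x)"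

text \<open>\<open>mult_right\<close> is the commutator of \<open>z\<close> with
  \<open>x dy\<close>, since \<open>(x dy) z = x d(yz) - xy dz\<close>. Taking one factor in
  \<open>V\<close> turns it into balancedness, which therefore appears below as a
  consequence.\<close>

locale trace1 = fin_digraph G for G :: "('a, 'b) pre_digraph" +
  fixes t :: "('a, 'b) path_vec \<Rightarrow> ('a, 'b) path_vec \<Rightarrow> complex"
  assumes functional_left: "y \<in> A \<Longrightarrow> functional G (\<lambda>x. t x y)"
    and functional_right: "x \<in> A \<Longrightarrow> functional G (t x)"
    and vertex: "x \<in> A \<Longrightarrow> v \<in> V \<Longrightarrow> t x v = 0"
    and mult_right: "x \<in> A \<Longrightarrow> y \<in> A \<Longrightarrow> z \<in> A \<Longrightarrow> t x (y \<odot> z) = t (x \<odot> y) z + t (z \<odot> x) y"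
begin

lemmas add_left = functional.add[OF functional_left]
  and scale_left = functional.scale[OF functional_left]
  and zero_left = functional.zero[OF functional_left]
  and minus_left = functional.minus[OF functional_left]
  and diff_left = functional.diff[OF functional_left]
  and add_right = functional.add[OF functional_right]
  and scale_right = functional.scale[OF functional_right]
  and zero_right = functional.zero[OF functional_right]
  and minus_right = functional.minus[OF functional_right]
  and diff_right = functional.diff[OF functional_right]

lemmas linear = add_left scale_left zero_left minus_left diff_left
  add_right scale_right zero_right minus_right diff_right

lemma balanced: "x \<in> A \<Longrightarrow> v \<in> V \<Longrightarrow> y \<in> A \<Longrightarrow> t (x \<odot> v) y = t x (v \<odot> y)"
  using mult_right[of x v y] vertex[of "y \<odot> x" v] by (simp add: vertex_alg_subset)

lemma balanced': "x \<in> A \<Longrightarrow> v \<in> V \<Longrightarrow> y \<in> A \<Longrightarrow> t (v \<odot> x) y = t x (y \<odot> v)"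
  using mult_right[of x y v] vertex[of "x \<odot> y" v] by (simp add: vertex_alg_subset)

text \<open>The Leibniz rule reduces \<open>x dy\<close> to the forms \<open>z db\<close> with \<open>b\<close> an arrow.\<close>

lemma expand:
  assumes "x \<in> A" "y \<in> A"
  shows "t x y = (\<Sum>b\<in>arcs G. t (form_coeff G b x y) (arrow G b))"
proof (rule functional.eqI[OF functional_right[OF assms(1)] _ _ assms(2)])
  show "functional G (\<lambda>y. \<Sum>b\<in>arcs G. t (form_coeff G b x y) (arrow G b))"
    by unfold_locales (simp_all add: assms linear sum.distrib sum_distrib_left)
  \<comment> \<open>For a single arrow the expansion says that \<open>z db\<close> depends only on
    the component of \<open>z\<close> between the ends of \<open>b\<close>: idempotents pass from
    one entry to the other by balancedness.\<close>
  have arr: "t z (arrow G c) = (\<Sum>b\<in>arcs G. t (form_coeff G b z (arrow G c)) (arrow G b))"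
    if "z \<in> A" "c \<in> arcs G" for z c
  proof -
    have V: "idem (tail G c) \<in> V" "idem (head G c) \<in> V" using that by auto
    note A = V[THEN vertex_alg_subset]
    have "t (idem (tail G c) \<odot> z \<odot> idem (head G c)) (arrow G c) = t z (arrow G c)"
      using that V A by (simp add: balanced balanced' del: gen_in_path_alg)
    then have "t z (arrow G c) =
        (\<Sum>b\<in>arcs G. if b = c then t (form_coeff G b z (arrow G c)) (arrow G b) else 0)"
      using that by (simp add: form_coeff_arrow)
    also have "\<dots> = (\<Sum>b\<in>arcs G. t (form_coeff G b z (arrow G c)) (arrow G b))"
      by (intro sum.cong) (auto simp: form_coeff_arrow zero_left)
    finally show ?thesis .
  qed
  fix u p v assume "awalk u p v"
  then show "t x (gen (u, p, v)) = (\<Sum>b\<in>arcs G. t (form_coeff G b x (gen (u, p, v))) (arrow G b))"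
    using assms(1)
  proof (induction p arbitrary: u x)
    case Nil
    then have "u = v" "v \<in> verts G" by (auto simp: awalk_Nil_iff)
    then show ?case using Nil
      by (simp add: vertex form_coeff_vertex zero_left)
  next
    case (Cons b p)
    then have *: "u = tail G b" "b \<in> arcs G" "awalk (head G b) p v"
      by (auto simp: awalk_Cons_iff)
    let ?y = "gen (head G b, p, v)"
    \<comment> \<open>The first arrow is split off; the remaining shorter path carries the
      coefficient \<open>b x\<close>, so \<open>x\<close> must be arbitrary in the
      induction.\<close>
    have "t x (?y \<odot> arrow G b) = t (x \<odot> ?y) (arrow G b) + t (arrow G b \<odot> x) ?y"
      using * Cons.prems by (simp add: mult_right)
    also have "\<dots> = (\<Sum>c\<in>arcs G. t (form_coeff G c (x \<odot> ?y) (arrow G b)) (arrow G c)) +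
        (\<Sum>c\<in>arcs G. t (form_coeff G c (arrow G b \<odot> x) ?y) (arrow G c))"
      using arr[of "x \<odot> ?y" b] Cons.IH[of "head G b" "arrow G b \<odot> x"] * Cons.prems by simp
    also have "\<dots> = (\<Sum>c\<in>arcs G. t (form_coeff G c x (?y \<odot> arrow G b)) (arrow G c))"
      using * Cons.prems by (simp add: form_coeff_mult add_left sum.distrib)
    finally show ?case using * by (simp add: gen_Cons)
  qed
qed

lemma expand_one:
  assumes "x \<in> A"
  shows "t (pone G) x = (\<Sum>b\<in>arcs G. t (cyc_deriv G b x) (arrow G b))"
  using expand[of "pone G" x] assms by (simp add: cyc_deriv_eq_form_coeff)

lemma mult_one: "x \<in> A \<Longrightarrow> y \<in> A \<Longrightarrow> t (pone G) (x \<odot> y) = t x y + t y x"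
  by (simp add: mult_right)

text \<open>Dual to the differential from degree zero to degree one; cyclicity holds because
  \<open>mult_one\<close> is symmetric in its two arguments.\<close>

lemma trace0: "trace0 G (t (pone G))"
  by unfold_locales (simp_all add: linear mult_one)

end

text \<open>\<open>commutator_02\<close> is the commutator of \<open>a\<close> with
  \<open>x dy dz\<close>, and \<open>commutator_11\<close> the supercommutator of
  \<open>w dx\<close> with \<open>y dz\<close>; the plus sign in the latter is the sign rule for two
  odd forms.\<close>

locale trace2 = fin_digraph G for G :: "('a, 'b) pre_digraph" +
  fixes t :: "('a, 'b) path_vec \<Rightarrow> ('a, 'b) path_vec \<Rightarrow> ('a, 'b) path_vec \<Rightarrow> complex"
  assumes functional_0: "y \<in> A \<Longrightarrow> z \<in> A \<Longrightarrow> functional G (\<lambda>x. t x y z)"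
    and functional_1: "x \<in> A \<Longrightarrow> z \<in> A \<Longrightarrow> functional G (\<lambda>y. t x y z)"
    and functional_2: "x \<in> A \<Longrightarrow> y \<in> A \<Longrightarrow> functional G (t x y)"
    and vertex_1: "x \<in> A \<Longrightarrow> v \<in> V \<Longrightarrow> z \<in> A \<Longrightarrow> t x v z = 0"
    and vertex_2: "x \<in> A \<Longrightarrow> y \<in> A \<Longrightarrow> v \<in> V \<Longrightarrow> t x y v = 0"
    and balanced_0: "x \<in> A \<Longrightarrow> v \<in> V \<Longrightarrow> y \<in> A \<Longrightarrow> z \<in> A \<Longrightarrow> t (x \<odot> v) y z = t x (v \<odot> y) z"
    and balanced_1: "x \<in> A \<Longrightarrow> v \<in> V \<Longrightarrow> y \<in> A \<Longrightarrow> z \<in> A \<Longrightarrow> t x (y \<odot> v) z = t x y (v \<odot> z)"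
    and commutator_02: "a \<in> A \<Longrightarrow> x \<in> A \<Longrightarrow> y \<in> A \<Longrightarrow> z \<in> A \<Longrightarrow>
      t (a \<odot> x) y z = t x y (z \<odot> a) - t x (y \<odot> z) a + t (x \<odot> y) z a"
    and commutator_11: "w \<in> A \<Longrightarrow> x \<in> A \<Longrightarrow> y \<in> A \<Longrightarrow> z \<in> A \<Longrightarrow>
      t w (x \<odot> y) z - t (w \<odot> x) y z + (t y (z \<odot> w) x - t (y \<odot> z) w x) = 0"
begin

lemmas linear = functional.add[OF functional_0] functional.scale[OF functional_0]
  functional.zero[OF functional_0] functional.minus[OF functional_0] functional.diff[OF functional_0]
  functional.add[OF functional_1] functional.scale[OF functional_1]
  functional.zero[OF functional_1] functional.minus[OF functional_1] functional.diff[OF functional_1]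
  functional.add[OF functional_2] functional.scale[OF functional_2]
  functional.zero[OF functional_2] functional.minus[OF functional_2] functional.diff[OF functional_2]

text \<open>Dual to the differential from degree one to degree two. The commutator of
  \<open>z\<close> with \<open>dx dy\<close> and that of \<open>dz\<close> with \<open>x dy\<close>
  both contain \<open>t z x y - t x y z\<close>; eliminating it leaves the axiom
  \<open>mult_right\<close>.\<close>

lemma trace1: "trace1 G (t (pone G))"
proof unfold_locales
  fix x y z assume A: "x \<in> A" "y \<in> A" "z \<in> A"
  have "t z x y = t (pone G) x (y \<odot> z) - t (pone G) (x \<odot> y) z + t x y z"
    using commutator_02[of z "pone G" x y] A by simp
  moreover have "t (pone G) (z \<odot> x) y - t z x y + t x y z = 0"
    using commutator_11[of "pone G" z x y] vertex_1[of "x \<odot> y" "pone G" z] A by simp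
  ultimately show "t (pone G) x (y \<odot> z) = t (pone G) (x \<odot> y) z + t (pone G) (z \<odot> x) y"
    by algebra
qed (simp_all add: linear vertex_2)

end

locale trace1_derivation = trace1 G t + relative_derivation G \<theta>
  for G :: "('a, 'b) pre_digraph" and t \<theta>
begin

text \<open>The pullback of a trace along \<open>L_\<theta>\<close>: the Leibniz rule for
  \<open>\<theta>\<close> distributes over both entries.\<close>

lemma lie_trace1: "trace1 G (\<lambda>x y. t (\<theta> x) y + t x (\<theta> y))"
proof unfold_locales
  fix x y z v c assume A: "x \<in> A" "y \<in> A" "z \<in> A"
  then show "t (\<theta> (x + y)) z + t (x + y) (\<theta> z) = t (\<theta> x) z + t x (\<theta> z) + (t (\<theta> y) z + t y (\<theta> z))"
    "t (\<theta> z) (x + y) + t z (\<theta> (x + y)) = t (\<theta> z) x + t z (\<theta> x) + (t (\<theta> z) y + t z (\<theta> y))"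
    by (simp_all add: linear)
  show "t (\<theta> x) (y \<odot> z) + t x (\<theta> (y \<odot> z)) =
    t (\<theta> (x \<odot> y)) z + t (x \<odot> y) (\<theta> z) + (t (\<theta> (z \<odot> x)) y + t (z \<odot> x) (\<theta> y))"
    using A by (simp add: linear mult_right)
next
  fix x y c assume A: "x \<in> A" "y \<in> A"
  then show "t (\<theta> (c \<cdot>\<^sub>c x)) y + t (c \<cdot>\<^sub>c x) (\<theta> y) = c * (t (\<theta> x) y + t x (\<theta> y))"
    "t (\<theta> y) (c \<cdot>\<^sub>c x) + t y (\<theta> (c \<cdot>\<^sub>c x)) = c * (t (\<theta> y) x + t y (\<theta> x))"
    by (simp_all add: linear distrib_left)
next
  fix x v assume "x \<in> A" "v \<in> V"
  then show "t (\<theta> x) v + t x (\<theta> v) = 0"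
    by (simp add: vertex zero_right)
qed

text \<open>This is \<open>t\<close> composed with \<open>i_\<theta>\<close>, which sends
  \<open>x dy dz\<close> to \<open>x \<theta>(y) dz - x dy \<theta>(z)\<close>; moving the last
  factor to the left gives \<open>x dy \<theta>(z) = x d(y \<theta>(z)) - xy d\<theta>(z)\<close>,
  hence three terms. The trace axioms for it say that contraction descends to the Karoubi
  quotient.\<close>

lemma contract_trace2:
  "trace2 G (\<lambda>x y z. t (x \<odot> \<theta> y) z + t (x \<odot> y) (\<theta> z) - t x (y \<odot> \<theta> z))"
proof unfold_locales
  fix x v y z assume "x \<in> A" "v \<in> V" "y \<in> A" "z \<in> A"
  moreover from this have "v \<in> A" by (simp add: vertex_alg_subset)
  ultimately show "t (x \<odot> v \<odot> \<theta> y) z + t (x \<odot> v \<odot> y) (\<theta> z) - t (x \<odot> v) (y \<odot> \<theta> z) =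
      t (x \<odot> \<theta> (v \<odot> y)) z + t (x \<odot> (v \<odot> y)) (\<theta> z) - t x (v \<odot> y \<odot> \<theta> z)"
    "t (x \<odot> \<theta> (y \<odot> v)) z + t (x \<odot> (y \<odot> v)) (\<theta> z) - t x (y \<odot> v \<odot> \<theta> z) =
      t (x \<odot> \<theta> y) (v \<odot> z) + t (x \<odot> y) (\<theta> (v \<odot> z)) - t x (y \<odot> \<theta> (v \<odot> z))"
    by (simp_all add: mult_right pmult_assoc vertex)
next
  fix a x y z assume A: "a \<in> A" "x \<in> A" "y \<in> A" "z \<in> A"
  then show "t (a \<odot> x \<odot> \<theta> y) z + t (a \<odot> x \<odot> y) (\<theta> z) - t (a \<odot> x) (y \<odot> \<theta> z) =
      t (x \<odot> \<theta> y) (z \<odot> a) + t (x \<odot> y) (\<theta> (z \<odot> a)) - t x (y \<odot> \<theta> (z \<odot> a)) -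
      (t (x \<odot> \<theta> (y \<odot> z)) a + t (x \<odot> (y \<odot> z)) (\<theta> a) - t x (y \<odot> z \<odot> \<theta> a)) +
      (t (x \<odot> y \<odot> \<theta> z) a + t (x \<odot> y \<odot> z) (\<theta> a) - t (x \<odot> y) (z \<odot> \<theta> a))"
    "t (a \<odot> \<theta> (x \<odot> y)) z + t (a \<odot> (x \<odot> y)) (\<theta> z) - t a (x \<odot> y \<odot> \<theta> z) -
      (t (a \<odot> x \<odot> \<theta> y) z + t (a \<odot> x \<odot> y) (\<theta> z) - t (a \<odot> x) (y \<odot> \<theta> z)) +
      (t (y \<odot> \<theta> (z \<odot> a)) x + t (y \<odot> (z \<odot> a)) (\<theta> x) - t y (z \<odot> a \<odot> \<theta> x) -
       (t (y \<odot> z \<odot> \<theta> a) x + t (y \<odot> z \<odot> a) (\<theta> x) - t (y \<odot> z) (a \<odot> \<theta> x))) = 0"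
    by (simp_all add: linear mult_right pmult_assoc)
next
  fix x v y assume "x \<in> A" "v \<in> V" "y \<in> A"
  moreover from this have "v \<in> A" by (simp add: vertex_alg_subset)
  ultimately show "t (x \<odot> \<theta> v) y + t (x \<odot> v) (\<theta> y) - t x (v \<odot> \<theta> y) = 0"
    "t (x \<odot> \<theta> y) v + t (x \<odot> y) (\<theta> v) - t x (y \<odot> \<theta> v) = 0"
    by (simp_all add: mult_right vertex zero_left zero_right)
qed (simp_all add: linear algebra_simps)

end

locale trace2_derivation = trace2 G t + relative_derivation G \<theta>
  for G :: "('a, 'b) pre_digraph" and t \<theta>
begin

text \<open>The axioms are multilinear, so applying \<open>\<theta>\<close> to each entry in turn
  and adding the instances proves them for the sum.\<close>

lemma lie_trace2: "trace2 G (\<lambda>x y z. t (\<theta> x) y z + t x (\<theta> y) z + t x y (\<theta> z))"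
proof unfold_locales
  fix a x y z assume A: "a \<in> A" "x \<in> A" "y \<in> A" "z \<in> A"
  show "t (\<theta> (a \<odot> x)) y z + t (a \<odot> x) (\<theta> y) z + t (a \<odot> x) y (\<theta> z) =
    t (\<theta> x) y (z \<odot> a) + t x (\<theta> y) (z \<odot> a) + t x y (\<theta> (z \<odot> a)) -
    (t (\<theta> x) (y \<odot> z) a + t x (\<theta> (y \<odot> z)) a + t x (y \<odot> z) (\<theta> a)) +
    (t (\<theta> (x \<odot> y)) z a + t (x \<odot> y) (\<theta> z) a + t (x \<odot> y) z (\<theta> a))"
    using A commutator_02[of "\<theta> a" x y z] commutator_02[of a "\<theta> x" y z]
      commutator_02[of a x "\<theta> y" z] commutator_02[of a x y "\<theta> z"]
    by (simp add: linear)
  have comm: "t w (x \<odot> y) z = t (w \<odot> x) y z - t y (z \<odot> w) x + t (y \<odot> z) w x"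
    if "w \<in> A" "x \<in> A" "y \<in> A" "z \<in> A" for w x y z
    using commutator_11[OF that] by (simp add: algebra_simps)
  show "t (\<theta> a) (x \<odot> y) z + t a (\<theta> (x \<odot> y)) z + t a (x \<odot> y) (\<theta> z) -
    (t (\<theta> (a \<odot> x)) y z + t (a \<odot> x) (\<theta> y) z + t (a \<odot> x) y (\<theta> z)) +
    (t (\<theta> y) (z \<odot> a) x + t y (\<theta> (z \<odot> a)) x + t y (z \<odot> a) (\<theta> x) -
     (t (\<theta> (y \<odot> z)) a x + t (y \<odot> z) (\<theta> a) x + t (y \<odot> z) a (\<theta> x))) = 0"
    using A comm[of "\<theta> a" x y z] comm[of a "\<theta> x" y z] comm[of a x "\<theta> y" z] comm[of a x y "\<theta> z"]
    by (simp add: linear)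
qed (simp_all add: linear vertex_1 vertex_2 vertex_alg_subset balanced_0 balanced_1 distrib_left)

end

section \<open>Functionals on the Karoubi quotient are traces\<close>

lemma in_karoubi_null_iff:
  "x \<in> karoubi_null G n \<longleftrightarrow>
    (\<forall>T. (\<forall>s \<in> tensor_rels G n \<union> supercommutators G n. pair T s = 0) \<longrightarrow> pair T x = 0)"
proof -
  \<comment> \<open>A functional kills a span as soon as it kills the generators, so the nested span
    of the definition can be flattened.\<close>
  have "(\<forall>s \<in> free.span (tensor_rels G n). pair T s = 0) \<longleftrightarrow> (\<forall>s \<in> tensor_rels G n. pair T s = 0)" for T
    using in_span_iff_pair[of _ "tensor_rels G n"] free.span_base[of _ "tensor_rels G n"] by blast
  then show ?thesis
    unfolding karoubi_null_def forms_null_def in_span_iff_pair[of x] ball_Un by presburger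
qed

lemmas form_mult_linear [simp] = bilin_ext_linear[of tuple_mult, folded form_mult_def]

lemma form_mult_gen [simp]: "gen as \<otimes>\<^sub>f gen bs = tuple_mult as bs"
  by (simp add: form_mult_def)

lemma tuple_mult_simps:
  "tuple_mult [a] (b # bs) = gen ((a \<odot> b) # bs)"
  "tuple_mult [a, a'] (b # bs) = gen (a # (a' \<odot> b) # bs) - gen ((a \<odot> a') # b # bs)"
  "tuple_mult [a, a', a''] (b # bs) =
    gen (a # a' # (a'' \<odot> b) # bs) - gen (a # (a' \<odot> a'') # b # bs) + gen ((a \<odot> a') # a'' # b # bs)"
  by (auto simp: tuple_mult_def Let_def numeral_2_eq_2 intro!: poly_mapping_eqI
      simp: lookup_add lookup_minus)

context wf_digraph
begin

lemma preforms_gen [simp]: "gen as \<in> preforms G n \<longleftrightarrow> length as = Suc n \<and> set as \<subseteq> A"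
  by (simp add: preforms_def)

lemma preforms_zero [simp]: "0 \<in> preforms G n"
  by (simp add: preforms_def)

lemma preforms_add [simp]: "x \<in> preforms G n \<Longrightarrow> y \<in> preforms G n \<Longrightarrow> x + y \<in> preforms G n"
  using Poly_Mapping.keys_add[of x y] by (auto simp: preforms_def)

lemma preforms_scale [simp]: "x \<in> preforms G n \<Longrightarrow> c \<cdot>\<^sub>c x \<in> preforms G n"
  using keys_cscale[of c x] by (auto simp: preforms_def)

lemma preforms_minus [simp]: "x \<in> preforms G n \<Longrightarrow> - x \<in> preforms G n"
  by (simp add: preforms_def)

lemma preforms_diff [simp]: "x \<in> preforms G n \<Longrightarrow> y \<in> preforms G n \<Longrightarrow> x - y \<in> preforms G n"
  using preforms_add[of x n "- y"] by simp

lemma preforms_sum [simp]: "(\<And>i. i \<in> I \<Longrightarrow> f i \<in> preforms G n) \<Longrightarrow> (\<Sum>i\<in>I. f i) \<in> preforms G n"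
  by (induction I rule: infinite_finite_induct) auto

lemma preforms_induct [consumes 1, case_names zero add scale gen]:
  assumes "x \<in> preforms G n" "P 0"
    and "\<And>x y. x \<in> preforms G n \<Longrightarrow> y \<in> preforms G n \<Longrightarrow> P x \<Longrightarrow> P y \<Longrightarrow> P (x + y)"
    and "\<And>c x. x \<in> preforms G n \<Longrightarrow> P x \<Longrightarrow> P (c \<cdot>\<^sub>c x)"
    and "\<And>as. length as = Suc n \<Longrightarrow> set as \<subseteq> A \<Longrightarrow> P (gen as)"
  shows "P x"
  using assms
  by (intro vec_induct_on[of x "{as. length as = n + 1 \<and> set as \<subseteq> A}" P]) (auto simp: preforms_def)

lemma preforms_lin_ext:
  assumes "x \<in> preforms G n" "\<And>as. length as = Suc n \<Longrightarrow> set as \<subseteq> A \<Longrightarrow> \<phi> as \<in> preforms G m"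
  shows "lin_ext \<phi> x \<in> preforms G m"
  using assms(1) by (induction x rule: preforms_induct) (auto simp: assms(2))

lemma pair_preforms_cong:
  assumes "x \<in> preforms G n" "\<And>as. length as = Suc n \<Longrightarrow> set as \<subseteq> A \<Longrightarrow> T as = S as"
  shows "pair T x = pair S x"
  using assms(1) by (induction x rule: preforms_induct) (auto simp: assms(2))

text \<open>Both products are bilinear, so commutators of arbitrary preforms reduce to commutators
  of tuples.\<close>

lemma pair_supercommutator_eq_0:
  assumes x: "x \<in> preforms G i" and y: "y \<in> preforms G j"
    and *: "\<And>as bs. length as = Suc i \<Longrightarrow> set as \<subseteq> A \<Longrightarrow> length bs = Suc j \<Longrightarrow> set bs \<subseteq> A \<Longrightarrow>
      pair T (tuple_mult as bs) = s * pair T (tuple_mult bs as)"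
  shows "pair T (x \<otimes>\<^sub>f y - s \<cdot>\<^sub>c (y \<otimes>\<^sub>f x)) = 0"
  using x
proof (induction x rule: preforms_induct)
  case (gen as)
  from y show ?case
    by (induction y rule: preforms_induct) (auto simp: gen * algebra_simps)
qed (auto simp: algebra_simps)

lemma karoubi_class_eqI:
  assumes "x - y \<in> karoubi_null G n"
  shows "karoubi_class G n x = karoubi_class G n y"
proof -
  have "z - x \<in> karoubi_null G n \<longleftrightarrow> z - y \<in> karoubi_null G n" for z
    using assms free.span_add[of "z - x" _ "x - y"] free.span_diff[of "z - y" _ "x - y"]
    by (auto simp: karoubi_null_def)
  then show ?thesis by (auto simp: karoubi_class_def)
qed

lemma mem_karoubi_class: "x \<in> preforms G n \<Longrightarrow> x \<in> karoubi_class G n x"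
  by (simp add: karoubi_class_def karoubi_null_def free.span_zero)

lemma karoubi_class_eq_iff:
  assumes "x \<in> preforms G n"
  shows "karoubi_class G n x = karoubi_class G n y \<longleftrightarrow> x - y \<in> karoubi_null G n"
proof
  assume "karoubi_class G n x = karoubi_class G n y"
  moreover have "x \<in> karoubi_class G n x"
    using assms by (rule mem_karoubi_class)
  ultimately show "x - y \<in> karoubi_null G n"
    by (auto simp: karoubi_class_def)
qed (rule karoubi_class_eqI)

text \<open>\<open>induced\<close> unites the classes of the images of all representatives.
  Compatibility makes these classes equal, and the union is over a nonempty set because
  \<open>x\<close> represents its own class.\<close>

lemma induced_karoubi_class:
  assumes "x \<in> preforms G n"
    and "\<And>y. y \<in> preforms G n \<Longrightarrow> y - x \<in> karoubi_null G n \<Longrightarrow> \<phi> y - \<phi> x \<in> karoubi_null G m"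
  shows "induced G m \<phi> (karoubi_class G n x) = karoubi_class G m (\<phi> x)"
proof -
  have "karoubi_class G m (\<phi> y) = karoubi_class G m (\<phi> x)" if "y \<in> karoubi_class G n x" for y
    using that by (intro karoubi_class_eqI assms(2)) (auto simp: karoubi_class_def)
  then have "induced G m \<phi> (karoubi_class G n x) =
      (\<Union>y\<in>karoubi_class G n x. karoubi_class G m (\<phi> x))"
    unfolding induced_def by (rule SUP_cong[OF refl])
  then show ?thesis using mem_karoubi_class[OF assms(1)] by blast
qed

end

text \<open>A functional on the quotient, as a function on tuples that kills all generators. Its
  values at lists of another length or with entries outside \<open>A\<close> are unconstrained, so
  it is compared with traces on \<open>preforms\<close> only.\<close>

locale karoubi_functional = fin_digraph G for G :: "('a, 'b) pre_digraph" +
  fixes n :: nat and T :: "('a, 'b) path_vec list \<Rightarrow> complex"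
  assumes kills: "s \<in> tensor_rels G n \<union> supercommutators G n \<Longrightarrow> pair T s = 0"
begin

lemma add:
  assumes "set xs \<union> {a, b} \<union> set ys \<subseteq> A" "length xs + length ys = n"
  shows "T (xs @ [a + b] @ ys) = T (xs @ [a] @ ys) + T (xs @ [b] @ ys)"
proof -
  have "gen (xs @ [a + b] @ ys) - gen (xs @ [a] @ ys) - gen (xs @ [b] @ ys) \<in> tensor_rels G n"
    using assms unfolding tensor_rels_def by blast
  from kills[OF UnI1, OF this] show ?thesis by (simp add: diff_eq_eq add.commute)
qed

lemma scale:
  assumes "set xs \<union> {a} \<union> set ys \<subseteq> A" "length xs + length ys = n"
  shows "T (xs @ [c \<cdot>\<^sub>c a] @ ys) = c * T (xs @ [a] @ ys)"
proof -
  have "gen (xs @ [c \<cdot>\<^sub>c a] @ ys) - c \<cdot>\<^sub>c gen (xs @ [a] @ ys) \<in> tensor_rels G n"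
    using assms unfolding tensor_rels_def by blast
  from kills[OF UnI1, OF this] show ?thesis by simp
qed

lemma balanced:
  assumes "set xs \<union> {a, b} \<union> set ys \<subseteq> A" "v \<in> V" "length xs + length ys + 1 = n"
  shows "T (xs @ [a \<odot> v, b] @ ys) = T (xs @ [a, v \<odot> b] @ ys)"
proof -
  have "gen (xs @ [a \<odot> v, b] @ ys) - gen (xs @ [a, v \<odot> b] @ ys) \<in> tensor_rels G n"
    using assms unfolding tensor_rels_def by blast
  from kills[OF UnI1, OF this] show ?thesis by simp
qed

lemma vertex:
  assumes "set xs \<union> set ys \<subseteq> A" "v \<in> V" "xs \<noteq> []" "length xs + length ys = n"
  shows "T (xs @ [v] @ ys) = 0"
proof -
  have "gen (xs @ [v] @ ys) \<in> tensor_rels G n"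
    using assms unfolding tensor_rels_def by blast
  from kills[OF UnI1, OF this] show ?thesis by simp
qed

lemma commute:
  assumes "length as = Suc i" "length bs = Suc j" "i + j = n" "set as \<subseteq> A" "set bs \<subseteq> A"
  shows "pair T (tuple_mult as bs) = (- 1) ^ (i * j) * pair T (tuple_mult bs as)"
proof -
  have "gen as \<in> preforms G i" "gen bs \<in> preforms G j"
    using assms by auto
  then have "gen as \<otimes>\<^sub>f gen bs - (- 1) ^ (i * j) \<cdot>\<^sub>c (gen bs \<otimes>\<^sub>f gen as) \<in> supercommutators G n"
    using assms(3) unfolding supercommutators_def by blast
  from kills[OF UnI2, OF this] show ?thesis by simp
qed

end

context fin_digraph
begin

lemma karoubi_functional_trace0:
  assumes "karoubi_functional G 0 T"
  shows "trace0 G (\<lambda>a. T [a])"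
proof -
  interpret karoubi_functional G 0 T by fact
  show ?thesis
  proof unfold_locales
    fix x y c assume "x \<in> A" "y \<in> A"
    then show "T [x + y] = T [x] + T [y]" "T [c \<cdot>\<^sub>c x] = c * T [x]" "T [x \<odot> y] = T [y \<odot> x]"
      using add[of "[]" x y "[]"] scale[of "[]" x "[]"] commute[of "[x]" 0 "[y]" 0]
      by (simp_all add: tuple_mult_simps)
  qed
qed

lemma karoubi_functional_trace1:
  assumes "karoubi_functional G 1 T"
  shows "trace1 G (\<lambda>a b. T [a, b])"
proof -
  interpret karoubi_functional G 1 T by fact
  show ?thesis
  proof unfold_locales
    fix x y z assume "x \<in> A" "y \<in> A" "z \<in> A"
    then show "T [x, y \<odot> z] = T [x \<odot> y, z] + T [z \<odot> x, y]"
      using commute[of "[z]" 0 "[x, y]" 1] by (simp add: tuple_mult_simps)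
  next
    fix x y z assume "x \<in> A" "y \<in> A" "z \<in> A"
    then show "T [x + y, z] = T [x, z] + T [y, z]" "T [z, x + y] = T [z, x] + T [z, y]"
      using add[of "[]" x y "[z]"] add[of "[z]" x y "[]"] by simp_all
  next
    fix x y c assume "x \<in> A" "y \<in> A"
    then show "T [c \<cdot>\<^sub>c x, y] = c * T [x, y]" "T [y, c \<cdot>\<^sub>c x] = c * T [y, x]"
      using scale[of "[]" x "[y]"] scale[of "[y]" x "[]"] by simp_all
  next
    fix x v assume "x \<in> A" "v \<in> V"
    then show "T [x, v] = 0"
      using vertex[of "[x]" "[]"] by simp
  qed
qed

lemma karoubi_functional_trace2:
  assumes "karoubi_functional G 2 T"
  shows "trace2 G (\<lambda>a b c. T [a, b, c])"
proof -
  interpret karoubi_functional G 2 T by fact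
  show ?thesis
  proof unfold_locales
    fix a x y z assume *: "a \<in> A" "x \<in> A" "y \<in> A" "z \<in> A"
    then show "T [a \<odot> x, y, z] = T [x, y, z \<odot> a] - T [x, y \<odot> z, a] + T [x \<odot> y, z, a]"
      using commute[of "[a]" 0 "[x, y, z]" 2] by (simp add: tuple_mult_simps)
    show "T [a, x \<odot> y, z] - T [a \<odot> x, y, z] + (T [y, z \<odot> a, x] - T [y \<odot> z, a, x]) = 0"
      using commute[of "[a, x]" 1 "[y, z]" 1] * by (simp add: tuple_mult_simps)
  next
    fix x y z w assume "x \<in> A" "z \<in> A" "y \<in> A" "w \<in> A"
    then show "T [x + y, z, w] = T [x, z, w] + T [y, z, w]"
      "T [z, x + y, w] = T [z, x, w] + T [z, y, w]"
      "T [z, w, x + y] = T [z, w, x] + T [z, w, y]"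
      using add[of "[]" x y "[z, w]"] add[of "[z]" x y "[w]"] add[of "[z, w]" x y "[]"]
      by simp_all
  next
    fix x y z c assume "x \<in> A" "y \<in> A" "z \<in> A"
    then show "T [c \<cdot>\<^sub>c x, y, z] = c * T [x, y, z]" "T [y, c \<cdot>\<^sub>c x, z] = c * T [y, x, z]"
      "T [y, z, c \<cdot>\<^sub>c x] = c * T [y, z, x]"
      using scale[of "[]" x "[y, z]"] scale[of "[y]" x "[z]"] scale[of "[y, z]" x "[]"] by simp_all
  next
    fix x v z assume "x \<in> A" "v \<in> V" "z \<in> A"
    then show "T [x, v, z] = 0"
      using vertex[of "[x]" "[z]"] by simp
  next
    fix x v z assume "x \<in> A" "z \<in> A" "v \<in> V"
    then show "T [x, z, v] = 0"
      using vertex[of "[x, z]" "[]"] by simp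
  next
    fix x v y z assume "x \<in> A" "v \<in> V" "y \<in> A" "z \<in> A"
    then show "T [x \<odot> v, y, z] = T [x, v \<odot> y, z]" "T [x, y \<odot> v, z] = T [x, y, v \<odot> z]"
      using balanced[of "[]" x y "[z]" v] balanced[of "[x]" y z "[]" v] by simp_all
  qed
qed

end

lemma list_length_cases:
  "length xs = Suc 0 \<longleftrightarrow> (\<exists>a. xs = [a])"
  "length xs = Suc (Suc 0) \<longleftrightarrow> (\<exists>a b. xs = [a, b])"
  "length xs = Suc (Suc (Suc 0)) \<longleftrightarrow> (\<exists>a b c. xs = [a, b, c])"
  by (auto simp: length_Suc_conv)

lemma add_eq_cases:
  "i + j = Suc 0 \<longleftrightarrow> i = 0 \<and> j = 1 \<or> i = 1 \<and> j = 0"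
  "i + j = Suc (Suc 0) \<longleftrightarrow> i = 0 \<and> j = 2 \<or> i = 1 \<and> j = 1 \<or> i = 2 \<and> j = 0"
  by auto

lemma (in trace0) karoubi_functional: "karoubi_functional G 0 (\<lambda>as. t (as ! 0))"
proof unfold_locales
  fix s assume "s \<in> tensor_rels G 0 \<union> supercommutators G 0"
  then show "pair (\<lambda>as. t (as ! 0)) s = 0"
  proof
    assume "s \<in> tensor_rels G 0"
    then show ?thesis by (auto simp: tensor_rels_def add scale)
  next
    assume "s \<in> supercommutators G 0"
    then obtain x y where *: "s = x \<otimes>\<^sub>f y - (- 1) ^ (0 * 0) \<cdot>\<^sub>c (y \<otimes>\<^sub>f x)"
      "x \<in> preforms G 0" "y \<in> preforms G 0"
      unfolding supercommutators_def by auto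
    show ?thesis
      unfolding *(1)
      by (intro pair_supercommutator_eq_0[OF *(2,3)])
        (auto simp: list_length_cases tuple_mult_simps cyclic)
  qed
qed

lemma (in trace1) karoubi_functional: "karoubi_functional G 1 (\<lambda>as. t (as ! 0) (as ! 1))"
proof unfold_locales
  fix s assume "s \<in> tensor_rels G 1 \<union> supercommutators G 1"
  then show "pair (\<lambda>as. t (as ! 0) (as ! 1)) s = 0"
  proof
    assume "s \<in> tensor_rels G 1"
    then show ?thesis
      by (auto simp: tensor_rels_def add_eq_cases list_length_cases linear vertex balanced)
  next
    assume "s \<in> supercommutators G 1"
    then obtain x y i j where *: "s = x \<otimes>\<^sub>f y - (- 1) ^ (i * j) \<cdot>\<^sub>c (y \<otimes>\<^sub>f x)" "i + j = 1"
      "x \<in> preforms G i" "y \<in> preforms G j"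
      unfolding supercommutators_def by blast
    show ?thesis
      unfolding *(1) using *(2)
      by (intro pair_supercommutator_eq_0[OF *(3,4)])
        (auto simp: add_eq_cases list_length_cases tuple_mult_simps mult_right)
  qed
qed

lemma (in trace2) karoubi_functional: "karoubi_functional G 2 (\<lambda>as. t (as ! 0) (as ! 1) (as ! 2))"
proof unfold_locales
  fix s assume "s \<in> tensor_rels G 2 \<union> supercommutators G 2"
  then show "pair (\<lambda>as. t (as ! 0) (as ! 1) (as ! 2)) s = 0"
  proof
    assume "s \<in> tensor_rels G 2"
    then show ?thesis
      by (auto simp: tensor_rels_def add_eq_cases list_length_cases linear vertex_1 vertex_2
          balanced_0 balanced_1 numeral_2_eq_2)
  next
    assume "s \<in> supercommutators G 2"
    then obtain x y i j where *: "s = x \<otimes>\<^sub>f y - (- 1) ^ (i * j) \<cdot>\<^sub>c (y \<otimes>\<^sub>f x)"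
      "i + j = 2" "x \<in> preforms G i" "y \<in> preforms G j"
      unfolding supercommutators_def by blast
    show ?thesis
      unfolding *(1)
    proof (rule pair_supercommutator_eq_0[OF *(3,4)])
      fix as bs :: "('a, 'b) path_vec list"
      assume l: "length as = Suc i" "set as \<subseteq> A" "length bs = Suc j" "set bs \<subseteq> A"
      let ?T = "\<lambda>as. t (as ! 0) (as ! 1) (as ! 2)"
      consider "i = 0" "j = 2" | "i = 1" "j = 1" | "i = 2" "j = 0"
        using *(2) by linarith
      then show "pair ?T (tuple_mult as bs) = (- 1) ^ (i * j) * pair ?T (tuple_mult bs as)"
      proof cases
        case 1
        then obtain w x y z where "as = [w]" "bs = [x, y, z]" "{w, x, y, z} \<subseteq> A"
          using l by (auto simp: list_length_cases numeral_2_eq_2)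
        then show ?thesis
          using commutator_02[of w x y z] 1 by (simp add: tuple_mult_simps)
      next
        case 2
        then obtain w x y z where "as = [w, x]" "bs = [y, z]" "{w, x, y, z} \<subseteq> A"
          using l by (auto simp: list_length_cases)
        then show ?thesis
          using commutator_11[of w x y z] 2 by (simp add: tuple_mult_simps algebra_simps eq_neg_iff_add_eq_0)
      next
        case 3
        then obtain w x y z where "bs = [w]" "as = [x, y, z]" "{w, x, y, z} \<subseteq> A"
          using l by (auto simp: list_length_cases numeral_2_eq_2)
        then show ?thesis
          using commutator_02[of w x y z] 3 by (simp add: tuple_mult_simps)
      qed
    qed
  qed
qed

abbreviation pair0 where "pair0 t \<equiv> pair (\<lambda>as. t (as ! 0))"
abbreviation pair1 where "pair1 t \<equiv> pair (\<lambda>as. t (as ! 0) (as ! 1))"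
abbreviation pair2 where "pair2 t \<equiv> pair (\<lambda>as. t (as ! 0) (as ! 1) (as ! 2))"

context fin_digraph
begin

lemma in_karoubi_null_iff_functional:
  "x \<in> karoubi_null G n \<longleftrightarrow> (\<forall>T. karoubi_functional G n T \<longrightarrow> pair T x = 0)"
proof -
  have "karoubi_functional G n T \<longleftrightarrow> (\<forall>s \<in> tensor_rels G n \<union> supercommutators G n. pair T s = 0)" for T
    unfolding karoubi_functional_def karoubi_functional_axioms_def
    by (blast intro: fin_digraph_axioms)
  then show ?thesis unfolding in_karoubi_null_iff by presburger
qed

lemma karoubi_null_0_iff:
  assumes "x \<in> preforms G 0"
  shows "x \<in> karoubi_null G 0 \<longleftrightarrow> (\<forall>t. trace0 G t \<longrightarrow> pair0 t x = 0)"
proof -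
  \<comment> \<open>The trace read off from \<open>T\<close> agrees with \<open>T\<close> on
    one-element lists over \<open>A\<close>, and \<open>x\<close> involves no others.\<close>
  have "pair T x = pair0 (\<lambda>a. T [a]) x" for T
    using assms by (rule pair_preforms_cong) (auto simp: list_length_cases)
  note * = this
  show ?thesis
    unfolding in_karoubi_null_iff_functional
  proof (intro iffI allI impI)
    fix t assume x: "\<forall>T. karoubi_functional G 0 T \<longrightarrow> pair T x = 0" and t: "trace0 G t"
    show "pair0 t x = 0"
      by (rule x[rule_format, OF trace0.karoubi_functional[OF t]])
  next
    fix T assume x: "\<forall>t. trace0 G t \<longrightarrow> pair0 t x = 0" and T: "karoubi_functional G 0 T"
    show "pair T x = 0"
      unfolding *[of T] by (rule x[rule_format, OF karoubi_functional_trace0[OF T]])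
  qed
qed

lemma karoubi_null_1_iff:
  assumes "x \<in> preforms G 1"
  shows "x \<in> karoubi_null G 1 \<longleftrightarrow> (\<forall>t. trace1 G t \<longrightarrow> pair1 t x = 0)"
proof -
  have "pair T x = pair1 (\<lambda>a b. T [a, b]) x" for T
    using assms by (rule pair_preforms_cong) (auto simp: list_length_cases)
  note * = this
  show ?thesis
    unfolding in_karoubi_null_iff_functional
  proof (intro iffI allI impI)
    fix t assume x: "\<forall>T. karoubi_functional G 1 T \<longrightarrow> pair T x = 0" and t: "trace1 G t"
    show "pair1 t x = 0"
      by (rule x[rule_format, OF trace1.karoubi_functional[OF t]])
  next
    fix T assume x: "\<forall>t. trace1 G t \<longrightarrow> pair1 t x = 0" and T: "karoubi_functional G 1 T"
    show "pair T x = 0"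
      unfolding *[of T] by (rule x[rule_format, OF karoubi_functional_trace1[OF T]])
  qed
qed

lemma karoubi_null_2_iff:
  assumes "x \<in> preforms G 2"
  shows "x \<in> karoubi_null G 2 \<longleftrightarrow> (\<forall>t. trace2 G t \<longrightarrow> pair2 t x = 0)"
proof -
  have "pair T x = pair2 (\<lambda>a b c. T [a, b, c]) x" for T
    using assms by (rule pair_preforms_cong) (auto simp: list_length_cases numeral_2_eq_2)
  note * = this
  show ?thesis
    unfolding in_karoubi_null_iff_functional
  proof (intro iffI allI impI)
    fix t assume x: "\<forall>T. karoubi_functional G 2 T \<longrightarrow> pair T x = 0" and t: "trace2 G t"
    show "pair2 t x = 0"
      by (rule x[rule_format, OF trace2.karoubi_functional[OF t]])
  next
    fix T assume x: "\<forall>t. trace2 G t \<longrightarrow> pair2 t x = 0" and T: "karoubi_functional G 2 T"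
    show "pair T x = 0"
      unfolding *[of T] by (rule x[rule_format, OF karoubi_functional_trace2[OF T]])
  qed
qed

end

section \<open>Differential, Lie derivative and contraction\<close>

context fin_digraph
begin

lemma form_d_gen [simp]: "form_d G (gen as) = gen (pone G # as)"
  by (simp add: form_d_def)

lemma form_d_preforms:
  assumes "x \<in> preforms G n"
  shows "form_d G x \<in> preforms G (Suc n)"
  unfolding form_d_def using assms by (rule preforms_lin_ext) auto

lemma pair1_form_d:
  assumes "x \<in> preforms G 0"
  shows "pair1 t (form_d G x) = pair0 (t (pone G)) x"
  unfolding form_d_def pair_lin_ext using assms
  by (rule pair_preforms_cong) (auto simp: list_length_cases)

lemma form_d_karoubi_null:
  assumes "x \<in> preforms G 0" "x \<in> karoubi_null G 0"
  shows "form_d G x \<in> karoubi_null G 1"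
proof -
  have "form_d G x \<in> preforms G 1" using form_d_preforms[OF assms(1)] by simp
  then show ?thesis
    using assms(2) unfolding karoubi_null_0_iff[OF assms(1)]
    by (subst karoubi_null_1_iff) (auto simp only: pair1_form_d[OF assms(1)] intro: trace1.trace0)
qed

text \<open>Each coordinate of each coefficient is itself a trace. Hence coefficients are well
  defined on degree-one classes, and there are enough traces to tell classes apart.\<close>

lemma trace1_form_coeff: "trace1 G (\<lambda>x y. Poly_Mapping.lookup (form_coeff G b x y) z)"
  by unfold_locales (simp_all add: lookup_add form_coeff_vertex form_coeff_mult)

lemma form_coeff_ends:
  "idem (tail G b) \<odot> form_coeff G b x y \<odot> idem (head G b) = form_coeff G b x y"
proof (induction y rule: vec_induct)
  case (gen p)
  obtain u q v where p: "p = (u, q, v)" by (cases p)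
  have "idem (tail G b) \<odot> (gen (u, q', tail G b) \<odot> x \<odot> gen (head G b, q'', v)) \<odot> idem (head G b) =
      gen (u, q', tail G b) \<odot> x \<odot> gen (head G b, q'', v)" for q' q''
  proof -
    have "idem (tail G b) \<odot> gen (u, q', tail G b) = gen (u, q', tail G b)"
      "gen (head G b, q'', v) \<odot> idem (head G b) = gen (head G b, q'', v)"
      by (simp_all add: pmult_gen)
    then show ?thesis by (metis pmult_assoc)
  qed
  then show ?case by (simp add: p form_coeff_gen pmult_sum_left pmult_sum_right)
qed simp_all

lemma cyc_deriv_ends:
  "x \<in> A \<Longrightarrow> idem (tail G b) \<odot> cyc_deriv G b x \<odot> idem (head G b) = cyc_deriv G b x"
  by (simp add: cyc_deriv_eq_form_coeff form_coeff_ends)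

lemma cyc_deriv_closed [simp]: "x \<in> A \<Longrightarrow> cyc_deriv G b x \<in> A"
  by (simp add: cyc_deriv_eq_form_coeff)

text \<open>Testing on coordinate traces isolates one coefficient. The endpoint conditions are
  essential because the form \<open>z db\<close> sees only the component of \<open>z\<close> with
  matching ends.\<close>

lemma one_form_coeffs_eqI:
  assumes "\<And>b. b \<in> arcs G \<Longrightarrow> idem (tail G b) \<odot> p b \<odot> idem (head G b) = p b"
    and "\<And>b. b \<in> arcs G \<Longrightarrow> idem (tail G b) \<odot> q b \<odot> idem (head G b) = q b"
    and "\<And>t. trace1 G t \<Longrightarrow> (\<Sum>b\<in>arcs G. t (p b) (arrow G b)) = (\<Sum>b\<in>arcs G. t (q b) (arrow G b))"
    and "b \<in> arcs G"
  shows "p b = q b"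
proof (rule poly_mapping_eqI)
  fix z
  have "(\<Sum>c\<in>arcs G. Poly_Mapping.lookup (form_coeff G b (p c) (arrow G c)) z) =
      (\<Sum>c\<in>arcs G. Poly_Mapping.lookup (form_coeff G b (q c) (arrow G c)) z)"
    by (rule assms(3)) (rule trace1_form_coeff)
  also have "(\<Sum>c\<in>arcs G. Poly_Mapping.lookup (form_coeff G b (p c) (arrow G c)) z) =
      (\<Sum>c\<in>arcs G. if c = b then Poly_Mapping.lookup (p b) z else 0)"
    by (rule sum.cong) (auto simp: form_coeff_arrow assms(1))
  also have "(\<Sum>c\<in>arcs G. Poly_Mapping.lookup (form_coeff G b (q c) (arrow G c)) z) =
      (\<Sum>c\<in>arcs G. if c = b then Poly_Mapping.lookup (q b) z else 0)"
    by (rule sum.cong) (auto simp: form_coeff_arrow assms(2))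
  finally show "Poly_Mapping.lookup (p b) z = Poly_Mapping.lookup (q b) z"
    using assms(4) by simp
qed

lemma form_coeff_eqI:
  assumes "x \<in> A" "y \<in> A"
    and "\<And>b. b \<in> arcs G \<Longrightarrow> idem (tail G b) \<odot> p b \<odot> idem (head G b) = p b"
    and "\<And>t. trace1 G t \<Longrightarrow> t x y = (\<Sum>b\<in>arcs G. t (p b) (arrow G b))"
    and "b \<in> arcs G"
  shows "form_coeff G b x y = p b"
  by (rule one_form_coeffs_eqI[OF form_coeff_ends])
    (use assms in \<open>simp_all flip: trace1.expand\<close>)

section \<open>The Euler derivation and division by degree\<close>

definition euler :: "('a, 'b) path_der"
  where "euler = (\<lambda>x\<in>A. path_derivation G (arrow G) x)"

lemma euler_derivation: "euler \<in> derivations G"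
  unfolding euler_def by (rule path_derivation_in_derivations) simp

lemma euler_gen:
  assumes "awalk u p v"
  shows "euler (gen (u, p, v)) = of_nat (length p) \<cdot>\<^sub>c gen (u, p, v)"
proof -
  interpret euler: relative_derivation G euler by unfold_locales (rule euler_derivation)
  show ?thesis
    using assms
  proof (induction p arbitrary: u)
    case Nil
    then show ?case by (auto simp: awalk_Nil_iff)
  next
    case (Cons b p)
    then have *: "u = tail G b" "b \<in> arcs G" "awalk (head G b) p v"
      by (auto simp: awalk_Cons_iff)
    have "euler (arrow G b) = arrow G b"
      using * by (simp add: euler_def path_derivation_arrow pmult_assoc)
    then show ?case using * Cons.IH
      by (simp add: gen_Cons free.scale_left_distrib)
  qed
qed

text \<open>Division by the degree shifted by \<open>k\<close>; the junk value \<open>1 / 0 = 0\<close> kills degree zero.\<close>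

definition degree_div :: "nat \<Rightarrow> ('a, 'b) path_vec \<Rightarrow> ('a, 'b) path_vec"
  where "degree_div k = lin_ext (\<lambda>(u, p, v). (1 / of_nat (length p + k)) \<cdot>\<^sub>c gen (u, p, v))"

lemma degree_div_linear [simp]:
  "degree_div k (x + y) = degree_div k x + degree_div k y"
  "degree_div k (c \<cdot>\<^sub>c x) = c \<cdot>\<^sub>c degree_div k x"
  "degree_div k 0 = 0"
  by (simp_all add: degree_div_def)

lemma degree_div_closed [simp]:
  assumes "x \<in> A"
  shows "degree_div k x \<in> A"
  using assms by (induction x rule: path_alg_induct) (auto simp: degree_div_def)

text \<open>On paths of length \<open>n\<close> the operator \<open>E + 1\<close> is multiplication
  by \<open>n + 1\<close>, which is never zero, so the inverse exists in every degree.\<close>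

lemma degree_div_euler:
  assumes "x \<in> A"
  shows "degree_div 1 (euler x + x) = x"
proof -
  interpret euler: relative_derivation G euler by unfold_locales (rule euler_derivation)
  show ?thesis
    using assms
  proof (induction x rule: path_alg_induct)
    case (gen u p v)
    have "(of_nat (length p) :: complex) + 1 \<noteq> 0"
      by (metis of_nat_Suc of_nat_eq_0_iff add.commute nat.distinct(1))
    moreover have "degree_div 1 (gen (u, p, v)) = (1 / of_nat (length p + 1)) \<cdot>\<^sub>c gen (u, p, v)"
      by (simp add: degree_div_def)
    ultimately show ?case
      using gen by (simp add: euler_gen free.scale_left_distrib[symmetric] field_simps
          add_divide_distrib[symmetric])
  next
    case (add x y)
    have "euler (x + y) + (x + y) = (euler x + x) + (euler y + y)" using add by simp
    then show ?case using add by (simp only: degree_div_linear)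
  next
    case (scale c x)
    have "euler (c \<cdot>\<^sub>c x) + c \<cdot>\<^sub>c x = c \<cdot>\<^sub>c (euler x + x)"
      using scale by (simp add: free.scale_right_distrib)
    then show ?case using scale by (simp only: degree_div_linear)
  qed simp
qed

lemma cyc_deriv_linear [simp]:
  "cyc_deriv G b (x + y) = cyc_deriv G b x + cyc_deriv G b y"
  "cyc_deriv G b (c \<cdot>\<^sub>c x) = c \<cdot>\<^sub>c cyc_deriv G b x"
  "cyc_deriv G b 0 = 0"
  by (simp_all add: cyc_deriv_def)

text \<open>Opening a necklace removes one arrow, so the degree shifts by one. On trivial paths both
  sides are zero.\<close>

lemma cyc_deriv_degree_div: "cyc_deriv G b (degree_div 0 x) = degree_div 1 (cyc_deriv G b x)"
proof (induction x rule: vec_induct)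
  case (gen p)
  obtain u q v where p: "p = (u, q, v)" by (cases p)
  have "degree_div 1 (\<Sum>i\<in>I. gen (head G b, open_at i q, tail G b)) =
      (\<Sum>i\<in>I. (1 / of_nat (length q)) \<cdot>\<^sub>c gen (head G b, open_at i q, tail G b))"
    if "I \<subseteq> {..<length q}" for I
    using that
    by (induction I rule: infinite_finite_induct)
      (auto simp: degree_div_def open_at_def min_def of_nat_diff)
  from this[of "{i. i < length q \<and> q ! i = b}", OF subsetI] show ?case
    unfolding p cyc_deriv_def degree_div_def[of 0]
    by (cases "u = v") (auto simp: free.scale_sum_right)
qed simp_all

end

context relative_derivation
begin

lemma form_lie_preforms:
  assumes "x \<in> preforms G n"
  shows "form_lie \<theta> x \<in> preforms G n"
  unfolding form_lie_def using assms
proof (rule preforms_lin_ext)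
  fix as assume "length as = Suc n" "set as \<subseteq> A"
  then show "(\<Sum>i<length as. gen (as[i := \<theta> (as ! i)])) \<in> preforms G n"
    by (intro preforms_sum) (auto dest!: set_update_subset_insert[THEN subsetD] intro!: der_closed)
qed

lemma pair2_form_lie:
  assumes "x \<in> preforms G 2"
  shows "pair2 t (form_lie \<theta> x) = pair2 (\<lambda>x y z. t (\<theta> x) y z + t x (\<theta> y) z + t x y (\<theta> z)) x"
  unfolding form_lie_def pair_lin_ext using assms
  by (rule pair_preforms_cong) (auto simp: list_length_cases numeral_2_eq_2 pair_sum)

lemma form_contract_gen:
  "form_contract \<theta> (gen [x, y, z]) =
    gen [x \<odot> \<theta> y, z] + gen [x \<odot> y, \<theta> z] - gen [x, y \<odot> \<theta> z]"
  by (simp add: form_contract_def numeral_2_eq_2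
      atLeastLessThanSuc tuple_mult_simps free.scale_minus_left)

lemma form_contract_preforms:
  assumes "x \<in> preforms G 2"
  shows "form_contract \<theta> x \<in> preforms G 1"
  using assms
proof (induction x rule: preforms_induct)
  case (gen as)
  then show ?case by (auto simp: list_length_cases numeral_2_eq_2 form_contract_gen)
qed (simp_all add: form_contract_def)

lemma pair1_form_contract:
  assumes "x \<in> preforms G 2"
  shows "pair1 t (form_contract \<theta> x) =
    pair2 (\<lambda>x y z. t (x \<odot> \<theta> y) z + t (x \<odot> y) (\<theta> z) - t x (y \<odot> \<theta> z)) x"
  using assms
proof (induction x rule: preforms_induct)
  case (gen as)
  then show ?case by (auto simp: list_length_cases numeral_2_eq_2 form_contract_gen)
qed (simp_all add: form_contract_def)

end

context fin_digraph
begin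

lemma form_lie_karoubi_null:
  assumes "\<theta> \<in> derivations G" "x \<in> preforms G 2" "x \<in> karoubi_null G 2"
  shows "form_lie \<theta> x \<in> karoubi_null G 2"
proof -
  interpret relative_derivation G \<theta> by unfold_locales fact
  show ?thesis
    unfolding karoubi_null_2_iff[OF form_lie_preforms[OF assms(2)]] pair2_form_lie[OF assms(2)]
  proof (intro allI impI)
    fix t assume "trace2 G t"
    then have "trace2_derivation G t \<theta>"
      by (simp add: trace2_derivation_def relative_derivation_axioms)
    from trace2_derivation.lie_trace2[OF this]
    show "pair2 (\<lambda>x y z. t (\<theta> x) y z + t x (\<theta> y) z + t x y (\<theta> z)) x = 0"
      using assms(3) karoubi_null_2_iff[OF assms(2)] by blast
  qed
qed

lemma form_contract_karoubi_null:
  assumes "\<theta> \<in> derivations G" "x \<in> preforms G 2" "x \<in> karoubi_null G 2"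
  shows "form_contract \<theta> x \<in> karoubi_null G 1"
proof -
  interpret relative_derivation G \<theta> by unfold_locales fact
  show ?thesis
    unfolding karoubi_null_1_iff[OF form_contract_preforms[OF assms(2)]] pair1_form_contract[OF assms(2)]
  proof (intro allI impI)
    fix t assume "trace1 G t"
    then have "trace1_derivation G t \<theta>"
      by (simp add: trace1_derivation_def relative_derivation_axioms)
    from trace1_derivation.contract_trace2[OF this]
    show "pair2 (\<lambda>x y z. t (x \<odot> \<theta> y) z + t (x \<odot> y) (\<theta> z) - t x (y \<odot> \<theta> z)) x = 0"
      using assms(3) karoubi_null_2_iff[OF assms(2)] by blast
  qed
qed

end

section \<open>The symplectic form\<close>

lemma double_quiver_simps [simp]:
  "verts (double_quiver Q) = verts Q"
  "arcs (double_quiver Q) = Arr ` arcs Q \<union> Star ` arcs Q"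
  "tail (double_quiver Q) (Arr a) = tail Q a" "tail (double_quiver Q) (Star a) = head Q a"
  "head (double_quiver Q) (Arr a) = head Q a" "head (double_quiver Q) (Star a) = tail Q a"
  by (simp_all add: double_quiver_def)

lemma fin_digraph_double_quiver:
  assumes "fin_digraph Q"
  shows "fin_digraph (double_quiver Q)"
proof -
  interpret fin_digraph Q by fact
  show ?thesis by unfold_locales auto
qed

locale quiver =
  fixes Q :: "('v, 'e) pre_digraph"
  assumes fin_digraph_Q: "fin_digraph Q"

sublocale quiver \<subseteq> fin_digraph "double_quiver Q"
  by (rule fin_digraph_double_quiver[OF fin_digraph_Q])

context quiver
begin

abbreviation D where "D \<equiv> double_quiver Q"
abbreviation arr where "arr a \<equiv> arrow D (Arr a)"
abbreviation star where "star a \<equiv> arrow D (Star a)"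

lemma sum_arcs_double:
  "(\<Sum>b\<in>arcs D. f b) = (\<Sum>a\<in>arcs Q. f (Arr a) + f (Star a))"
  for f :: "'e dbl \<Rightarrow> 'x::comm_monoid_add"
proof -
  have "finite (arcs Q)" using fin_digraph.finite_arcs[OF fin_digraph_Q] .
  then have "(\<Sum>b\<in>arcs D. f b) = (\<Sum>b\<in>Arr ` arcs Q. f b) + (\<Sum>b\<in>Star ` arcs Q. f b)"
    unfolding double_quiver_simps by (intro sum.union_disjoint) auto
  also have "\<dots> = (\<Sum>a\<in>arcs Q. f (Arr a)) + (\<Sum>a\<in>arcs Q. f (Star a))"
    by (simp add: sum.reindex inj_on_def)
  finally show ?thesis by (simp add: sum.distrib)
qed

lemma arr_star_closed:
  assumes "a \<in> arcs Q"
  shows "arr a \<in> A" "star a \<in> A"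
  using assms by auto

lemma symp_form_preforms: "symp_form Q \<in> preforms D 2"
  by (auto simp: symp_form_def Let_def tuple_mult_simps numeral_2_eq_2 arr_star_closed
      intro!: preforms_sum)

lemma pair2_symp_form:
  assumes "trace2 D t"
  shows "pair2 t (symp_form Q) = (\<Sum>a\<in>arcs Q. t (pone D) (star a) (arr a))"
proof -
  interpret trace2 D t by fact
  show ?thesis
    by (auto simp: symp_form_def Let_def pair_sum tuple_mult_simps vertex_1
        arr_star_closed intro!: sum.cong)
qed

text \<open>The coefficient of \<open>db\<close> in \<open>i\<^sub>\<theta>\<omega> = \<Sum>\<^sub>a (\<theta>(a\<^sup>*) da - \<theta>(a) da\<^sup>*)\<close>.\<close>

definition tau_coeff :: "('v, 'e dbl) path_der \<Rightarrow> 'e dbl \<Rightarrow> ('v, 'e dbl) path_vec"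
  where "tau_coeff \<theta> b = (case b of Arr a \<Rightarrow> \<theta> (star a) | Star a \<Rightarrow> - \<theta> (arr a))"

lemma tau_coeff_ends:
  assumes "\<theta> \<in> derivations D" "b \<in> arcs D"
  shows "idem (tail D b) \<odot> tau_coeff \<theta> b \<odot> idem (head D b) = tau_coeff \<theta> b"
proof -
  interpret relative_derivation D \<theta> by unfold_locales fact
  show ?thesis
    using assms(2) der_arrow_ends[of "Arr _"] der_arrow_ends[of "Star _"]
    by (auto simp: tau_coeff_def)
qed

lemma tau_coeff_closed:
  assumes "\<theta> \<in> derivations D" "b \<in> arcs D"
  shows "tau_coeff \<theta> b \<in> A"
proof -
  interpret relative_derivation D \<theta> by unfold_locales fact
  show ?thesis using assms(2) arr_star_closed by (auto simp: tau_coeff_def)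
qed

lemma sum_tau_coeff:
  assumes "\<theta> \<in> derivations D" "trace1 D t"
  shows "(\<Sum>b\<in>arcs D. t (tau_coeff \<theta> b) (arrow D b)) =
    (\<Sum>a\<in>arcs Q. t (\<theta> (star a)) (arr a) - t (\<theta> (arr a)) (star a))"
proof -
  interpret relative_derivation D \<theta> by unfold_locales fact
  interpret trace1 D t by fact
  show ?thesis
    unfolding sum_arcs_double by (rule sum.cong) (auto simp: tau_coeff_def minus_left arr_star_closed)
qed

lemma pair1_contract_symp_form:
  assumes "\<theta> \<in> derivations D" "trace1 D t"
  shows "pair1 t (form_contract \<theta> (symp_form Q)) = (\<Sum>b\<in>arcs D. t (tau_coeff \<theta> b) (arrow D b))"
proof -
  interpret relative_derivation D \<theta> by unfold_locales fact
  interpret trace1 D t by fact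
  interpret trace1_derivation D t \<theta> ..
  show ?thesis
    unfolding pair1_form_contract[OF symp_form_preforms] pair2_symp_form[OF contract_trace2]
      sum_tau_coeff[OF assms]
    by (rule sum.cong) (auto simp: arr_star_closed mult_one)
qed

section \<open>Bijectivity of tau and the symplectic condition\<close>

definition tau_inverse :: "('e dbl \<Rightarrow> ('v, 'e dbl) path_vec) \<Rightarrow> ('v, 'e dbl) path_der"
  where "tau_inverse p =
    (\<lambda>x\<in>A. path_derivation D (\<lambda>b. case b of Arr a \<Rightarrow> - p (Star a) | Star a \<Rightarrow> p (Arr a)) x)"

lemma tau_inverse_derivation:
  assumes "\<And>b. b \<in> arcs D \<Longrightarrow> p b \<in> A"
  shows "tau_inverse p \<in> derivations D"
  unfolding tau_inverse_def using assms by (intro path_derivation_in_derivations) auto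

lemma tau_coeff_tau_inverse:
  assumes "b \<in> arcs D" "idem (tail D b) \<odot> p b \<odot> idem (head D b) = p b"
  shows "tau_coeff (tau_inverse p) b = p b"
  using assms by (auto simp: tau_coeff_def tau_inverse_def arr_star_closed path_derivation_arrow)

lemma derivation_eqI_tau_coeff:
  assumes "\<theta> \<in> derivations D" "\<eta> \<in> derivations D"
    and *: "\<And>b. b \<in> arcs D \<Longrightarrow> tau_coeff \<theta> b = tau_coeff \<eta> b"
  shows "\<theta> = \<eta>"
proof (rule der_eqI[OF assms(1,2)])
  fix b assume "b \<in> arcs D"
  then show "\<theta> (arrow D b) = \<eta> (arrow D b)"
    using *[of "Arr _"] *[of "Star _"] by (auto simp: tau_coeff_def)
qed

lemma derivation_eqI:
  assumes "\<theta> \<in> derivations D" "\<eta> \<in> derivations D"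
    and *: "\<And>t. trace1 D t \<Longrightarrow>
      (\<Sum>b\<in>arcs D. t (tau_coeff \<theta> b) (arrow D b)) = (\<Sum>b\<in>arcs D. t (tau_coeff \<eta> b) (arrow D b))"
  shows "\<theta> = \<eta>"
  using assms(1,2)
  by (rule derivation_eqI_tau_coeff)
    (rule one_form_coeffs_eqI; simp add: tau_coeff_ends assms del: double_quiver_simps)

lemma tau_eq_class:
  assumes "\<theta> \<in> derivations D"
  shows "tau Q \<theta> = karoubi_class D 1 (form_contract \<theta> (symp_form Q))"
  unfolding tau_def symp_class_def
proof (rule induced_karoubi_class[OF symp_form_preforms])
  fix y assume *: "y \<in> preforms D 2" "y - symp_form Q \<in> karoubi_null D 2"
  have "form_contract \<theta> (y - symp_form Q) \<in> karoubi_null D 1"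
    using * symp_form_preforms by (intro form_contract_karoubi_null assms) auto
  then show "form_contract \<theta> y - form_contract \<theta> (symp_form Q) \<in> karoubi_null D 1"
    by (simp add: form_contract_def)
qed

lemma contract_symp_form_preforms:
  assumes "\<theta> \<in> derivations D"
  shows "form_contract \<theta> (symp_form Q) \<in> preforms D 1"
proof -
  interpret relative_derivation D \<theta> by unfold_locales fact
  show ?thesis by (rule form_contract_preforms[OF symp_form_preforms])
qed

lemma karoubi_class_1_eq_iff:
  assumes "x \<in> preforms D 1" "y \<in> preforms D 1"
  shows "karoubi_class D 1 x = karoubi_class D 1 y \<longleftrightarrow> (\<forall>t. trace1 D t \<longrightarrow> pair1 t x = pair1 t y)"
  unfolding karoubi_class_eq_iff[OF assms(1)] karoubi_null_1_iff[OF preforms_diff[OF assms]]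
  by simp

lemma tau_bij: "bij_betw (tau Q) (derivations D) (karoubi D 1)"
proof (rule bij_betwI')
  fix \<theta> \<eta> assume *: "\<theta> \<in> derivations D" "\<eta> \<in> derivations D"
  show "tau Q \<theta> = tau Q \<eta> \<longleftrightarrow> \<theta> = \<eta>"
  proof
    assume "tau Q \<theta> = tau Q \<eta>"
    then have "\<forall>t. trace1 D t \<longrightarrow>
        pair1 t (form_contract \<theta> (symp_form Q)) = pair1 t (form_contract \<eta> (symp_form Q))"
      unfolding tau_eq_class[OF *(1)] tau_eq_class[OF *(2)]
      by (subst (asm) karoubi_class_1_eq_iff) (rule contract_symp_form_preforms, fact)+
    then show "\<theta> = \<eta>"
      by (intro derivation_eqI *) (simp only: pair1_contract_symp_form[OF *(1), symmetric]
        pair1_contract_symp_form[OF *(2), symmetric])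
  qed simp
next
  fix \<theta> assume *: "\<theta> \<in> derivations D"
  show "tau Q \<theta> \<in> karoubi D 1"
    unfolding tau_eq_class[OF *] karoubi_def
    by (rule imageI) (rule contract_symp_form_preforms[OF *])
next
  fix X assume "X \<in> karoubi D 1"
  then obtain x where x: "x \<in> preforms D 1" "X = karoubi_class D 1 x"
    by (auto simp: karoubi_def)
  \<comment> \<open>The coefficients of the representative \<open>x\<close>, so that
    \<open>x\<close> is cyclically the sum of the \<open>p b db\<close>; they have the right ends
    and hence prescribe a derivation.\<close>
  define p where "p b = lin_ext (\<lambda>as. form_coeff D b (as ! 0) (as ! 1)) x" for b
  have closed: "lin_ext (\<lambda>as. form_coeff D b (as ! 0) (as ! 1)) y \<in> A" if "y \<in> preforms D 1" for b y
    using that by (induction y rule: preforms_induct) (auto simp: list_length_cases)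
  then have pA: "p b \<in> A" for b
    using x(1) by (simp only: p_def)
  have ends: "idem (tail D b) \<odot> p b \<odot> idem (head D b) = p b" for b
    unfolding p_def by (induction x rule: vec_induct) (simp_all add: form_coeff_ends)
  let ?\<theta> = "tau_inverse p"
  have der: "?\<theta> \<in> derivations D" by (rule tau_inverse_derivation) (rule pA)
  have "pair1 t x = pair1 t (form_contract ?\<theta> (symp_form Q))" if t: "trace1 D t" for t
  proof -
    interpret trace1 D t by fact
    have "pair1 t x = (\<Sum>b\<in>arcs D. t (p b) (arrow D b))"
      using x(1) unfolding p_def
    proof (induction x rule: preforms_induct)
      case (gen as)
      then show ?case by (auto simp: list_length_cases expand simp del: double_quiver_simps)
    next
      case (add x y)
      then show ?case
        by (simp add: add_left closed[unfolded One_nat_def] sum.distrib del: double_quiver_simps)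
    next
      case (scale c x)
      then show ?case
        by (simp add: scale_left closed[unfolded One_nat_def]
            sum_distrib_left del: double_quiver_simps)
    qed (simp add: zero_left)
    also have "\<dots> = (\<Sum>b\<in>arcs D. t (tau_coeff ?\<theta> b) (arrow D b))"
      by (rule sum.cong) (simp_all add: tau_coeff_tau_inverse ends del: double_quiver_simps)
    finally show ?thesis by (simp only: pair1_contract_symp_form[OF der t])
  qed
  then have "X = tau Q ?\<theta>"
    unfolding tau_eq_class[OF der] x(2)
    by (subst karoubi_class_1_eq_iff)
      (simp_all add: x(1)[simplified] contract_symp_form_preforms[OF der, simplified])
  then show "\<exists>\<theta>\<in>derivations D. X = tau Q \<theta>" using der by blast
qed

lemma symp_derivations_iff:
  "\<theta> \<in> symp_derivations Q \<longleftrightarrow> \<theta> \<in> derivations D \<and> (\<forall>t. trace2 D t \<longrightarrow>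
    (\<Sum>a\<in>arcs Q. t (pone D) (\<theta> (star a)) (arr a) + t (pone D) (star a) (\<theta> (arr a))) = 0)"
proof (cases "\<theta> \<in> derivations D")
  case True
  then interpret relative_derivation D \<theta> by unfold_locales
  have "induced D 2 (form_lie \<theta>) (symp_class Q) = karoubi_class D 2 (form_lie \<theta> (symp_form Q))"
    unfolding symp_class_def
  proof (rule induced_karoubi_class[OF symp_form_preforms])
    fix y assume *: "y \<in> preforms D 2" "y - symp_form Q \<in> karoubi_null D 2"
    have "form_lie \<theta> (y - symp_form Q) \<in> karoubi_null D 2"
      using * symp_form_preforms True by (intro form_lie_karoubi_null) auto
    then show "form_lie \<theta> y - form_lie \<theta> (symp_form Q) \<in> karoubi_null D 2"
      by (simp add: form_lie_def)
  qed
  then have "\<theta> \<in> symp_derivations Q \<longleftrightarrow> form_lie \<theta> (symp_form Q) \<in> karoubi_null D 2"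
    using True karoubi_class_eq_iff[OF form_lie_preforms[OF symp_form_preforms], of 0]
    by (simp add: symp_derivations_def)
  also have "\<dots> \<longleftrightarrow> (\<forall>t. trace2 D t \<longrightarrow> pair2 t (form_lie \<theta> (symp_form Q)) = 0)"
    by (rule karoubi_null_2_iff) (rule form_lie_preforms[OF symp_form_preforms])
  also have "pair2 t (form_lie \<theta> (symp_form Q)) =
      (\<Sum>a\<in>arcs Q. t (pone D) (\<theta> (star a)) (arr a) + t (pone D) (star a) (\<theta> (arr a)))"
    if "trace2 D t" for t
  proof -
    interpret trace2 D t by fact
    interpret trace2_derivation D t \<theta> ..
    show ?thesis
      unfolding pair2_form_lie[OF symp_form_preforms] pair2_symp_form[OF lie_trace2]
      by (rule sum.cong) (auto simp: linear arr_star_closed)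
  qed
  then have "(\<forall>t. trace2 D t \<longrightarrow> pair2 t (form_lie \<theta> (symp_form Q)) = 0) \<longleftrightarrow>
     (\<forall>t. trace2 D t \<longrightarrow>
    (\<Sum>a\<in>arcs Q. t (pone D) (\<theta> (star a)) (arr a) + t (pone D) (star a) (\<theta> (arr a))) = 0)"
    by simp
  finally show ?thesis using True by simp
next
  case False
  then show ?thesis by (simp add: symp_derivations_def)
qed

end

section \<open>Hamiltonian derivations\<close>

context quiver
begin

lemma symp_derivationsD:
  assumes "\<theta> \<in> symp_derivations Q" "trace2 D t"
  shows "(\<Sum>a\<in>arcs Q. t (pone D) (\<theta> (star a)) (arr a) + t (pone D) (star a) (\<theta> (arr a))) = 0"
  using assms unfolding symp_derivations_iff by blast

definition hamiltonian :: "('v, 'e dbl) path_vec \<Rightarrow> ('v, 'e dbl) path_der"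
  where "hamiltonian x = tau_inverse (\<lambda>b. cyc_deriv D b x)"

lemma hamiltonian_derivation:
  assumes "x \<in> A"
  shows "hamiltonian x \<in> derivations D"
  unfolding hamiltonian_def by (rule tau_inverse_derivation) (simp add: assms)

lemma tau_coeff_hamiltonian:
  assumes "x \<in> A" "b \<in> arcs D"
  shows "tau_coeff (hamiltonian x) b = cyc_deriv D b x"
  unfolding hamiltonian_def
  by (rule tau_coeff_tau_inverse[OF assms(2)]) (rule cyc_deriv_ends[OF assms(1)])

lemma hamiltonian_arrows:
  assumes "x \<in> A" "a \<in> arcs Q"
  shows "hamiltonian x (star a) = cyc_deriv D (Arr a) x" "hamiltonian x (arr a) = - cyc_deriv D (Star a) x"
  using tau_coeff_hamiltonian[OF assms(1), of "Arr a"] tau_coeff_hamiltonian[OF assms(1), of "Star a"] assms(2)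
  by (auto simp: tau_coeff_def minus_equation_iff)

lemma sum_tau_coeff_hamiltonian:
  assumes "x \<in> A" "trace1 D t"
  shows "(\<Sum>b\<in>arcs D. t (tau_coeff (hamiltonian x) b) (arrow D b)) = t (pone D) x"
  unfolding trace1.expand_one[OF assms(2,1)]
  by (rule sum.cong) (simp_all add: tau_coeff_hamiltonian assms(1) del: double_quiver_simps)

text \<open>Dual form of \<open>L_\<theta>\<omega> = d i_\<theta>\<omega> = ddx = 0\<close>:
  evaluated at \<open>a\<^sub>0 = 1\<close> the trace has degree one, and the sum becomes its value
  on \<open>d1 dx\<close>, where \<open>d1 = 0\<close>.\<close>

lemma hamiltonian_symplectic:
  assumes "x \<in> A"
  shows "hamiltonian x \<in> symp_derivations Q"
  unfolding symp_derivations_iff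
proof (intro conjI allI impI)
  show der: "hamiltonian x \<in> derivations D" by (rule hamiltonian_derivation) fact
  interpret relative_derivation D "hamiltonian x" by unfold_locales (rule der)
  fix t assume "trace2 D t"
  then interpret t: trace2 D t .
  interpret s: trace1 D "t (pone D)" by (rule t.trace1)
  have [simp]: "t (pone D) (pone D) y = 0" if "y \<in> A" for y
    using that by (simp add: t.vertex_1)
  \<comment> \<open>Anticommutativity of \<open>dy\<close> and \<open>dz\<close>, obtained from the
    Leibniz rule for \<open>yz\<close> together with \<open>d1 = 0\<close>.\<close>
  have anti: "t (pone D) y z = - t (pone D) z y" if "y \<in> A" "z \<in> A" for y z
    using s.mult_one[OF that] that by (simp add: eq_neg_iff_add_eq_0)
  have "(\<Sum>a\<in>arcs Q. t (pone D) (hamiltonian x (star a)) (arr a) + t (pone D) (star a) (hamiltonian x (arr a)))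
      = (\<Sum>b\<in>arcs D. t (pone D) (tau_coeff (hamiltonian x) b) (arrow D b))"
    unfolding sum_tau_coeff[OF der s.trace1_axioms]
    by (intro sum.cong) (simp_all add: arr_star_closed anti[of "star _" "hamiltonian x (arr _)"])
  also have "\<dots> = t (pone D) (pone D) x"
    by (rule sum_tau_coeff_hamiltonian[OF assms s.trace1_axioms])
  finally show "(\<Sum>a\<in>arcs Q. t (pone D) (hamiltonian x (star a)) (arr a) +
      t (pone D) (star a) (hamiltonian x (arr a))) = 0"
    using assms by simp
qed

text \<open>
  With the Euler derivation \<open>E\<close>, Cartan's formula \<open>L\<^sub>E = d i\<^sub>E + i\<^sub>E d\<close> makes a closed \<open>1\<close>-form exact:
  up to division by the degree, its primitive is \<open>\<Sum>\<^sub>b p\<^sub>b b\<close>.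
\<close>

lemma symplectic_hamiltonian:
  assumes "\<theta> \<in> symp_derivations Q"
  shows "\<exists>x\<in>A. \<theta> = hamiltonian x"
proof -
  have der: "\<theta> \<in> derivations D" using assms by (simp add: symp_derivations_iff)
  interpret relative_derivation D \<theta> by unfold_locales (rule der)
  interpret E: relative_derivation D euler by unfold_locales (rule euler_derivation)
  define p where "p = tau_coeff \<theta>"
  \<comment> \<open>\<open>w\<close> is the contraction of the one-form with coefficients
    \<open>p b\<close> by the Euler derivation, which fixes every arrow.\<close>
  define w where "w = (\<Sum>b\<in>arcs D. p b \<odot> arrow D b)"
  have pA: "p b \<in> A" if "b \<in> arcs D" for b
    unfolding p_def using der that by (rule tau_coeff_closed)
  have ends: "idem (tail D b) \<odot> p b \<odot> idem (head D b) = p b" if "b \<in> arcs D" for b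
    unfolding p_def using der that by (rule tau_coeff_ends)
  have wA: "w \<in> A" unfolding w_def using pA by (intro path_alg_sum path_alg_mult) auto
  have euler_arrow: "euler (arrow D b) = arrow D b" if "b \<in> arcs D" for b
    using that euler_gen[of "tail D b" "[b]" "head D b"] arc_implies_awalk[OF that]
    by (simp add: arrow_def)
  \<comment> \<open>Coefficientwise, this is \<open>d i_E = L_E\<close> on the closed form: the Lie
    derivative contributes \<open>E(p b) db + p b db\<close>.\<close>
  have "form_coeff D b (pone D) w = euler (p b) + p b" if b: "b \<in> arcs D" for b
  proof (rule form_coeff_eqI[OF _ wA _ _ b])
    show "pone D \<in> A" by simp
    show "idem (tail D b) \<odot> (euler (p b) + p b) \<odot> idem (head D b) = euler (p b) + p b"
      if b: "b \<in> arcs D" for b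
    proof -
      have V: "idem (tail D b) \<in> V" "idem (head D b) \<in> V" using b head_in_verts tail_in_verts by auto
      have "euler (p b) = euler (idem (tail D b) \<odot> p b \<odot> idem (head D b))"
        using ends[OF b] by simp
      also have "\<dots> = idem (tail D b) \<odot> euler (p b) \<odot> idem (head D b)"
        using V V[THEN vertex_alg_subset] pA[OF b] by (simp del: gen_in_path_alg)
      finally show ?thesis using ends[OF b] by simp
    qed
    fix t assume t: "trace1 D t"
    interpret t: trace1 D t by (rule t)
    interpret tE: trace1_derivation D t euler ..
    \<comment> \<open>Closedness is used by testing \<open>L_\<theta>\<omega> = 0\<close> on the
      trace of degree two obtained by contracting \<open>t\<close> with the Euler
      derivation.\<close>
    have "0 = (\<Sum>a\<in>arcs Q. t (pone D \<odot> euler (\<theta> (star a))) (arr a) + t (pone D \<odot> \<theta> (star a)) (euler (arr a))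
          - t (pone D) (\<theta> (star a) \<odot> euler (arr a)) +
        (t (pone D \<odot> euler (star a)) (\<theta> (arr a)) + t (pone D \<odot> star a) (euler (\<theta> (arr a)))
          - t (pone D) (star a \<odot> euler (\<theta> (arr a)))))"
      by (rule symp_derivationsD[OF assms tE.contract_trace2, symmetric])
    also have "\<dots> = (\<Sum>a\<in>arcs Q. (t (euler (p (Arr a)) + p (Arr a)) (arr a) - t (pone D) (p (Arr a) \<odot> arr a)) +
        (t (euler (p (Star a)) + p (Star a)) (star a) - t (pone D) (p (Star a) \<odot> star a)))"
      by (rule sum.cong)
        (auto simp: p_def tau_coeff_def arr_star_closed euler_arrow t.linear t.mult_one)
    also have "\<dots> = (\<Sum>b\<in>arcs D. t (euler (p b) + p b) (arrow D b) - t (pone D) (p b \<odot> arrow D b))"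
      by (rule sum_arcs_double[symmetric])
    also have "\<dots> = (\<Sum>b\<in>arcs D. t (euler (p b) + p b) (arrow D b)) - t (pone D) w"
      unfolding w_def using pA
      by (subst functional.sum[OF t.functional_right])
        (simp_all add: sum_subtractf del: double_quiver_simps)
    finally show "t (pone D) w = (\<Sum>b\<in>arcs D. t (euler (p b) + p b) (arrow D b))"
      by simp
  qed
  \<comment> \<open>Dividing \<open>w\<close> by its degree divides its cyclic derivatives by their
    degree plus one, which undoes \<open>E + 1\<close>.\<close>
  then have "cyc_deriv D b (degree_div 0 w) = p b" if "b \<in> arcs D" for b
    unfolding cyc_deriv_degree_div cyc_deriv_eq_form_coeff[OF wA]
    using that by (simp only: degree_div_euler[OF pA])
  note coeff = this
  have closed: "degree_div 0 w \<in> A" using wA by simp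
  have "\<theta> = hamiltonian (degree_div 0 w)"
  proof (rule derivation_eqI_tau_coeff[OF der hamiltonian_derivation[OF closed]])
    fix b assume "b \<in> arcs D"
    then show "tau_coeff \<theta> b = tau_coeff (hamiltonian (degree_div 0 w)) b"
      by (simp only: tau_coeff_hamiltonian[OF closed] coeff) (simp only: p_def)
  qed
  then show ?thesis using closed by blast
qed

lemma class0_eq_iff:
  assumes "x \<in> A" "y \<in> A"
  shows "class0 Q x = class0 Q y \<longleftrightarrow> (\<forall>t. trace0 D t \<longrightarrow> t x = t y)"
proof -
  have "gen [x] \<in> preforms D 0" "gen [y] \<in> preforms D 0" using assms by auto
  then show ?thesis
    unfolding class0_def by (simp add: karoubi_class_eq_iff karoubi_null_0_iff)
qed

lemma karoubi_d_class0:
  assumes "x \<in> A"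
  shows "karoubi_d D 0 (class0 Q x) = karoubi_class D 1 (gen [pone D, x])"
proof -
  have *: "gen [x] \<in> preforms D 0" using assms by simp
  have "karoubi_d D 0 (class0 Q x) = karoubi_class D 1 (form_d D (gen [x]))"
    unfolding karoubi_d_def class0_def add_0
  proof (rule induced_karoubi_class[OF *])
    fix y assume "y \<in> preforms D 0" "y - gen [x] \<in> karoubi_null D 0"
    then have "form_d D (y - gen [x]) \<in> karoubi_null D 1"
      using * by (intro form_d_karoubi_null) auto
    then show "form_d D y - form_d D (gen [x]) \<in> karoubi_null D 1"
      by (simp add: form_d_def)
  qed
  then show ?thesis by simp
qed

lemma tau_hamiltonian:
  assumes "x \<in> A"
  shows "tau Q (hamiltonian x) = karoubi_d D 0 (class0 Q x)"
proof -
  have der: "hamiltonian x \<in> derivations D" by (rule hamiltonian_derivation) fact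
  have "gen [pone D, x] \<in> preforms D 1" using assms by simp
  moreover have "pair1 t (form_contract (hamiltonian x) (symp_form Q)) = pair1 t (gen [pone D, x])"
    if "trace1 D t" for t
    unfolding pair1_contract_symp_form[OF der that] sum_tau_coeff_hamiltonian[OF assms that] by simp
  ultimately show ?thesis
    unfolding karoubi_d_class0[OF assms] tau_eq_class[OF der]
    using karoubi_class_1_eq_iff[OF contract_symp_form_preforms[OF der]] by blast
qed

lemma inv_tau_d:
  assumes "x \<in> A"
  shows "inv_into (derivations D) (tau Q) (karoubi_d D 0 (class0 Q x)) = hamiltonian x"
  unfolding tau_hamiltonian[OF assms, symmetric]
  by (rule inv_into_f_f) (use tau_bij hamiltonian_derivation[OF assms] in \<open>auto simp: bij_betw_def\<close>)

text \<open>The differential \<open>dx\<close> depends on the class of \<open>x\<close> only,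
  because a degree-one trace evaluated at 1 is a degree-zero trace.\<close>

lemma hamiltonian_cong:
  assumes "x \<in> A" "y \<in> A" "\<And>t. trace0 D t \<Longrightarrow> t x = t y"
  shows "hamiltonian x = hamiltonian y"
  by (rule derivation_eqI)
    (simp_all add: assms hamiltonian_derivation sum_tau_coeff_hamiltonian trace1.trace0 del: double_quiver_simps)

section \<open>The Kontsevich bracket as Hamiltonian action\<close>

lemma kontsevich_closed:
  assumes "x \<in> A" "y \<in> A"
  shows "kontsevich Q x y \<in> A"
  unfolding kontsevich_def Let_def using assms by (intro path_alg_sum) simp

text \<open>With \<open>\<theta>\<close> the derivation of \<open>x\<close>, sending
  \<open>z dy\<close> to \<open>t (z \<theta>(y))\<close> defines a trace of degree one. Expanding
  \<open>dy\<close> in cyclic derivatives then writes \<open>t (\<theta> y)\<close> as the sum of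
  \<open>t\<close> over \<open>(\<partial>y/\<partial>b) \<theta>(b)\<close>, and inserting the
  values of \<open>\<theta>\<close> on arrows gives the bracket.\<close>

lemma trace0_kontsevich:
  assumes "x \<in> A" "y \<in> A" "trace0 D t"
  shows "t (hamiltonian x y) = t (kontsevich Q x y)"
proof -
  interpret trace0 D t by fact
  have der: "hamiltonian x \<in> derivations D" by (rule hamiltonian_derivation) fact
  interpret relative_derivation D "hamiltonian x" by unfold_locales (rule der)
  have "trace1 D (\<lambda>x' y. t (x' \<odot> hamiltonian x y))"
  proof unfold_locales
    fix x' y z assume "x' \<in> A" "y \<in> A" "z \<in> A"
    then show "t (x' \<odot> hamiltonian x (y \<odot> z)) = t (x' \<odot> y \<odot> hamiltonian x z) + t (z \<odot> x' \<odot> hamiltonian x y)"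
      using cyclic[of "x' \<odot> hamiltonian x y" z] by (simp add: add pmult_assoc)
  qed (simp_all add: add scale zero)
  from trace1.expand_one[OF this assms(2)] have
    "t (hamiltonian x y) = (\<Sum>b\<in>arcs D. t (cyc_deriv D b y \<odot> hamiltonian x (arrow D b)))"
    using assms by simp
  also have "\<dots> = (\<Sum>a\<in>arcs Q. t (cyc_deriv D (Arr a) x \<odot> cyc_deriv D (Star a) y -
      cyc_deriv D (Star a) x \<odot> cyc_deriv D (Arr a) y))"
    unfolding sum_arcs_double
    by (rule sum.cong) (auto simp: hamiltonian_arrows assms minus diff cyclic[of "cyc_deriv D _ y"])
  also have "\<dots> = t (kontsevich Q x y)"
    unfolding kontsevich_def Let_def using assms by (intro sum[symmetric]) simp
  finally show ?thesis .
qed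

lemma commutator_derivation:
  assumes "\<theta> \<in> derivations D" "\<eta> \<in> derivations D"
  shows "(\<lambda>x\<in>A. \<theta> (\<eta> x) - \<eta> (\<theta> x)) \<in> derivations D"
proof -
  interpret \<theta>: relative_derivation D \<theta> by unfold_locales fact
  interpret \<eta>: relative_derivation D \<eta> by unfold_locales fact
  show ?thesis
    by (rule derivationsI) (simp_all add: free.scale_right_diff_distrib vertex_alg_subset)
qed

text \<open>Behind it is the Cartan identity \<open>L_\<theta> i_\<eta> \<omega> =
  i_[\<theta>,\<eta>] \<omega> + i_\<eta> L_\<theta> \<omega>\<close>. Its left side is
  \<open>L_\<theta> dy = d(\<theta> y)\<close>, the differential of the bracket, and
  \<open>L_\<theta> \<omega> = 0\<close>.\<close>

lemma hamiltonian_kontsevich: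
  assumes x: "x \<in> A" and y: "y \<in> A"
  shows "hamiltonian (kontsevich Q x y) =
    (\<lambda>z\<in>A. hamiltonian x (hamiltonian y z) - hamiltonian y (hamiltonian x z))"
    (is "_ = ?\<zeta>")
proof (rule derivation_eqI)
  let ?\<theta> = "hamiltonian x" and ?\<eta> = "hamiltonian y"
  note der = hamiltonian_derivation[OF x] hamiltonian_derivation[OF y]
  interpret \<theta>: relative_derivation D ?\<theta> by unfold_locales (rule der)
  interpret \<eta>: relative_derivation D ?\<eta> by unfold_locales (rule der)
  show \<zeta>: "?\<zeta> \<in> derivations D" by (rule commutator_derivation[OF der])
  show K: "hamiltonian (kontsevich Q x y) \<in> derivations D"
    by (rule hamiltonian_derivation[OF kontsevich_closed[OF x y]])
  fix t assume t: "trace1 D t"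
  interpret t: trace1 D t by (rule t)
  interpret t\<theta>: trace1_derivation D t ?\<theta> ..
  interpret t\<eta>: trace1_derivation D t ?\<eta> ..
  have "(\<Sum>b\<in>arcs D. t (tau_coeff (hamiltonian (kontsevich Q x y)) b) (arrow D b)) =
      t (pone D) (kontsevich Q x y)"
    by (rule sum_tau_coeff_hamiltonian[OF kontsevich_closed[OF x y] t])
  also have "\<dots> = t (pone D) (?\<theta> y)"
    by (rule trace0_kontsevich[OF x y t.trace0, symmetric])
  also have "\<dots> = t (?\<theta> (pone D)) y + t (pone D) (?\<theta> y)"
    using y by (simp add: t.zero_left)
  also have "\<dots> = (\<Sum>b\<in>arcs D. t (?\<theta> (tau_coeff ?\<eta> b)) (arrow D b) + t (tau_coeff ?\<eta> b) (?\<theta> (arrow D b)))"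
    by (rule sum_tau_coeff_hamiltonian[OF y t\<theta>.lie_trace1, symmetric])
  \<comment> \<open>The commutator is split off; the remainder is \<open>L_\<theta> \<omega>\<close>
    tested on the trace contracted with \<open>\<eta>\<close>.\<close>
  also have "\<dots> = (\<Sum>b\<in>arcs D. t (tau_coeff ?\<zeta> b) (arrow D b)) +
     (\<Sum>a\<in>arcs Q. t (pone D \<odot> ?\<eta> (?\<theta> (star a))) (arr a) + t (pone D \<odot> ?\<theta> (star a)) (?\<eta> (arr a))
          - t (pone D) (?\<theta> (star a) \<odot> ?\<eta> (arr a)) +
        (t (pone D \<odot> ?\<eta> (star a)) (?\<theta> (arr a)) + t (pone D \<odot> star a) (?\<eta> (?\<theta> (arr a)))
          - t (pone D) (star a \<odot> ?\<eta> (?\<theta> (arr a)))))"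
    unfolding sum_arcs_double sum.distrib[symmetric]
    by (rule sum.cong) (auto simp: tau_coeff_def arr_star_closed t.linear t.mult_one)
  also have "(\<Sum>a\<in>arcs Q. t (pone D \<odot> ?\<eta> (?\<theta> (star a))) (arr a) + t (pone D \<odot> ?\<theta> (star a)) (?\<eta> (arr a))
          - t (pone D) (?\<theta> (star a) \<odot> ?\<eta> (arr a)) +
        (t (pone D \<odot> ?\<eta> (star a)) (?\<theta> (arr a)) + t (pone D \<odot> star a) (?\<eta> (?\<theta> (arr a)))
          - t (pone D) (star a \<odot> ?\<eta> (?\<theta> (arr a))))) = 0"
    by (rule symp_derivationsD[OF hamiltonian_symplectic[OF x] t\<eta>.contract_trace2])
  finally show "(\<Sum>b\<in>arcs D. t (tau_coeff (hamiltonian (kontsevich Q x y)) b) (arrow D b)) =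
    (\<Sum>b\<in>arcs D. t (tau_coeff ?\<zeta> b) (arrow D b))" by (simp only: add_0_right)
qed

text \<open>For a trace \<open>t\<close>, also \<open>x dy \<mapsto> t (x E y)\<close> is a trace, so that \<open>dx = 0\<close> forces \<open>t (E x) = 0\<close>.\<close>

lemma trace0_euler_eq_0:
  assumes "x \<in> A" "\<And>b. b \<in> arcs D \<Longrightarrow> cyc_deriv D b x = 0" "trace0 D t"
  shows "t (euler x) = 0"
proof -
  interpret trace0 D t by fact
  interpret relative_derivation D euler by unfold_locales (rule euler_derivation)
  have "trace1 D (\<lambda>x y. t (x \<odot> euler y))"
  proof unfold_locales
    fix x y z assume "x \<in> A" "y \<in> A" "z \<in> A"
    then show "t (x \<odot> euler (y \<odot> z)) = t (x \<odot> y \<odot> euler z) + t (z \<odot> x \<odot> euler y)"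
      using cyclic[of "x \<odot> euler y" z] by (simp add: add pmult_assoc)
  qed (simp_all add: add scale zero)
  from trace1.expand_one[OF this assms(1)] assms show ?thesis
    by (simp add: zero del: double_quiver_simps)
qed

end

section \<open>Necklaces\<close>

lemma cyclic_rel_iff:
  "((u, p, v), c) \<in> cyclic_rel G \<longleftrightarrow> u = v \<and> (u, p, u) \<in> qpaths G \<and>
    (\<exists>u' n. c = (u', rotate n p, u') \<and> c \<in> qpaths G \<and> (p = [] \<longrightarrow> u' = u))"
  by (cases c) (auto simp: cyclic_rel_def)

lemma equiv_cyclic_rel: "equiv {(u, p, u) | u p. (u, p, u) \<in> qpaths G} (cyclic_rel G)"
proof (rule equivI)
  show "cyclic_rel G \<subseteq> {(u, p, u) | u p. (u, p, u) \<in> qpaths G} \<times> {(u, p, u) | u p. (u, p, u) \<in> qpaths G}"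
    by (auto simp: cyclic_rel_def)
  show "refl_on {(u, p, u) | u p. (u, p, u) \<in> qpaths G} (cyclic_rel G)"
    by (auto simp: refl_on_def cyclic_rel_iff intro!: exI[of _ "0 :: nat"])
  show "sym (cyclic_rel G)"
  proof (rule symI)
    fix c c' assume "(c, c') \<in> cyclic_rel G"
    then obtain u p u' n where *: "c = (u, p, u)" "c' = (u', rotate n p, u')" "(u, p, u) \<in> qpaths G"
      "(u', rotate n p, u') \<in> qpaths G" "p = [] \<longrightarrow> u' = u"
      by (cases c) (auto simp: cyclic_rel_iff)
    \<comment> \<open>Together with the given rotation by \<open>n\<close> this makes
      \<open>n\<close> full turns.\<close>
    have "rotate (length p * n - n) (rotate n p) = p"
    proof (cases "p = []")
      case False
      then have "n \<le> length p * n" by (cases p) auto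
      then show ?thesis by (simp add: rotate_rotate rotate_id)
    qed simp
    then show "(c', c) \<in> cyclic_rel G"
      using * by (auto simp: cyclic_rel_iff intro!: exI[of _ "length p * n - n"])
  qed
  show "trans (cyclic_rel G)"
    by (rule transI) (force simp: cyclic_rel_def rotate_rotate)
qed

text \<open>The quotient map from \<open>A\<close> to \<open>A/[A,A]\<close> in the necklace basis;
  paths that are not closed are commutators and go to 0.\<close>

definition necklace_proj :: "('v, 'b) pre_digraph \<Rightarrow> ('v, 'b) path_vec \<Rightarrow> ('v, 'b) necklace_vec"
  where "necklace_proj G = lin_ext (\<lambda>(u, p, v). if u = v then gen (necklace_of G (u, p, v)) else 0)"

definition necklace_lift :: "('v, 'b) necklace_vec \<Rightarrow> ('v, 'b) path_vec"
  where "necklace_lift = lin_ext (\<lambda>w. gen (necklace_rep w))"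

definition necklace_space :: "('v, 'b) pre_digraph \<Rightarrow> ('v, 'b) necklace_vec set"
  where "necklace_space G = {f. Poly_Mapping.keys f \<subseteq> necklaces G}"

lemma necklace_proj_linear [simp]:
  "necklace_proj G (x + y) = necklace_proj G x + necklace_proj G y"
  "necklace_proj G (x - y) = necklace_proj G x - necklace_proj G y"
  "necklace_proj G (c \<cdot>\<^sub>c x) = c \<cdot>\<^sub>c necklace_proj G x"
  "necklace_proj G 0 = 0"
  by (simp_all add: necklace_proj_def)

lemma necklace_proj_sum: "necklace_proj G (\<Sum>i\<in>I. f i) = (\<Sum>i\<in>I. necklace_proj G (f i))"
  by (simp add: necklace_proj_def lin_ext_sum)

lemma necklace_proj_gen:
  "necklace_proj G (gen (u, p, v)) = (if u = v then gen (necklace_of G (u, p, v)) else 0)"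
  by (simp add: necklace_proj_def)

lemma necklace_lift_linear [simp]:
  "necklace_lift (x + y) = necklace_lift x + necklace_lift y"
  "necklace_lift (c \<cdot>\<^sub>c x) = c \<cdot>\<^sub>c necklace_lift x"
  "necklace_lift 0 = 0"
  "necklace_lift (gen w) = gen (necklace_rep w)"
  by (simp_all add: necklace_lift_def)

lemma necklace_space_gen [simp]: "gen w \<in> necklace_space G \<longleftrightarrow> w \<in> necklaces G"
  by (simp add: necklace_space_def)

lemma necklace_space_zero [simp]: "0 \<in> necklace_space G"
  by (simp add: necklace_space_def)

lemma necklace_space_add [simp]:
  "f \<in> necklace_space G \<Longrightarrow> g \<in> necklace_space G \<Longrightarrow> f + g \<in> necklace_space G"
  using Poly_Mapping.keys_add[of f g] by (auto simp: necklace_space_def)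

lemma necklace_space_scale [simp]: "f \<in> necklace_space G \<Longrightarrow> c \<cdot>\<^sub>c f \<in> necklace_space G"
  using keys_cscale[of c f] by (auto simp: necklace_space_def)

lemma necklace_space_minus [simp]: "f \<in> necklace_space G \<Longrightarrow> - f \<in> necklace_space G"
  by (simp add: necklace_space_def)

lemma necklace_space_induct [consumes 1, case_names zero add scale gen]:
  assumes "f \<in> necklace_space G" "P 0"
    and "\<And>f g. f \<in> necklace_space G \<Longrightarrow> g \<in> necklace_space G \<Longrightarrow> P f \<Longrightarrow> P g \<Longrightarrow> P (f + g)"
    and "\<And>c f. f \<in> necklace_space G \<Longrightarrow> P f \<Longrightarrow> P (c \<cdot>\<^sub>c f)"
    and "\<And>w. w \<in> necklaces G \<Longrightarrow> P (gen w)"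
  shows "P f"
  using assms by (intro vec_induct_on[of f "necklaces G" P]) (auto simp: necklace_space_def)

lemma necklace_of_in_necklaces: "(u, p, u) \<in> qpaths G \<Longrightarrow> necklace_of G (u, p, u) \<in> necklaces G"
  unfolding necklaces_def necklace_of_def by (rule quotientI) auto

lemma necklace_rep_cases:
  assumes "w \<in> necklaces G"
  obtains u p where "necklace_rep w = (u, p, u)" "(u, p, u) \<in> qpaths G" "necklace_of G (u, p, u) = w"
proof -
  have "w \<noteq> {}"
    using assms unfolding necklaces_def by (rule in_quotient_imp_non_empty[OF equiv_cyclic_rel])
  then have rep: "necklace_rep w \<in> w"
    unfolding necklace_rep_def by (simp add: some_in_eq)
  moreover have "w \<subseteq> {(u, p, u) | u p. (u, p, u) \<in> qpaths G}"
    using assms unfolding necklaces_def by (rule in_quotient_imp_subset[OF equiv_cyclic_rel])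
  ultimately obtain u p where *: "necklace_rep w = (u, p, u)" "(u, p, u) \<in> qpaths G" by auto
  moreover have "necklace_of G (u, p, u) = w"
    using assms rep * unfolding necklaces_def necklace_of_def
    by (auto elim!: quotientE dest: equiv_class_eq[OF equiv_cyclic_rel])
  ultimately show ?thesis by (rule that)
qed

lemma necklace_rep_necklace_of:
  assumes "(u, p, u) \<in> qpaths G"
  shows "((u, p, u), necklace_rep (necklace_of G (u, p, u))) \<in> cyclic_rel G"
proof -
  obtain u' p' where "necklace_rep (necklace_of G (u, p, u)) = (u', p', u')" "(u', p', u') \<in> qpaths G"
    "necklace_of G (u', p', u') = necklace_of G (u, p, u)"
    using necklace_of_in_necklaces[OF assms] by (rule necklace_rep_cases)
  moreover from this(2) have "(u', p', u') \<in> necklace_of G (u', p', u')"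
    unfolding necklace_of_def by (intro equiv_class_self[OF equiv_cyclic_rel]) auto
  ultimately show ?thesis by (auto simp: necklace_of_def)
qed

section \<open>Necklaces as a basis of the degree-zero Karoubi space\<close>

context wf_digraph
begin

lemma necklace_lift_closed [simp]: "f \<in> necklace_space G \<Longrightarrow> necklace_lift f \<in> A"
  by (induction f rule: necklace_space_induct) (auto elim: necklace_rep_cases)

lemma necklace_proj_closed [simp]: "x \<in> A \<Longrightarrow> necklace_proj G x \<in> necklace_space G"
  by (induction x rule: path_alg_induct)
    (auto simp: necklace_proj_gen intro: necklace_of_in_necklaces)

lemma necklace_proj_lift [simp]: "f \<in> necklace_space G \<Longrightarrow> necklace_proj G (necklace_lift f) = f"
  by (induction f rule: necklace_space_induct)
    (auto simp: necklace_proj_gen elim: necklace_rep_cases)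

lemma awalk_source_unique: "awalk u p v \<Longrightarrow> awalk u' p v' \<Longrightarrow> p \<noteq> [] \<Longrightarrow> u = u'"
  by (cases p) (auto simp: awalk_Cons_iff)

end

text \<open>A rotation cuts the closed path into two factors and exchanges them.\<close>

lemma (in trace0) cyclic_rel_eq:
  assumes "(c, c') \<in> cyclic_rel G"
  shows "t (gen c) = t (gen c')"
proof -
  obtain u p u' n where *: "c = (u, p, u)" "c' = (u', rotate n p, u')" "awalk u p u"
    "awalk u' (rotate n p) u'" "p = [] \<longrightarrow> u' = u"
    using assms by (cases c) (auto simp: cyclic_rel_iff)
  show ?thesis
  proof (cases "p = []")
    case False
    define m where "m = n mod length p"
    have rot: "rotate n p = drop m p @ take m p"
      by (simp add: m_def rotate_drop_take)
    have "m < length p" using False by (simp add: m_def)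
    then have "drop m p \<noteq> []" by simp
    have "awalk u (take m p @ drop m p) u" using *(3) by simp
    then obtain x where x: "awalk u (take m p) x" "awalk x (drop m p) u"
      unfolding awalk_append_iff by blast
    have "awalk u' (drop m p @ take m p) u'" using *(4) rot by simp
    \<comment> \<open>The first arrow of the nonempty rotated path fixes its source, so the new base
      point is the cutting point.\<close>
    then have "u' = x"
      using x(2) \<open>drop m p \<noteq> []\<close> awalk_source_unique unfolding awalk_append_iff by blast
    then show ?thesis
      using cyclic[of "gen (x, drop m p, u)" "gen (u, take m p, x)"] x
      by (simp add: * rot pmult_gen)
  qed (use * in simp)
qed

text \<open>Multiplying by the idempotent at the target fixes the path on one side and kills it on
  the other.\<close>

lemma (in trace0) not_closed:
  assumes "awalk u p v" "u \<noteq> v"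
  shows "t (gen (u, p, v)) = 0"
proof -
  have "v \<in> verts G" using assms by auto
  then have "t (idem v \<odot> gen (u, p, v)) = t (gen (u, p, v) \<odot> idem v)"
    using assms by (intro cyclic) (simp_all add: awalk_Nil_iff)
  then show ?thesis using assms by (simp add: pmult_gen zero)
qed

lemma (in trace0) lift_proj:
  assumes "x \<in> A"
  shows "t (necklace_lift (necklace_proj G x)) = t x"
  using assms
proof (induction x rule: path_alg_induct)
  case (gen u p v)
  then show ?case
    using cyclic_rel_eq[OF necklace_rep_necklace_of[of u p G]]
    by (auto simp: necklace_proj_gen not_closed zero)
qed (auto simp: add scale zero)

context fin_digraph
begin

text \<open>Exchanging two factors of a closed path rotates it, so each necklace coordinate is a
  trace. This makes distinct necklaces independent in the quotient.\<close>

lemma trace0_necklace_proj: "trace0 G (\<lambda>x. Poly_Mapping.lookup (necklace_proj G x) w)"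
proof unfold_locales
  have *: "necklace_proj G (gen (u, p, v) \<odot> gen (u', q, v')) = necklace_proj G (gen (u', q, v') \<odot> gen (u, p, v))"
    if "awalk u p v" "awalk u' q v'" for u p v u' q v'
  proof (cases "v' = u \<and> v = u'")
    case True
    then have "((u', q @ p, u'), (u, p @ q, u)) \<in> cyclic_rel G"
      using that by (auto simp: cyclic_rel_iff awalk_appendI intro!: exI[of _ "length q"] simp: rotate_append)
    then have "necklace_of G (u', q @ p, u') = necklace_of G (u, p @ q, u)"
      unfolding necklace_of_def by (rule equiv_class_eq[OF equiv_cyclic_rel])
    then show ?thesis using True by (simp add: pmult_gen necklace_proj_gen)
  qed (auto simp: pmult_gen necklace_proj_gen)
  fix x y assume "x \<in> A" "y \<in> A"
  then have "necklace_proj G (x \<odot> y) = necklace_proj G (y \<odot> x)"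
  proof (induction x rule: path_alg_induct)
    case (gen u p v)
    from gen(2,1) show ?case
      by (induction y rule: path_alg_induct) (simp_all add: *)
  qed simp_all
  then show "Poly_Mapping.lookup (necklace_proj G (x \<odot> y)) w = Poly_Mapping.lookup (necklace_proj G (y \<odot> x)) w"
    by simp
qed (simp_all add: lookup_add)

lemma necklace_proj_eqI:
  assumes "\<And>t. trace0 G t \<Longrightarrow> t x = t y"
  shows "necklace_proj G x = necklace_proj G y"
  by (rule poly_mapping_eqI) (rule assms[OF trace0_necklace_proj])

end

text \<open>All axioms are inherited by a surjective image. Preservation of zero is a separate
  premise: \<open>lie_hom\<close> does not include it, and it cannot be deduced before
  \<open>M\<close> is known to have additive inverses.\<close>

lemma lie_algebra_surj_hom:
  assumes L: "lie_algebra L" and f: "lie_hom L M f" "f ` lcarrier L = lcarrier M"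
    and zero: "f (lzero L) = lzero M"
  shows "lie_algebra M"
proof -
  interpret lie_algebra L by fact
  have add: "f (ladd L x y) = ladd M (f x) (f y)"
    and br: "f (lbracket L x y) = lbracket M (f x) (f y)"
    and sc: "f (lscale L c x) = lscale M c (f x)"
    if "x \<in> lcarrier L" "y \<in> lcarrier L" for x y c
    using f(1) that by (auto simp: lie_hom_def)
  note cl = zero_closed add_closed scale_closed bracket_closed
  note hom = add[symmetric] br[symmetric] sc[symmetric] zero[symmetric] cl
  show ?thesis
  proof (unfold_locales; (unfold f(2)[symmetric])?; (elim imageE)?; hypsubst?)
    show "lzero M \<in> f ` lcarrier L"
      unfolding zero[symmetric] by (rule imageI[OF zero_closed])
    fix x assume x: "x \<in> lcarrier L"
    then obtain y where "y \<in> lcarrier L" "ladd L x y = lzero L" using add_inverse by blast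
    then show "\<exists>y\<in>f ` lcarrier L. ladd M (f x) y = lzero M"
      using x add zero by (intro bexI[of _ "f y"]) (auto simp flip: add)
  qed (simp_all add: hom add_assoc add_zero scale_one scale_scale scale_add_right scale_add_left
      bracket_add_left bracket_add_right bracket_scale_left bracket_scale_right bracket_alternating jacobi
      | simp add: hom add_comm)+
qed

section \<open>The exact sequence\<close>

context quiver
begin

lemma kontsevich_linear:
  "kontsevich Q (x + x') y = kontsevich Q x y + kontsevich Q x' y"
  "kontsevich Q x (y + y') = kontsevich Q x y + kontsevich Q x y'"
  "kontsevich Q (c \<cdot>\<^sub>c x) y = c \<cdot>\<^sub>c kontsevich Q x y"
  "kontsevich Q x (c \<cdot>\<^sub>c y) = c \<cdot>\<^sub>c kontsevich Q x y"
  "kontsevich Q 0 y = 0" "kontsevich Q x 0 = 0"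
  by (simp_all add: kontsevich_def Let_def sum.distrib[symmetric] free.scale_sum_right
      free.scale_right_diff_distrib algebra_simps)

text \<open>Opening both necklaces and regluing is the product of two cyclic derivatives. Since
  \<open>b\<close> and \<open>b'\<close> are mutually reverse, all ends match and every product is a
  closed path.\<close>

lemma reglue_eq:
  assumes w: "w \<in> necklaces D" and w': "w' \<in> necklaces D"
    and b: "head D b = tail D b'" "tail D b = head D b'"
  shows "reglue D b b' w w' =
    necklace_proj D (cyc_deriv D b (gen (necklace_rep w)) \<odot> cyc_deriv D b' (gen (necklace_rep w')))"
proof -
  obtain u p where w: "necklace_rep w = (u, p, u)" using w by (rule necklace_rep_cases)
  obtain u' p' where w': "necklace_rep w' = (u', p', u')" using w' by (rule necklace_rep_cases)
  show ?thesis
    by (simp add: reglue_def w w' cyc_deriv_def pmult_sum_left pmult_sum_right necklace_proj_sum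
        pmult_gen b necklace_proj_gen) (rule sum.swap)
qed

lemma necklace_bracket_linear:
  "necklace_bracket Q (f + f') g = necklace_bracket Q f g + necklace_bracket Q f' g"
  "necklace_bracket Q f (g + g') = necklace_bracket Q f g + necklace_bracket Q f g'"
  "necklace_bracket Q (c \<cdot>\<^sub>c f) g = c \<cdot>\<^sub>c necklace_bracket Q f g"
  "necklace_bracket Q f (c \<cdot>\<^sub>c g) = c \<cdot>\<^sub>c necklace_bracket Q f g"
  "necklace_bracket Q 0 g = 0" "necklace_bracket Q f 0 = 0"
  by (simp_all add: necklace_bracket_def bilin_ext_linear)

lemma necklace_bracket_eq:
  assumes "f \<in> necklace_space D" "g \<in> necklace_space D"
  shows "necklace_bracket Q f g = necklace_proj D (kontsevich Q (necklace_lift f) (necklace_lift g))"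
proof -
  note [simp] = necklace_bracket_linear kontsevich_linear
  show ?thesis
    using assms(1)
  proof (induction f rule: necklace_space_induct)
    case (gen w)
    from assms(2) show ?case
    proof (induction g rule: necklace_space_induct)
      case (gen w')
      show ?case
        unfolding necklace_bracket_def bilin_ext_gen necklace_lift_linear kontsevich_def Let_def necklace_proj_sum
        by (rule sum.cong) (simp_all add: reglue_eq \<open>w \<in> necklaces D\<close> \<open>w' \<in> necklaces D\<close>)
    qed simp_all
  qed simp_all
qed

text \<open>Cyclicity exchanges the two factors of each product, after which the sums cancel term by
  term.\<close>

lemma trace0_kontsevich_antisym:
  assumes "x \<in> A" "y \<in> A" "trace0 D t"
  shows "t (kontsevich Q x y) = - t (kontsevich Q y x)"
proof -
  interpret trace0 D t by fact
  have "t (kontsevich Q x y + kontsevich Q y x) = (\<Sum>a\<in>arcs Q.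
      t (cyc_deriv D (Arr a) x \<odot> cyc_deriv D (Star a) y - cyc_deriv D (Star a) x \<odot> cyc_deriv D (Arr a) y +
        (cyc_deriv D (Arr a) y \<odot> cyc_deriv D (Star a) x - cyc_deriv D (Star a) y \<odot> cyc_deriv D (Arr a) x)))"
    unfolding kontsevich_def Let_def sum.distrib[symmetric] using assms by (intro sum) simp
  also have "\<dots> = 0"
    using assms cyclic[of "cyc_deriv D (Arr _) x" "cyc_deriv D (Star _) y"]
      cyclic[of "cyc_deriv D (Arr _) y" "cyc_deriv D (Star _) x"]
    by (intro sum.neutral) (simp add: add diff)
  finally show ?thesis
    using assms by (simp add: add kontsevich_closed eq_neg_iff_add_eq_0)
qed

text \<open>Bracketing with \<open>z\<close> acts as a derivation, and a trace composed with a
  derivation is a trace; this settles the second argument, and antisymmetry the first.\<close>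

lemma trace0_kontsevich_cong:
  assumes "x \<in> A" "y \<in> A" "x' \<in> A" "y' \<in> A" "trace0 D t"
    and "\<And>t. trace0 D t \<Longrightarrow> t x = t x'" "\<And>t. trace0 D t \<Longrightarrow> t y = t y'"
  shows "t (kontsevich Q x y) = t (kontsevich Q x' y')"
proof -
  have right: "t (kontsevich Q z y) = t (kontsevich Q z y')"
    if "z \<in> A" "y \<in> A" "y' \<in> A" "\<And>t. trace0 D t \<Longrightarrow> t y = t y'" for z y y'
  proof -
    interpret trace0 D t by fact
    interpret relative_derivation D "hamiltonian z"
      by unfold_locales (rule hamiltonian_derivation[OF that(1)])
    have "trace0 D (\<lambda>y. t (hamiltonian z y))"
      by unfold_locales (simp_all add: add scale cyclic[of _ "hamiltonian z _"])
    from that(4)[OF this] show ?thesis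
      using that by (simp add: trace0_kontsevich[symmetric] assms(5))
  qed
  have "t (kontsevich Q x y) = - t (kontsevich Q y x)"
    by (rule trace0_kontsevich_antisym) fact+
  also have "\<dots> = - t (kontsevich Q y x')"
    using right[of y x x'] assms by simp
  also have "\<dots> = t (kontsevich Q x' y)"
    using trace0_kontsevich_antisym[of x' y t] assms by simp
  also have "\<dots> = t (kontsevich Q x' y')"
    using right[of x' y y'] assms by simp
  finally show ?thesis .
qed

text \<open>With \<open>\<theta>\<close> and \<open>\<eta>\<close> the derivations of
  \<open>x\<close> and \<open>y\<close>, the three terms are the traces of
  \<open>\<theta> \<eta> z\<close>, \<open>- \<eta> \<theta> z\<close> and
  \<open>- [\<theta>, \<eta>] z\<close>.\<close>

lemma trace0_jacobi:
  assumes "x \<in> A" "y \<in> A" "z \<in> A" "trace0 D t"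
  shows "t (kontsevich Q x (kontsevich Q y z)) + (t (kontsevich Q y (kontsevich Q z x)) +
    t (kontsevich Q z (kontsevich Q x y))) = 0"
proof -
  interpret trace0 D t by fact
  interpret x: relative_derivation D "hamiltonian x"
    by unfold_locales (rule hamiltonian_derivation[OF assms(1)])
  interpret y: relative_derivation D "hamiltonian y"
    by unfold_locales (rule hamiltonian_derivation[OF assms(2)])
  note K = kontsevich_closed
  have 1: "t (kontsevich Q x (kontsevich Q y z)) = t (kontsevich Q x (hamiltonian y z))"
    by (rule trace0_kontsevich_cong) (simp_all add: assms K trace0_kontsevich)
  have 2: "t (kontsevich Q y (kontsevich Q z x)) = t (kontsevich Q y (- hamiltonian x z))"
  proof (rule trace0_kontsevich_cong)
    fix s assume s: "trace0 D s"
    interpret s: trace0 D s by fact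
    show "s (kontsevich Q z x) = s (- hamiltonian x z)"
      using assms s by (simp add: s.minus trace0_kontsevich trace0_kontsevich_antisym[of z x])
  qed (simp_all add: assms K)
  have 3: "t (kontsevich Q z (kontsevich Q x y)) = - t (hamiltonian (kontsevich Q x y) z)"
    using trace0_kontsevich_antisym[of z "kontsevich Q x y" t] assms K by (simp add: trace0_kontsevich)
  show ?thesis
    unfolding 1 2 3 hamiltonian_kontsevich[OF assms(1,2)]
    using assms by (simp add: trace0_kontsevich[symmetric] minus diff)
qed

section \<open>The necklace Lie algebra\<close>

lemma necklace_lie_simps:
  "lcarrier (necklace_lie Q) = necklace_space D" "ladd (necklace_lie Q) = (+)"
  "lzero (necklace_lie Q) = 0" "lscale (necklace_lie Q) = cscale"
  "lbracket (necklace_lie Q) = necklace_bracket Q"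
  by (simp_all add: necklace_lie_def necklace_space_def)

lemma necklace_bracket_closed:
  "f \<in> necklace_space D \<Longrightarrow> g \<in> necklace_space D \<Longrightarrow> necklace_bracket Q f g \<in> necklace_space D"
  by (simp add: necklace_bracket_eq kontsevich_closed)

lemma necklace_lie_algebra: "lie_algebra (necklace_lie Q)"
proof (unfold_locales; unfold necklace_lie_simps)
  fix x y z :: "('v, 'e dbl) necklace_vec"
  assume x: "x \<in> necklace_space D"
  note lift [simp] = necklace_lift_closed
  show "\<exists>y\<in>necklace_space D. x + y = 0"
    using x by (intro bexI[of _ "- x"]) auto
  show "necklace_bracket Q x x = 0"
  proof -
    let ?K = "kontsevich Q (necklace_lift x) (necklace_lift x)"
    have "necklace_proj D ?K = necklace_proj D 0"
    proof (rule necklace_proj_eqI)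
      fix t assume t: "trace0 D t"
      interpret trace0 D t by fact
      show "t ?K = t 0"
        using trace0_kontsevich_antisym[of "necklace_lift x" "necklace_lift x" t] x t by (simp add: zero)
    qed
    then show ?thesis using x by (simp add: necklace_bracket_eq)
  qed
  assume y: "y \<in> necklace_space D" and z: "z \<in> necklace_space D"
  let ?x = "necklace_lift x" and ?y = "necklace_lift y" and ?z = "necklace_lift z"
  \<comment> \<open>The inner bracket is projected to necklaces and lifted again, which no trace
    detects, so it may be replaced by the bracket of representatives.\<close>
  have double: "necklace_bracket Q f (necklace_bracket Q g h) =
      necklace_proj D (kontsevich Q (necklace_lift f) (kontsevich Q (necklace_lift g) (necklace_lift h)))"
    if "f \<in> necklace_space D" "g \<in> necklace_space D" "h \<in> necklace_space D" for f g h
    unfolding necklace_bracket_eq[OF that(1) necklace_bracket_closed[OF that(2,3)]]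
    unfolding necklace_bracket_eq[OF that(2,3)]
    by (rule necklace_proj_eqI, rule trace0_kontsevich_cong)
      (simp_all add: that kontsevich_closed trace0.lift_proj)
  have "necklace_proj D (kontsevich Q ?x (kontsevich Q ?y ?z) +
      (kontsevich Q ?y (kontsevich Q ?z ?x) + kontsevich Q ?z (kontsevich Q ?x ?y))) = necklace_proj D 0"
  proof (rule necklace_proj_eqI)
    fix t assume t: "trace0 D t"
    interpret trace0 D t by fact
    show "t (kontsevich Q ?x (kontsevich Q ?y ?z) +
      (kontsevich Q ?y (kontsevich Q ?z ?x) + kontsevich Q ?z (kontsevich Q ?x ?y))) = t 0"
      using trace0_jacobi[of ?x ?y ?z t] x y z t by (simp add: add zero kontsevich_closed)
  qed
  then show "necklace_bracket Q x (necklace_bracket Q y z) +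
      (necklace_bracket Q y (necklace_bracket Q z x) + necklace_bracket Q z (necklace_bracket Q x y)) = 0"
    using x y z by (simp add: double)
qed (simp_all add: necklace_bracket_closed necklace_bracket_linear
    free.scale_right_distrib free.scale_left_distrib)

section \<open>The isomorphism with the degree-zero Karoubi space\<close>

lemma necklace_class_eq: "necklace_class Q f = class0 Q (necklace_lift f)"
  by (simp add: necklace_class_def necklace_lift_def)

lemma mem_class0_iff:
  assumes "x \<in> A"
  shows "x' \<in> class0 Q x \<longleftrightarrow> x' \<in> preforms D 0 \<and> (\<forall>t. trace0 D t \<longrightarrow> pair0 t x' = t x)"
proof (cases "x' \<in> preforms D 0")
  case True
  have "gen [x] \<in> preforms D 0" using assms by simp
  from karoubi_null_0_iff[OF preforms_diff[OF True this]] show ?thesis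
    using True by (simp add: class0_def karoubi_class_def)
qed (simp add: class0_def karoubi_class_def)

lemma class0_eqI:
  assumes "x \<in> A" "x' \<in> preforms D 0" "\<And>t. trace0 D t \<Longrightarrow> pair0 t x' = t x"
  shows "karoubi_class D 0 x' = class0 Q x"
proof -
  have "gen [x] \<in> preforms D 0" using assms by simp
  from karoubi_null_0_iff[OF preforms_diff[OF assms(2) this]] show ?thesis
    unfolding class0_def karoubi_class_eq_iff[OF assms(2)] using assms(3) by simp
qed

text \<open>The defining union ranges over all representatives; independence of the choice collapses
  it to one class.\<close>

lemma kontsevich_bracket_class0:
  assumes "x \<in> A" "y \<in> A"
  shows "kontsevich_bracket Q (class0 Q x) (class0 Q y) = class0 Q (kontsevich Q x y)"
proof -
  have "class0 Q (kontsevich Q x' y') = class0 Q (kontsevich Q x y)"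
    if "x' \<in> A" "y' \<in> A" "class0 Q x' = class0 Q x" "class0 Q y' = class0 Q y" for x' y'
    using that assms unfolding class0_eq_iff[OF kontsevich_closed[OF that(1,2)] kontsevich_closed[OF assms]]
    by (auto simp: class0_eq_iff intro!: trace0_kontsevich_cong)
  then show ?thesis
    unfolding kontsevich_bracket_def using assms by blast
qed

lemma kontsevich_lie_simps:
  "lcarrier (kontsevich_lie Q) = karoubi D 0"
  "ladd (kontsevich_lie Q) = (\<lambda>X Y. \<Union>x\<in>X. \<Union>y\<in>Y. karoubi_class D 0 (x + y))"
  "lzero (kontsevich_lie Q) = karoubi_class D 0 0"
  "lscale (kontsevich_lie Q) = (\<lambda>c. induced D 0 (cscale c))"
  "lbracket (kontsevich_lie Q) = kontsevich_bracket Q"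
  by (simp_all add: kontsevich_lie_def Let_def)

lemma karoubi_0_eq: "karoubi D 0 = class0 Q ` A"
proof (intro equalityI subsetI)
  fix X assume "X \<in> karoubi D 0"
  then obtain x where x: "x \<in> preforms D 0" "X = karoubi_class D 0 x"
    by (auto simp: karoubi_def)
  \<comment> \<open>The formal combination of one-element tuples, evaluated in the path
    algebra.\<close>
  let ?y = "lin_ext (\<lambda>as. as ! 0) x"
  have closed: "lin_ext (\<lambda>as. as ! 0) x \<in> A" if "x \<in> preforms D 0" for x
    using that by (induction x rule: preforms_induct) (auto simp: list_length_cases)
  have "pair0 t x = t ?y" if "trace0 D t" for t
  proof -
    interpret trace0 D t by fact
    show ?thesis using x(1)
      by (induction x rule: preforms_induct) (auto simp: list_length_cases add scale zero closed)
  qed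
  then have "X = class0 Q ?y"
    unfolding x(2) by (intro class0_eqI x(1) closed)
  then show "X \<in> class0 Q ` A" using closed[OF x(1)] by blast
next
  fix X assume "X \<in> class0 Q ` A"
  then show "X \<in> karoubi D 0" by (auto simp: karoubi_def class0_def)
qed

lemma class0_add:
  assumes "x \<in> A" "y \<in> A"
  shows "(\<Union>x'\<in>class0 Q x. \<Union>y'\<in>class0 Q y. karoubi_class D 0 (x' + y')) = class0 Q (x + y)"
proof -
  have "karoubi_class D 0 (x' + y') = class0 Q (x + y)" if "x' \<in> class0 Q x" "y' \<in> class0 Q y" for x' y'
    using that assms
    by (intro class0_eqI) (auto simp: mem_class0_iff functional.add[OF trace0.axioms(2)])
  moreover have "gen [x] \<in> class0 Q x" "gen [y] \<in> class0 Q y"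
    using assms by (auto simp: mem_class0_iff)
  ultimately show ?thesis by auto
qed

lemma class0_scale:
  assumes "x \<in> A"
  shows "induced D 0 (cscale c) (class0 Q x) = class0 Q (c \<cdot>\<^sub>c x)"
proof -
  have "karoubi_class D 0 (c \<cdot>\<^sub>c x') = class0 Q (c \<cdot>\<^sub>c x)" if "x' \<in> class0 Q x" for x'
    using that assms
    by (intro class0_eqI) (auto simp: mem_class0_iff functional.scale[OF trace0.axioms(2)])
  moreover have "gen [x] \<in> class0 Q x" using assms by (auto simp: mem_class0_iff)
  ultimately show ?thesis unfolding induced_def by auto
qed

lemma class0_lift_proj:
  assumes "x \<in> A"
  shows "class0 Q (necklace_lift (necklace_proj D x)) = class0 Q x"
  using assms by (subst class0_eq_iff) (auto simp: trace0.lift_proj)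

lemma class0_zero: "class0 Q 0 = karoubi_class D 0 0"
  by (rule class0_eqI[symmetric]) (auto simp: functional.zero[OF trace0.axioms(2)])

lemma necklace_class_iso: "lie_iso (necklace_lie Q) (kontsevich_lie Q) (necklace_class Q)"
  unfolding lie_iso_def lie_hom_def necklace_lie_simps kontsevich_lie_simps necklace_class_eq[abs_def]
proof (intro conjI ballI allI)
  show "bij_betw (\<lambda>f. class0 Q (necklace_lift f)) (necklace_space D) (karoubi D 0)"
    unfolding bij_betw_def
  proof
    show "inj_on (\<lambda>f. class0 Q (necklace_lift f)) (necklace_space D)"
    proof (rule inj_onI)
      fix f g assume *: "f \<in> necklace_space D" "g \<in> necklace_space D"
        "class0 Q (necklace_lift f) = class0 Q (necklace_lift g)"
      then have "necklace_proj D (necklace_lift f) = necklace_proj D (necklace_lift g)"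
        by (intro necklace_proj_eqI) (simp add: class0_eq_iff)
      then show "f = g" using * by simp
    qed
    have "class0 Q x \<in> (\<lambda>f. class0 Q (necklace_lift f)) ` necklace_space D" if "x \<in> A" for x
      using class0_lift_proj[OF that, symmetric] necklace_proj_closed[OF that] by (rule image_eqI)
    then show "(\<lambda>f. class0 Q (necklace_lift f)) ` necklace_space D = karoubi D 0"
      unfolding karoubi_0_eq by auto
  qed
  then show "(\<lambda>f. class0 Q (necklace_lift f)) ` necklace_space D \<subseteq> karoubi D 0"
    by (simp add: bij_betw_def)
next
  fix f g assume *: "f \<in> necklace_space D" "g \<in> necklace_space D"
  then show "class0 Q (necklace_lift (necklace_bracket Q f g)) =
      kontsevich_bracket Q (class0 Q (necklace_lift f)) (class0 Q (necklace_lift g))"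
    by (simp add: kontsevich_bracket_class0 necklace_bracket_eq class0_lift_proj kontsevich_closed)
qed (simp_all add: class0_add class0_scale)

lemma kontsevich_lie_algebra: "lie_algebra (kontsevich_lie Q)"
proof (rule lie_algebra_surj_hom[OF necklace_lie_algebra])
  show "lie_hom (necklace_lie Q) (kontsevich_lie Q) (necklace_class Q)"
    "necklace_class Q ` lcarrier (necklace_lie Q) = lcarrier (kontsevich_lie Q)"
    using necklace_class_iso by (auto simp: lie_iso_def bij_betw_def)
  show "necklace_class Q (lzero (necklace_lie Q)) = lzero (kontsevich_lie Q)"
    by (simp add: necklace_class_eq necklace_lie_simps kontsevich_lie_simps class0_zero)
qed

section \<open>Necklaces acting by Hamiltonian derivations\<close>

lemma tau_inv_d_eq:
  assumes "f \<in> necklace_space D"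
  shows "tau_inv_d Q f = hamiltonian (necklace_lift f)"
  unfolding tau_inv_d_def necklace_class_eq using assms by (intro inv_tau_d) simp

lemma symp_lie_simps:
  "lcarrier (symp_lie Q) = symp_derivations Q"
  "ladd (symp_lie Q) = (\<lambda>\<theta> \<eta>. \<lambda>x\<in>A. \<theta> x + \<eta> x)"
  "lzero (symp_lie Q) = (\<lambda>x\<in>A. 0)"
  "lscale (symp_lie Q) = (\<lambda>c \<theta>. \<lambda>x\<in>A. c \<cdot>\<^sub>c \<theta> x)"
  "lbracket (symp_lie Q) = (\<lambda>\<theta> \<eta>. \<lambda>x\<in>A. \<theta> (\<eta> x) - \<eta> (\<theta> x))"
  by (simp_all add: symp_lie_def Let_def)

lemma hamiltonian_add:
  assumes "x \<in> A" "y \<in> A"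
  shows "hamiltonian (x + y) = (\<lambda>z\<in>A. hamiltonian x z + hamiltonian y z)"
proof (rule derivation_eqI_tau_coeff)
  note der = hamiltonian_derivation[OF assms(1)] hamiltonian_derivation[OF assms(2)]
  interpret x: relative_derivation D "hamiltonian x" by unfold_locales (rule der)
  interpret y: relative_derivation D "hamiltonian y" by unfold_locales (rule der)
  show "(\<lambda>z\<in>A. hamiltonian x z + hamiltonian y z) \<in> derivations D"
    by (rule derivationsI) (simp_all add: free.scale_right_distrib vertex_alg_subset)
  fix b assume b: "b \<in> arcs D"
  have "tau_coeff (\<lambda>z\<in>A. hamiltonian x z + hamiltonian y z) b =
      tau_coeff (hamiltonian x) b + tau_coeff (hamiltonian y) b"
    using b by (auto simp: tau_coeff_def arr_star_closed)
  then show "tau_coeff (hamiltonian (x + y)) b = tau_coeff (\<lambda>z\<in>A. hamiltonian x z + hamiltonian y z) b"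
    using assms b by (simp add: tau_coeff_hamiltonian del: double_quiver_simps)
qed (use assms in \<open>simp add: hamiltonian_derivation\<close>)

lemma hamiltonian_scale:
  assumes "x \<in> A"
  shows "hamiltonian (c \<cdot>\<^sub>c x) = (\<lambda>z\<in>A. c \<cdot>\<^sub>c hamiltonian x z)"
proof (rule derivation_eqI_tau_coeff)
  note der = hamiltonian_derivation[OF assms]
  interpret x: relative_derivation D "hamiltonian x" by unfold_locales (rule der)
  show "(\<lambda>z\<in>A. c \<cdot>\<^sub>c hamiltonian x z) \<in> derivations D"
    by (rule derivationsI) (simp_all add: free.scale_right_distrib vertex_alg_subset mult.commute)
  fix b assume b: "b \<in> arcs D"
  have "tau_coeff (\<lambda>z\<in>A. c \<cdot>\<^sub>c hamiltonian x z) b = c \<cdot>\<^sub>c tau_coeff (hamiltonian x) b"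
    using b by (auto simp: tau_coeff_def arr_star_closed)
  then show "tau_coeff (hamiltonian (c \<cdot>\<^sub>c x)) b = tau_coeff (\<lambda>z\<in>A. c \<cdot>\<^sub>c hamiltonian x z) b"
    using assms b by (simp add: tau_coeff_hamiltonian del: double_quiver_simps)
qed (use assms in \<open>simp add: hamiltonian_derivation\<close>)

lemma zero_derivation: "(\<lambda>z\<in>A. 0) \<in> derivations D"
  by (rule derivationsI) (simp_all add: vertex_alg_subset)

lemma hamiltonian_eq_zero_iff:
  assumes "x \<in> A"
  shows "hamiltonian x = (\<lambda>z\<in>A. 0) \<longleftrightarrow> (\<forall>b\<in>arcs D. cyc_deriv D b x = 0)"
proof -
  have zero: "tau_coeff (\<lambda>z\<in>A. 0) b = 0" if "b \<in> arcs D" for b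
    using that by (auto simp: tau_coeff_def arr_star_closed)
  show ?thesis
  proof
    assume "hamiltonian x = (\<lambda>z\<in>A. 0)"
    then show "\<forall>b\<in>arcs D. cyc_deriv D b x = 0"
      using zero tau_coeff_hamiltonian[OF assms] by metis
  next
    assume "\<forall>b\<in>arcs D. cyc_deriv D b x = 0"
    then show "hamiltonian x = (\<lambda>z\<in>A. 0)"
      using zero tau_coeff_hamiltonian[OF assms]
      by (intro derivation_eqI_tau_coeff[OF hamiltonian_derivation[OF assms] zero_derivation]) metis
  qed
qed

section \<open>Vertices as the kernel\<close>

lemma vertex_lie_simps:
  "lcarrier (vertex_lie Q) = V" "ladd (vertex_lie Q) = (+)"
  "lzero (vertex_lie Q) = 0" "lscale (vertex_lie Q) = cscale" "lbracket (vertex_lie Q) = (\<lambda>x y. 0)"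
  by (simp_all add: vertex_lie_def)

lemma vertex_lie_algebra: "lie_algebra (vertex_lie Q)"
proof (unfold_locales; unfold vertex_lie_simps)
  fix x :: "('v, 'e dbl) path_vec"
  assume "x \<in> V"
  then show "\<exists>y\<in>V. x + y = 0"
    by (intro bexI[of _ "- x"]) (auto simp: vertex_alg_def)
qed (simp_all add: free.scale_right_distrib free.scale_left_distrib)

lemma vertex_to_necklace_linear:
  "vertex_to_necklace Q (x + y) = vertex_to_necklace Q x + vertex_to_necklace Q y"
  "vertex_to_necklace Q (c \<cdot>\<^sub>c x) = c \<cdot>\<^sub>c vertex_to_necklace Q x"
  "vertex_to_necklace Q 0 = 0"
  by (simp_all add: vertex_to_necklace_def)

lemma vertex_to_necklace_closed:
  assumes "x \<in> V"
  shows "vertex_to_necklace Q x \<in> necklace_space D"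
  using assms
  by (induction x rule: vertex_alg_induct)
    (auto simp: vertex_to_necklace_def intro!: necklace_of_in_necklaces simp: awalk_Nil_iff)

text \<open>A trivial path is related only to itself, so the choice of a representative is
  forced.\<close>

lemma lift_vertex_to_necklace:
  assumes "x \<in> V"
  shows "necklace_lift (vertex_to_necklace Q x) = x"
  using assms
proof (induction x rule: vertex_alg_induct)
  case (idem v)
  have "((v, [], v), necklace_rep (necklace_of D (v, [], v))) \<in> cyclic_rel D"
    by (rule necklace_rep_necklace_of) (use idem in \<open>simp add: awalk_Nil_iff\<close>)
  then have "necklace_rep (necklace_of D (v, [], v)) = (v, [], v)"
    by (auto simp: cyclic_rel_iff)
  then show ?case by (simp add: vertex_to_necklace_def)
qed (simp_all add: vertex_to_necklace_linear)

lemma cyc_deriv_vertex: "x \<in> V \<Longrightarrow> cyc_deriv D b x = 0"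
  by (simp add: cyc_deriv_eq_form_coeff vertex_alg_subset form_coeff_vertex)

lemma vertex_central:
  assumes "x \<in> V" "f \<in> necklace_space D"
  shows "necklace_bracket Q (vertex_to_necklace Q x) f = 0"
proof -
  have "kontsevich Q x y = 0" for y
    by (simp add: kontsevich_def Let_def cyc_deriv_vertex[OF assms(1)])
  then show ?thesis
    using assms by (simp add: necklace_bracket_eq vertex_to_necklace_closed lift_vertex_to_necklace)
qed

text \<open>The Euler derivation multiplies a necklace by its length, which turns vanishing of
  \<open>t (E x)\<close> into a statement about supports.\<close>

lemma proj_euler_lift:
  assumes "f \<in> necklace_space D"
  shows "Poly_Mapping.lookup (necklace_proj D (euler (necklace_lift f))) w =
    of_nat (length (fst (snd (necklace_rep w)))) * Poly_Mapping.lookup f w"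
proof -
  interpret relative_derivation D euler by unfold_locales (rule euler_derivation)
  show ?thesis
    using assms
  proof (induction f rule: necklace_space_induct)
    case (gen w')
    then obtain u p where "necklace_rep w' = (u, p, u)" "awalk u p u" "necklace_of D (u, p, u) = w'"
      by (elim necklace_rep_cases) auto
    then show ?case
      by (auto simp: euler_gen necklace_proj_gen lookup_gen)
  qed (simp_all add: lookup_add algebra_simps)
qed

lemma tau_inv_d_kernel:
  "vertex_to_necklace Q ` V = {f \<in> necklace_space D. tau_inv_d Q f = (\<lambda>z\<in>A. 0)}"
proof (intro equalityI subsetI)
  fix f assume "f \<in> vertex_to_necklace Q ` V"
  then obtain x where x: "x \<in> V" "f = vertex_to_necklace Q x" by blast
  then have "f \<in> necklace_space D" by (simp add: vertex_to_necklace_closed)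
  moreover have "hamiltonian x = (\<lambda>z\<in>A. 0)"
    using x by (simp add: hamiltonian_eq_zero_iff vertex_alg_subset cyc_deriv_vertex)
  ultimately show "f \<in> {f \<in> necklace_space D. tau_inv_d Q f = (\<lambda>z\<in>A. 0)}"
    using x by (simp add: tau_inv_d_eq lift_vertex_to_necklace)
next
  fix f assume "f \<in> {f \<in> necklace_space D. tau_inv_d Q f = (\<lambda>z\<in>A. 0)}"
  then have f: "f \<in> necklace_space D" "hamiltonian (necklace_lift f) = (\<lambda>z\<in>A. 0)"
    by (auto simp: tau_inv_d_eq)
  then have "\<forall>b\<in>arcs D. cyc_deriv D b (necklace_lift f) = 0"
    using hamiltonian_eq_zero_iff[OF necklace_lift_closed[OF f(1)]] by blast
  then have "Poly_Mapping.lookup (necklace_proj D (euler (necklace_lift f))) w = 0" for w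
    by (intro trace0_euler_eq_0[OF necklace_lift_closed[OF f(1)] _ trace0_necklace_proj]) blast
  \<comment> \<open>A necklace with nonzero coefficient must have length zero, since length times
    coefficient vanishes over the complex numbers.\<close>
  then have "length (fst (snd (necklace_rep w))) = 0" if "w \<in> Poly_Mapping.keys f" for w
    using that unfolding proj_euler_lift[OF f(1)] by (auto simp: in_keys_iff)
  then have "Poly_Mapping.keys f \<subseteq> {w \<in> necklaces D. fst (snd (necklace_rep w)) = []}"
    using f(1) by (auto simp: necklace_space_def)
  then have "necklace_lift f \<in> V \<and> vertex_to_necklace Q (necklace_lift f) = f"
  proof (induction f rule: vec_induct_on)
    case (gen w)
    then obtain v where "necklace_rep w = (v, [], v)" "awalk v [] v" "necklace_of D (v, [], v) = w"
      by (auto elim!: necklace_rep_cases)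
    then show ?case by (auto simp: vertex_to_necklace_def awalk_Nil_iff)
  qed (simp_all add: vertex_to_necklace_linear)
  then show "f \<in> vertex_to_necklace Q ` V" by (metis image_eqI)
qed

section \<open>Exactness and centrality\<close>

lemma tau_inv_d_hom: "lie_hom (necklace_lie Q) (symp_lie Q) (tau_inv_d Q)"
  unfolding lie_hom_def necklace_lie_simps symp_lie_simps
proof (intro conjI ballI allI)
  show "tau_inv_d Q ` necklace_space D \<subseteq> symp_derivations Q"
    by (auto simp: tau_inv_d_eq hamiltonian_symplectic)
next
  fix f g assume *: "f \<in> necklace_space D" "g \<in> necklace_space D"
  let ?K = "kontsevich Q (necklace_lift f) (necklace_lift g)"
  \<comment> \<open>Projecting and lifting changes the representative but not its class, hence not
    its derivation.\<close>
  have "hamiltonian (necklace_lift (necklace_proj D ?K)) = hamiltonian ?K"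
    using * by (intro hamiltonian_cong) (simp_all add: kontsevich_closed trace0.lift_proj)
  then show "tau_inv_d Q (necklace_bracket Q f g) =
      (\<lambda>x\<in>A. tau_inv_d Q f (tau_inv_d Q g x) - tau_inv_d Q g (tau_inv_d Q f x))"
    using * by (simp add: tau_inv_d_eq necklace_bracket_closed necklace_bracket_eq kontsevich_closed hamiltonian_kontsevich)
qed (simp_all add: tau_inv_d_eq hamiltonian_add hamiltonian_scale)

lemma tau_inv_d_surj: "tau_inv_d Q ` necklace_space D = symp_derivations Q"
proof (intro equalityI subsetI)
  fix \<theta> assume "\<theta> \<in> symp_derivations Q"
  then obtain x where x: "x \<in> A" "\<theta> = hamiltonian x" using symplectic_hamiltonian by blast
  then have "\<theta> = tau_inv_d Q (necklace_proj D x)"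
    by (subst tau_inv_d_eq) (auto intro!: hamiltonian_cong simp: trace0.lift_proj)
  then show "\<theta> \<in> tau_inv_d Q ` necklace_space D" using x(1) by simp
qed (auto simp: tau_inv_d_eq hamiltonian_symplectic)

lemma symp_lie_algebra: "lie_algebra (symp_lie Q)"
proof (rule lie_algebra_surj_hom[OF necklace_lie_algebra tau_inv_d_hom])
  show "tau_inv_d Q ` lcarrier (necklace_lie Q) = lcarrier (symp_lie Q)"
    unfolding necklace_lie_simps symp_lie_simps by (rule tau_inv_d_surj)
  show "tau_inv_d Q (lzero (necklace_lie Q)) = lzero (symp_lie Q)"
    by (simp add: necklace_lie_simps symp_lie_simps tau_inv_d_eq hamiltonian_eq_zero_iff)
qed

lemma vertex_to_necklace_hom: "lie_hom (vertex_lie Q) (necklace_lie Q) (vertex_to_necklace Q)"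
  unfolding lie_hom_def vertex_lie_simps necklace_lie_simps
  by (auto simp: vertex_to_necklace_linear vertex_to_necklace_closed vertex_central)

lemma necklace_short_exact:
  "lie_short_exact (vertex_lie Q) (necklace_lie Q) (symp_lie Q) (vertex_to_necklace Q) (tau_inv_d Q)"
  unfolding lie_short_exact_def
proof (intro conjI vertex_lie_algebra necklace_lie_algebra symp_lie_algebra vertex_to_necklace_hom
    tau_inv_d_hom; unfold vertex_lie_simps necklace_lie_simps symp_lie_simps)
  show "inj_on (vertex_to_necklace Q) V"
    by (rule inj_on_inverseI) (rule lift_vertex_to_necklace)
qed (rule tau_inv_d_kernel, rule tau_inv_d_surj)

lemma vertex_to_necklace_center:
  "vertex_to_necklace Q ` lcarrier (vertex_lie Q) \<subseteq> lie_center (necklace_lie Q)"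
  by (auto simp: lie_center_def vertex_lie_simps
      necklace_lie_simps vertex_to_necklace_closed vertex_central)

end

theorem theorem4p2:
  fixes Q :: "('v, 'e) pre_digraph"
  assumes "fin_digraph Q"
  shows "lie_algebra (kontsevich_lie Q)
    \<and> lie_algebra (necklace_lie Q)
    \<and> lie_iso (necklace_lie Q) (kontsevich_lie Q) (necklace_class Q)
    \<and> bij_betw (tau Q) (derivations (double_quiver Q)) (karoubi (double_quiver Q) 1)
    \<and> lie_short_exact (vertex_lie Q) (necklace_lie Q) (symp_lie Q)
        (vertex_to_necklace Q) (tau_inv_d Q)
    \<and> vertex_to_necklace Q ` lcarrier (vertex_lie Q) \<subseteq> lie_center (necklace_lie Q)"
proof -
  interpret quiver Q by (rule quiver.intro) (rule assms)
  show ?thesis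
    using kontsevich_lie_algebra necklace_lie_algebra necklace_class_iso tau_bij necklace_short_exact
      vertex_to_necklace_center by blast
qed

end
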